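(* Let $G$ be a finitely presented group with a presentation having generators $a_1,\dots,a_d$ and finitely many relations, each of the form $a_i^xa_j^y=a_k^z$ with $x,y,z\in\{-1,0,1\}$. Let $\mathcal{S}=\operatorname{span}\{I,a_1,\dots,a_d,a_1^{-1},\dots,a_d^{-1}\}\subseteq\mathbb{C}[G]$, let $\mathcal{D}\subseteq\mathcal{S}\times\mathcal{S}$ be the set of all pairs $(s,t)$ with $st\in\mathcal{S}$ (product in $\mathbb{C}[G]$), and let $m:\mathcal{D}\to\mathcal{S}$, $m(s,t)=st$. Let $\{\|\cdot\|_{n,k}\}$ be the matrix norms on $\mathcal{S}$ obtained by identifying $\mathcal{S}$ with the operator space quotient $\mathrm{MAX}(\ell^1_{2d+1})/\mathcal{J}$. Then the factorization seminorm \[ \|A\|_n^m:=\inf\{\|A_1\|\|A_2\|\cdots\|A_N\|:A=A_1\odot_m\cdots\odot_mA_N\},\qquad A\in M_n(\mathcal{S}), \] where the infimum is over all permissible factorizations ($N\ge1$ arbitrary), is an $\mathrm{L}^\infty$-matrix norm on $\mathcal{S}$. Moreover, this matrix norm agrees with the matrix norm $\mathcal{S}$ inherits from the universal group C*-algebra $C^*(G)$.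
   Context: $\mathrm{MAX}(\ell^1_{2d+1})$ is the Banach space $\ell^1_{2d+1}$ with its maximal operator space structure: for $x\in M_n(\ell^1_{2d+1})$, $\|x\|_n=\inf\{\|\alpha\|\|\beta\|:x=\alpha\,\mathrm{diag}(y_1,\dots,y_r)\beta\}$ over scalar matrices $\alpha,\beta$ and $y_1,\dots,y_r\in\ell^1_{2d+1}$ with $\|y_i\|\le1$. Let $\{e_{-d},\dots,e_{-1},e_0,e_1,\dots,e_d\}$ be the canonical basis of $\ell^1_{2d+1}$ and define the linear surjection $\pi:\ell^1_{2d+1}\to\mathcal{S}$ by $\pi(e_0)=I$, $\pi(e_i)=a_i$, $\pi(e_{-i})=a_i^{-1}$ for $i>0$; put $\mathcal{J}=\ker\pi$. The operator space quotient norm is $\|x+\mathcal{J}\|=\inf\{\|x+y\|:y\in M_{n,k}(\mathcal{J})\}$. Let $\mathcal{F}_m(\mathcal{S})$ be the quotient of the free (tensor) algebra over $\mathcal{S}$ by the ideal generated by $a\cdot b-m(a,b)$, $(a,b)\in\mathcal{D}$, with $I\in\mathcal{S}$ as its unit; $\mathcal{S}$ embeds in it. A tuple $(A_1,\dots,A_N)$ of rectangular matrices over $\mathcal{S}$ is permissible if the number of columns of $A_k$ equals the number of rows of $A_{k+1}$ for all $k$ and all entries of the matrix product $A_1\odot_m\cdots\odot_mA_N$, computed in $\mathcal{F}_m(\mathcal{S})$, lie in $\mathcal{S}$. An $\mathrm{L}^\infty$-matrix norm on a vector space is a sequence of norms $\|\cdot\|_n$ on $M_n$ of it with $\|\alpha^*A\beta\|_k\le\|\alpha\|\|A\|_n\|\beta\|$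 for scalar $\alpha,\beta\in M_{n,k}$ and $\|A\oplus B\|_{n+k}=\max(\|A\|_n,\|B\|_k)$. *)

theory Defs
  imports
    "HOL-Library.Poly_Mapping"
    "HOL-Library.Infinite_Typeclass"
    "HOL-Analysis.L2_Norm"
    "HOL-Analysis.Infinite_Sum"
    "Jordan_Normal_Form.Schur_Decomposition"
begin

text \<open>
  All complex vector spaces
  in play consist of finitely supported functions \<open>'a \<Rightarrow>\<^sub>0 complex\<close>.  In particular the group
  algebra of a group \<open>'g :: group_add\<close>, written additively but not assumed commutative, is the ring
  \<open>'g \<Rightarrow>\<^sub>0 complex\<close> with its convolution product, in which the group element \<open>g\<close> is
  \<open>Poly_Mapping.single g 1\<close> and the identity \<open>I\<close> is \<open>1\<close>.
\<close>

definition pm_scale :: "complex \<Rightarrow> ('a \<Rightarrow>\<^sub>0 complex) \<Rightarrow> ('a \<Rightarrow>\<^sub>0 complex)" where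
  "pm_scale c f = Poly_Mapping.map (\<lambda>z. c * z) f"

lemma lookup_pm_scale [simp]:
  "Poly_Mapping.lookup (pm_scale c f) x = c * Poly_Mapping.lookup f x"
  by (simp add: pm_scale_def Poly_Mapping.map.rep_eq when_def)

global_interpretation pm: vector_space pm_scale
  by unfold_locales (auto intro!: poly_mapping_eqI simp: lookup_add algebra_simps)

definition mats :: "'v set \<Rightarrow> nat \<Rightarrow> nat \<Rightarrow> 'v mat set" where
  "mats V n k = {A \<in> carrier_mat n k. elements_mat A \<subseteq> V}"

definition mat_scale :: "complex \<Rightarrow> ('a \<Rightarrow>\<^sub>0 complex) mat \<Rightarrow> ('a \<Rightarrow>\<^sub>0 complex) mat" where
  "mat_scale c A = map_mat (pm_scale c) A"

text \<open>The product \<open>\<alpha> A \<beta>\<close> of a vector-valued matrix with scalar matrices.\<close>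

definition sandwich ::
    "complex mat \<Rightarrow> ('a \<Rightarrow>\<^sub>0 complex) mat \<Rightarrow> complex mat \<Rightarrow> ('a \<Rightarrow>\<^sub>0 complex) mat" where
  "sandwich \<alpha> A \<beta> = mat (dim_row \<alpha>) (dim_col \<beta>)
     (\<lambda>(i, j). \<Sum>p<dim_row A. \<Sum>q<dim_col A. pm_scale (\<alpha> $$ (i, p) * \<beta> $$ (q, j)) (A $$ (p, q)))"

definition direct_sum_mat :: "'v::zero mat \<Rightarrow> 'v mat \<Rightarrow> 'v mat" where
  "direct_sum_mat A B =
     four_block_mat A (0\<^sub>m (dim_row A) (dim_col B)) (0\<^sub>m (dim_row B) (dim_col A)) B"

definition l2norm :: "complex vec \<Rightarrow> real" where
  "l2norm v = L2_set (\<lambda>i. cmod (v $ i)) {..<dim_vec v}"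

definition opnorm :: "complex mat \<Rightarrow> real" where
  "opnorm \<alpha> = Sup {l2norm (\<alpha> *\<^sub>v v) | v. v \<in> carrier_vec (dim_col \<alpha>) \<and> l2norm v \<le> 1}"


subsection \<open>\<open>L\<^sup>\<infinity>\<close>-matrix norms\<close>

text \<open>The sequence of norms on \<open>M\<^sub>n(V)\<close>, \<open>n \<ge> 1\<close>, is one function on matrices, since a matrix
  determines its size.\<close>

definition Linf_matrix_norm ::
    "('a \<Rightarrow>\<^sub>0 complex) set \<Rightarrow> (('a \<Rightarrow>\<^sub>0 complex) mat \<Rightarrow> real) \<Rightarrow> bool" where
  "Linf_matrix_norm V N \<longleftrightarrow>
     (\<forall>n\<ge>1. \<forall>A\<in>mats V n n. 0 \<le> N A \<and> (N A = 0 \<longleftrightarrow> A = 0\<^sub>m n n)) \<and>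
     (\<forall>n\<ge>1. \<forall>A\<in>mats V n n. \<forall>c. N (mat_scale c A) = cmod c * N A) \<and>
     (\<forall>n\<ge>1. \<forall>A\<in>mats V n n. \<forall>B\<in>mats V n n. N (A + B) \<le> N A + N B) \<and>
     (\<forall>n\<ge>1. \<forall>k\<ge>1. \<forall>A\<in>mats V n n. \<forall>\<alpha>\<in>carrier_mat n k. \<forall>\<beta>\<in>carrier_mat n k.
        N (sandwich (mat_adjoint \<alpha>) A \<beta>) \<le> opnorm \<alpha> * N A * opnorm \<beta>) \<and>
     (\<forall>n\<ge>1. \<forall>k\<ge>1. \<forall>A\<in>mats V n n. \<forall>B\<in>mats V k k.
        N (direct_sum_mat A B) = max (N A) (N B))"


subsection \<open>The generated algebra \<open>F\<^sub>m(S)\<close> and the factorization seminorm\<close>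

text \<open>Words with concatenation.  A wrapper around lists, so that no class instance is put on the
  type of lists itself.\<close>

datatype 'a fword = FWord (letters: "'a list")

instantiation fword :: (type) monoid_add
begin
definition zero_fword :: "'a fword" where "0 = FWord []"
definition plus_fword :: "'a fword \<Rightarrow> 'a fword \<Rightarrow> 'a fword" where
  "u + v = FWord (letters u @ letters v)"
instance
  by standard (auto simp: zero_fword_def plus_fword_def)
end

text \<open>The tensor algebra over \<open>S\<close> is the free algebra on one letter for each vector of \<open>S\<close>, modulo
  the relations saying that \<open>letter\<close> is linear.\<close>

definition free_alg :: "'v set \<Rightarrow> ('v fword \<Rightarrow>\<^sub>0 complex) set" where
  "free_alg S = {x. \<forall>w\<in>Poly_Mapping.keys x. set (letters w) \<subseteq> S}"

definition letter :: "'v \<Rightarrow> ('v fword \<Rightarrow>\<^sub>0 complex)" where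
  "letter s = Poly_Mapping.single (FWord [s]) 1"

inductive_set gen_ideal :: "'r::ring_1 set \<Rightarrow> 'r set \<Rightarrow> 'r set"
  for R B where
  zero: "0 \<in> gen_ideal R B"
| gen: "b \<in> B \<Longrightarrow> u \<in> R \<Longrightarrow> v \<in> R \<Longrightarrow> u * b * v \<in> gen_ideal R B"
| add: "x \<in> gen_ideal R B \<Longrightarrow> y \<in> gen_ideal R B \<Longrightarrow> x + y \<in> gen_ideal R B"

definition tensor_rels ::
    "('a \<Rightarrow>\<^sub>0 complex) set \<Rightarrow> (('a \<Rightarrow>\<^sub>0 complex) fword \<Rightarrow>\<^sub>0 complex) set" where
  "tensor_rels S =
     {letter (s + t) - letter s - letter t | s t. s \<in> S \<and> t \<in> S} \<union>
     {letter (pm_scale c s) - pm_scale c (letter s) | c s. s \<in> S}"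

text \<open>Equality in \<open>F\<^sub>m(S)\<close>, where \<open>m\<close> is a partial multiplication with domain \<open>D\<close> and unit \<open>e\<close>.\<close>

definition Fm_rels ::
    "('a \<Rightarrow>\<^sub>0 complex) set \<Rightarrow> (('a \<Rightarrow>\<^sub>0 complex) \<times> ('a \<Rightarrow>\<^sub>0 complex)) set \<Rightarrow>
     (('a \<Rightarrow>\<^sub>0 complex) \<times> ('a \<Rightarrow>\<^sub>0 complex) \<Rightarrow> ('a \<Rightarrow>\<^sub>0 complex)) \<Rightarrow> ('a \<Rightarrow>\<^sub>0 complex) \<Rightarrow>
     (('a \<Rightarrow>\<^sub>0 complex) fword \<Rightarrow>\<^sub>0 complex) set" where
  "Fm_rels S D m e =
     tensor_rels S \<union> {letter s * letter t - letter (m (s, t)) | s t. (s, t) \<in> D} \<union> {letter e - 1}"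

definition Fm_eq ::
    "('a \<Rightarrow>\<^sub>0 complex) set \<Rightarrow> (('a \<Rightarrow>\<^sub>0 complex) \<times> ('a \<Rightarrow>\<^sub>0 complex)) set \<Rightarrow>
     (('a \<Rightarrow>\<^sub>0 complex) \<times> ('a \<Rightarrow>\<^sub>0 complex) \<Rightarrow> ('a \<Rightarrow>\<^sub>0 complex)) \<Rightarrow> ('a \<Rightarrow>\<^sub>0 complex) \<Rightarrow>
     (('a \<Rightarrow>\<^sub>0 complex) fword \<Rightarrow>\<^sub>0 complex) \<Rightarrow> (('a \<Rightarrow>\<^sub>0 complex) fword \<Rightarrow>\<^sub>0 complex) \<Rightarrow> bool" where
  "Fm_eq S D m e x y \<longleftrightarrow> x - y \<in> gen_ideal (free_alg S) (Fm_rels S D m e)"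

fun mat_list_prod :: "'r::semiring_1 mat list \<Rightarrow> 'r mat" where
  "mat_list_prod [] = 1\<^sub>m 0"
| "mat_list_prod [A] = A"
| "mat_list_prod (A # B # As) = A * mat_list_prod (B # As)"

definition Fm_prod ::
    "('a \<Rightarrow>\<^sub>0 complex) mat list \<Rightarrow> (('a \<Rightarrow>\<^sub>0 complex) fword \<Rightarrow>\<^sub>0 complex) mat" where
  "Fm_prod As = mat_list_prod (map (map_mat letter) As)"

definition permissible ::
    "('a \<Rightarrow>\<^sub>0 complex) set \<Rightarrow> (('a \<Rightarrow>\<^sub>0 complex) \<times> ('a \<Rightarrow>\<^sub>0 complex)) set \<Rightarrow>
     (('a \<Rightarrow>\<^sub>0 complex) \<times> ('a \<Rightarrow>\<^sub>0 complex) \<Rightarrow> ('a \<Rightarrow>\<^sub>0 complex)) \<Rightarrow> ('a \<Rightarrow>\<^sub>0 complex) \<Rightarrow>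
     ('a \<Rightarrow>\<^sub>0 complex) mat list \<Rightarrow> bool" where
  "permissible S D m e As \<longleftrightarrow>
     As \<noteq> [] \<and>
     (\<forall>A\<in>set As. dim_row A \<ge> 1 \<and> dim_col A \<ge> 1 \<and> elements_mat A \<subseteq> S) \<and>
     (\<forall>k. Suc k < length As \<longrightarrow> dim_col (As ! k) = dim_row (As ! Suc k)) \<and>
     (\<forall>i<dim_row (Fm_prod As). \<forall>j<dim_col (Fm_prod As).
        \<exists>s\<in>S. Fm_eq S D m e (Fm_prod As $$ (i, j)) (letter s))"

definition is_factorization ::
    "('a \<Rightarrow>\<^sub>0 complex) set \<Rightarrow> (('a \<Rightarrow>\<^sub>0 complex) \<times> ('a \<Rightarrow>\<^sub>0 complex)) set \<Rightarrow>
     (('a \<Rightarrow>\<^sub>0 complex) \<times> ('a \<Rightarrow>\<^sub>0 complex) \<Rightarrow> ('a \<Rightarrow>\<^sub>0 complex)) \<Rightarrow> ('a \<Rightarrow>\<^sub>0 complex) \<Rightarrow>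
     ('a \<Rightarrow>\<^sub>0 complex) mat \<Rightarrow> ('a \<Rightarrow>\<^sub>0 complex) mat list \<Rightarrow> bool" where
  "is_factorization S D m e A As \<longleftrightarrow>
     permissible S D m e As \<and>
     dim_row (Fm_prod As) = dim_row A \<and> dim_col (Fm_prod As) = dim_col A \<and>
     (\<forall>i<dim_row A. \<forall>j<dim_col A.
        Fm_eq S D m e (Fm_prod As $$ (i, j)) (letter (A $$ (i, j))))"

definition fact_norm ::
    "(('a \<Rightarrow>\<^sub>0 complex) mat \<Rightarrow> real) \<Rightarrow>
     ('a \<Rightarrow>\<^sub>0 complex) set \<Rightarrow> (('a \<Rightarrow>\<^sub>0 complex) \<times> ('a \<Rightarrow>\<^sub>0 complex)) set \<Rightarrow>
     (('a \<Rightarrow>\<^sub>0 complex) \<times> ('a \<Rightarrow>\<^sub>0 complex) \<Rightarrow> ('a \<Rightarrow>\<^sub>0 complex)) \<Rightarrow> ('a \<Rightarrow>\<^sub>0 complex) \<Rightarrow>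
     ('a \<Rightarrow>\<^sub>0 complex) mat \<Rightarrow> real" where
  "fact_norm N S D m e A = Inf {prod_list (map N As) | As. is_factorization S D m e A As}"


subsection \<open>The operator space \<open>MAX(\<ell>\<^sup>1\<^bsub>2d+1\<^esub>)\<close>\<close>

text \<open>The coordinates are indexed by the integers \<open>-d, \<dots>, d\<close>.  The convolution product on
  \<open>int \<Rightarrow>\<^sub>0 complex\<close> plays no role.\<close>

definition ell1 :: "nat \<Rightarrow> (int \<Rightarrow>\<^sub>0 complex) set" where
  "ell1 d = {y. Poly_Mapping.keys y \<subseteq> {- int d..int d}}"

definition ell1_norm :: "nat \<Rightarrow> (int \<Rightarrow>\<^sub>0 complex) \<Rightarrow> real" where
  "ell1_norm d y = (\<Sum>t\<in>{- int d..int d}. cmod (Poly_Mapping.lookup y t))"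

definition diag_of :: "nat \<Rightarrow> (nat \<Rightarrow> 'v::zero) \<Rightarrow> 'v mat" where
  "diag_of r y = mat r r (\<lambda>(i, j). if i = j then y i else 0)"

definition max_norm :: "nat \<Rightarrow> (int \<Rightarrow>\<^sub>0 complex) mat \<Rightarrow> real" where
  "max_norm d x = Inf {opnorm \<alpha> * opnorm \<beta> | \<alpha> \<beta> r y.
     \<alpha> \<in> carrier_mat (dim_row x) r \<and> \<beta> \<in> carrier_mat r (dim_col x) \<and>
     (\<forall>l<r. y l \<in> ell1 d \<and> ell1_norm d (y l) \<le> 1) \<and>
     x = sandwich \<alpha> (diag_of r y) \<beta>}"


subsection \<open>The space \<open>S\<close> and its quotient matrix norms\<close>

definition gen_space :: "(nat \<Rightarrow> 'g::group_add) \<Rightarrow> nat \<Rightarrow> ('g \<Rightarrow>\<^sub>0 complex) set" where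
  "gen_space a d = pm.span
     ({1} \<union> (\<lambda>i. Poly_Mapping.single (a i) 1) ` {1..d} \<union> (\<lambda>i. Poly_Mapping.single (- a i) 1) ` {1..d})"

definition signed_gen :: "(nat \<Rightarrow> 'g::group_add) \<Rightarrow> int \<Rightarrow> 'g" where
  "signed_gen a t = (if t = 0 then 0 else if t > 0 then a (nat t) else - a (nat (- t)))"

definition ell1_proj ::
    "(nat \<Rightarrow> 'g::group_add) \<Rightarrow> nat \<Rightarrow> (int \<Rightarrow>\<^sub>0 complex) \<Rightarrow> ('g \<Rightarrow>\<^sub>0 complex)" where
  "ell1_proj a d y =
     (\<Sum>t\<in>{- int d..int d}. Poly_Mapping.single (signed_gen a t) (Poly_Mapping.lookup y t))"

definition ell1_ker :: "(nat \<Rightarrow> 'g::group_add) \<Rightarrow> nat \<Rightarrow> (int \<Rightarrow>\<^sub>0 complex) set" where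
  "ell1_ker a d = {y \<in> ell1 d. ell1_proj a d y = 0}"

definition max_quot_norm ::
    "(nat \<Rightarrow> 'g::group_add) \<Rightarrow> nat \<Rightarrow> (int \<Rightarrow>\<^sub>0 complex) mat \<Rightarrow> real" where
  "max_quot_norm a d x =
     Inf {max_norm d (x + y) | y. y \<in> mats (ell1_ker a d) (dim_row x) (dim_col x)}"

text \<open>The norm transported to \<open>S\<close>; it does not depend on the chosen representative \<open>x\<close>.\<close>

definition gen_space_norm ::
    "(nat \<Rightarrow> 'g::group_add) \<Rightarrow> nat \<Rightarrow> ('g \<Rightarrow>\<^sub>0 complex) mat \<Rightarrow> real" where
  "gen_space_norm a d A = max_quot_norm a d
     (SOME x. x \<in> mats (ell1 d) (dim_row A) (dim_col A) \<and> map_mat (ell1_proj a d) x = A)"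


subsection \<open>Group presentations\<close>

text \<open>A word is a list of letters \<open>(i, b)\<close>, standing for the generator \<open>a i\<close> if \<open>b\<close> holds and for
  its inverse otherwise.  The presented group consists of the words modulo the congruence generated
  by free cancellation and the relations.\<close>

inductive word_eq ::
    "nat \<Rightarrow> ((nat \<times> bool) list \<times> (nat \<times> bool) list) set \<Rightarrow>
     (nat \<times> bool) list \<Rightarrow> (nat \<times> bool) list \<Rightarrow> bool"
  for d R where
  refl: "word_eq d R w w"
| sym: "word_eq d R v w \<Longrightarrow> word_eq d R w v"
| trans: "word_eq d R u v \<Longrightarrow> word_eq d R v w \<Longrightarrow> word_eq d R u w"
| cancel: "i \<in> {1..d} \<Longrightarrow> word_eq d R (u @ [(i, b), (i, \<not> b)] @ v) (u @ v)"
| rel: "(l, r) \<in> R \<Longrightarrow> word_eq d R (u @ l @ v) (u @ r @ v)"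

definition word_val :: "(nat \<Rightarrow> 'g::group_add) \<Rightarrow> (nat \<times> bool) list \<Rightarrow> 'g" where
  "word_val a w = sum_list (map (\<lambda>(i, b). if b then a i else - a i) w)"

definition presented_by ::
    "(nat \<Rightarrow> 'g::group_add) \<Rightarrow> nat \<Rightarrow>
     ((nat \<times> bool) list \<times> (nat \<times> bool) list) set \<Rightarrow> bool" where
  "presented_by a d R \<longleftrightarrow>
     word_val a ` lists ({1..d} \<times> UNIV) = UNIV \<and>
     (\<forall>v\<in>lists ({1..d} \<times> UNIV). \<forall>w\<in>lists ({1..d} \<times> UNIV).
        word_val a v = word_val a w \<longleftrightarrow> word_eq d R v w)"

text \<open>The word \<open>a\<^sub>i\<^sup>x\<close>, only meaningful for \<open>x \<in> {-1, 0, 1}\<close>.\<close>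

definition pow_word :: "nat \<times> int \<Rightarrow> (nat \<times> bool) list" where
  "pow_word = (\<lambda>(i, x). if x = 0 then [] else [(i, x > 0)])"

text \<open>The triple \<open>((i, x), (j, y), (k, z))\<close> encodes the relation \<open>a\<^sub>i\<^sup>x a\<^sub>j\<^sup>y = a\<^sub>k\<^sup>z\<close>.\<close>

definition relation_words ::
    "((nat \<times> int) \<times> (nat \<times> int) \<times> (nat \<times> int)) set \<Rightarrow>
     ((nat \<times> bool) list \<times> (nat \<times> bool) list) set" where
  "relation_words R = (\<lambda>(p, q, s). (pow_word p @ pow_word q, pow_word s)) ` R"


subsection \<open>Matrix norms of the universal group C*-algebra\<close>

text \<open>The norm of \<open>M\<^sub>n(C*(G))\<close> on \<open>M\<^sub>n(\<complex>[G])\<close> is the supremum of \<open>\<parallel>\<rho>(A)\<parallel>\<close> over all unitary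
  representations \<open>\<rho>\<close> of \<open>G\<close>.  Up to unitary equivalence a Hilbert space is \<open>\<ell>\<^sup>2(X)\<close> for some set \<open>X\<close>.
  Here \<open>X\<close> ranges over all subsets of an index type \<open>'i\<close>; for countable \<open>G\<close> every infinite \<open>'i\<close>
  gives the same supremum as all Hilbert spaces, because a closed invariant subspace generated by
  finitely many vectors is separable.\<close>

definition ell2 :: "'i set \<Rightarrow> ('i \<Rightarrow> complex) set" where
  "ell2 X = {f. (\<forall>i. i \<notin> X \<longrightarrow> f i = 0) \<and> (\<lambda>i. (cmod (f i))\<^sup>2) summable_on X}"

definition ell2_inner :: "'i set \<Rightarrow> ('i \<Rightarrow> complex) \<Rightarrow> ('i \<Rightarrow> complex) \<Rightarrow> complex" where
  "ell2_inner X f g = (\<Sum>\<^sub>\<infinity>i\<in>X. f i * cnj (g i))"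

definition ell2_norm :: "'i set \<Rightarrow> ('i \<Rightarrow> complex) \<Rightarrow> real" where
  "ell2_norm X f = sqrt (\<Sum>\<^sub>\<infinity>i\<in>X. (cmod (f i))\<^sup>2)"

definition unitary_op :: "'i set \<Rightarrow> (('i \<Rightarrow> complex) \<Rightarrow> ('i \<Rightarrow> complex)) \<Rightarrow> bool" where
  "unitary_op X U \<longleftrightarrow>
     U ` ell2 X = ell2 X \<and>
     (\<forall>f\<in>ell2 X. \<forall>g\<in>ell2 X. U (\<lambda>i. f i + g i) = (\<lambda>i. U f i + U g i)) \<and>
     (\<forall>c. \<forall>f\<in>ell2 X. U (\<lambda>i. c * f i) = (\<lambda>i. c * U f i)) \<and>
     (\<forall>f\<in>ell2 X. \<forall>g\<in>ell2 X. ell2_inner X (U f) (U g) = ell2_inner X f g)"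

definition unitary_rep ::
    "'i set \<Rightarrow> ('g::group_add \<Rightarrow> ('i \<Rightarrow> complex) \<Rightarrow> ('i \<Rightarrow> complex)) \<Rightarrow> bool" where
  "unitary_rep X \<rho> \<longleftrightarrow>
     (\<forall>g. unitary_op X (\<rho> g)) \<and>
     (\<forall>f\<in>ell2 X. \<rho> 0 f = f) \<and>
     (\<forall>g h. \<forall>f\<in>ell2 X. \<rho> (g + h) f = \<rho> g (\<rho> h f))"

definition rep_ext ::
    "('g \<Rightarrow> ('i \<Rightarrow> complex) \<Rightarrow> ('i \<Rightarrow> complex)) \<Rightarrow> ('g \<Rightarrow>\<^sub>0 complex) \<Rightarrow>
     ('i \<Rightarrow> complex) \<Rightarrow> ('i \<Rightarrow> complex)" where
  "rep_ext \<rho> x f = (\<lambda>i. \<Sum>g\<in>Poly_Mapping.keys x. Poly_Mapping.lookup x g * \<rho> g f i)"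

text \<open>The operator norm of \<open>(\<rho>(A\<^sub>i\<^sub>j))\<close> from \<open>\<ell>\<^sup>2(X)\<^sup>k\<close> to \<open>\<ell>\<^sup>2(X)\<^sup>n\<close>.\<close>

definition rep_mat_norm ::
    "'i set \<Rightarrow> ('g \<Rightarrow> ('i \<Rightarrow> complex) \<Rightarrow> ('i \<Rightarrow> complex)) \<Rightarrow> ('g \<Rightarrow>\<^sub>0 complex) mat \<Rightarrow> real" where
  "rep_mat_norm X \<rho> A = Sup
     {L2_set (\<lambda>i. ell2_norm X (\<lambda>t. \<Sum>j<dim_col A. rep_ext \<rho> (A $$ (i, j)) (\<xi> j) t)) {..<dim_row A}
      | \<xi>. (\<forall>j<dim_col A. \<xi> j \<in> ell2 X) \<and> L2_set (\<lambda>j. ell2_norm X (\<xi> j)) {..<dim_col A} \<le> 1}"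

definition cstar_mat_norm :: "'i itself \<Rightarrow> ('g::group_add \<Rightarrow>\<^sub>0 complex) mat \<Rightarrow> real" where
  "cstar_mat_norm _ A = Sup {rep_mat_norm X \<rho> A | (X :: 'i set) \<rho>. unitary_rep X \<rho>}"

end

theory Submission imports Defs "HOL-Analysis.Convex" begin

text \<open>Each defining relation, and each cancellation of a generator against its inverse, says
  that a product of two elements of S is an element of S. So all of them already hold in F_m(S), and
  evaluation from F_m(S) to the group algebra is injective (\<open>Fm_eq_iff_eval\<close>). A
  permissible factorization is therefore an ordinary matrix factorization over the group algebra
  whose factors have entries in S (\<open>is_factorizationI\<close>,
  \<open>is_factorizationD\<close>).

  One inequality is direct. A unitary representation sends the unit ball of the l1 space to
  contractions, hence is completely contractive for the quotient norm
  (\<open>op_bound_gen_space_norm\<close>); being multiplicative, it bounds the C*-norm by every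
  product of factor norms (\<open>cstar_le_fact_norm\<close>).

  For the converse a matrix is read as the list of its rows, each a finitely supported vector on
  pairs (group element, column). Left multiplication by a scalar contraction, or by a diagonal
  matrix of signed generators, is multiplication by a factor of norm at most 1.
  \<open>reach Y Z\<close> says that finitely many such steps lead from Z to Y. If the rows of A are
  reachable from s times the unit rows E, then the factorization norm is at most s
  (\<open>fact_norm_le_reach\<close>). It remains to show that every s above the C*-norm is reached.

  Suppose s is not reached. Up to reachability only the Gram form Y^* Y of a list counts
  (\<open>douglas\<close>, \<open>reach_gram\<close>). Call t admissible for a Hermitian form u if u
  = Y^* Y - Z^* Z with Y reachable from sqrt t E together with Z; the infimum of such t is a
  sublinear gauge. The auxiliary list Z works as a catalyst, and it can be removed at arbitrarily
  small cost (\<open>reach_cancel\<close>): n copies are run in a cascade that hands Z on,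
  everything is scaled by 1 / sqrt n, and the cost of Z tends to 0. So the Gram form of A has gauge
  at least s^2 (\<open>gauge_gram\<close>). Hahn-Banach then gives a positive semidefinite form h
  that no generator increases, of total mass at most 1 on E and at least s^2 on the rows of A
  (\<open>dual_form\<close>). Since generators come with their inverses, h is invariant under the
  group (\<open>dual_invariant\<close>), and the GNS construction
  (\<open>gns_representation\<close>) yields a unitary representation \<rho> and a vector \<xi> of
  norm at most 1 for which \<rho>(A)\<xi> has norm at least s (\<open>cstar_ge\<close>). The group
  is countable, so the Hilbert space lives on a subset of any infinite index type.

  The axioms of a matrix norm are then read off from the C*-norm. Definiteness comes from the GNS
  representation of the standard inner product.\<close>

section \<open>Semi-inner products and Gram-Schmidt for degenerate forms\<close>

locale semi_inner =
  vector_space scale for scale :: "complex \<Rightarrow> 'v::ab_group_add \<Rightarrow> 'v" +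
  fixes h :: "'v \<Rightarrow> 'v \<Rightarrow> complex"
  assumes h_add: "h x (y + z) = h x y + h x z"
    and h_scale: "h x (scale c y) = c * h x y"
    and h_sym: "h y x = cnj (h x y)"
    and h_nonneg: "0 \<le> Re (h x x)"
begin

lemma h_add_left: "h (x + y) z = h x z + h y z"
  by (metis h_add h_sym complex_cnj_add)

lemma h_scale_left: "h (scale c x) y = cnj c * h x y"
  by (metis h_scale h_sym complex_cnj_mult)

lemma h_zero [simp]: "h x 0 = 0" "h 0 x = 0"
  using h_scale[of _ 0] h_scale_left[of 0] by auto

lemma h_minus: "h x (- y) = - h x y" "h (- x) y = - h x y"
  by (metis add.right_inverse add_eq_0_iff h_add h_zero(1))
     (metis add.right_inverse add_eq_0_iff h_add_left h_zero(2))

lemma h_diff: "h x (y - z) = h x y - h x z" "h (x - y) z = h x z - h y z"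
  using h_add[of x y "- z"] h_add_left[of x "- y" z] by (simp_all add: h_minus)

lemma h_sum: "h x (\<Sum>i\<in>I. f i) = (\<Sum>i\<in>I. h x (f i))"
  by (induction I rule: infinite_finite_induct) (auto simp: h_add)

lemma h_sum_left: "h (\<Sum>i\<in>I. f i) x = (\<Sum>i\<in>I. h (f i) x)"
  by (induction I rule: infinite_finite_induct) (auto simp: h_add_left)

lemma h_self: "h x x = of_real (Re (h x x))"
  using h_sym[of x x] by (metis complex_cnj_cancel_iff Reals_cnj_iff of_real_Re)

text \<open>Adding a suitable multiple of the null vector to \<open>y\<close> would otherwise make
  the square negative.\<close>

lemma null_orthogonal:
  assumes "h x x = 0" shows "h x y = 0"
proof (rule ccontr)
  let ?a = "h x y"
  assume a: "?a \<noteq> 0"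
  \<comment> \<open>Chosen so that the square of \<open>y + scale c x\<close> has real part exactly
    -1.\<close>
  define s where "s = (Re (h y y) + 1) / (2 * (cmod ?a)\<^sup>2)"
  define c where "c = - (of_real s * ?a)"
  have "h (y + scale c x) (y + scale c x) = h y y + c * cnj ?a + cnj c * ?a"
    using assms h_sym[of x y] by (simp add: h_add h_add_left h_scale h_scale_left algebra_simps)
  also have "\<dots> = h y y - of_real (2 * s * (cmod ?a)\<^sup>2)"
    by (simp add: c_def complex_norm_square[symmetric] mult.commute[of _ ?a] mult.assoc
        flip: of_real_mult) (simp add: complex_norm_square algebra_simps)
  finally have "Re (h (y + scale c x) (y + scale c x)) = Re (h y y) - 2 * s * (cmod ?a)\<^sup>2"
    by simp
  moreover have "2 * s * (cmod ?a)\<^sup>2 = Re (h y y) + 1" using a by (simp add: s_def)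
  ultimately show False using h_nonneg[of "y + scale c x"] by simp
qed

text \<open>Zero vectors are admitted so that Gram--Schmidt needs no reindexing.\<close>

definition orthonormal_or_zero :: "('k \<Rightarrow> 'v) \<Rightarrow> 'k set \<Rightarrow> bool" where
  "orthonormal_or_zero e I \<longleftrightarrow>
     (\<forall>k\<in>I. e k = 0 \<or> h (e k) (e k) = 1) \<and> (\<forall>k\<in>I. \<forall>l\<in>I. k \<noteq> l \<longrightarrow> h (e k) (e l) = 0)"

lemma orthonormal_or_zero_sum:
  assumes "orthonormal_or_zero e I" "finite J" "J \<subseteq> I" "k \<in> I"
  shows "(\<Sum>l\<in>J. c l * h (e k) (e l)) = (if k \<in> J then c k * h (e k) (e k) else 0)"
proof -
  have "(\<Sum>l\<in>J. c l * h (e k) (e l)) = (\<Sum>l\<in>J. if l = k then c k * h (e k) (e k) else 0)"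
    using assms unfolding orthonormal_or_zero_def by (intro sum.cong HOL.refl) (auto simp: subset_iff)
  then show ?thesis using assms(2) by simp
qed

lemma h_expand:
  assumes "orthonormal_or_zero e I" "finite J" "J \<subseteq> I"
  shows "h (\<Sum>k\<in>J. scale (c k) (e k)) (\<Sum>k\<in>J. scale (c k) (e k)) =
    (\<Sum>k\<in>J. of_real ((cmod (c k))\<^sup>2) * h (e k) (e k))"
proof -
  have "h (\<Sum>k\<in>J. scale (c k) (e k)) (\<Sum>k\<in>J. scale (c k) (e k)) =
     (\<Sum>k\<in>J. cnj (c k) * (\<Sum>l\<in>J. c l * h (e k) (e l)))"
    by (simp add: h_sum h_sum_left h_scale h_scale_left sum_distrib_left algebra_simps)
       (subst sum.swap, simp)
  also have "\<dots> = (\<Sum>k\<in>J. of_real ((cmod (c k))\<^sup>2) * h (e k) (e k))"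
  proof (rule sum.cong[OF HOL.refl])
    fix k assume k: "k \<in> J"
    then have "(\<Sum>l\<in>J. c l * h (e k) (e l)) = c k * h (e k) (e k)"
      using orthonormal_or_zero_sum[OF assms, of k c] assms(3) by auto
    then show "cnj (c k) * (\<Sum>l\<in>J. c l * h (e k) (e l)) = of_real ((cmod (c k))\<^sup>2) * h (e k) (e k)"
      by (simp only: complex_norm_square mult_ac)
  qed
  finally show ?thesis .
qed

lemma bessel:
  assumes "orthonormal_or_zero e I" "finite J" "J \<subseteq> I"
  shows "(\<Sum>k\<in>J. (cmod (h (e k) x))\<^sup>2) \<le> Re (h x x)"
proof -
  define p where "p = (\<Sum>k\<in>J. scale (h (e k) x) (e k))"
  have e: "of_real ((cmod (h (e k) x))\<^sup>2) * h (e k) (e k) = of_real ((cmod (h (e k) x))\<^sup>2)"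
    if "k \<in> J" for k
  proof -
    have "e k = 0 \<or> h (e k) (e k) = 1"
      using assms that unfolding orthonormal_or_zero_def by blast
    then show ?thesis by auto
  qed
  have pp: "h p p = of_real (\<Sum>k\<in>J. (cmod (h (e k) x))\<^sup>2)"
    unfolding p_def h_expand[OF assms] of_real_sum by (rule sum.cong[OF HOL.refl e])
  have xp: "h x p = of_real (\<Sum>k\<in>J. (cmod (h (e k) x))\<^sup>2)"
  proof -
    have "h (e k) x * h x (e k) = of_real ((cmod (h (e k) x))\<^sup>2)" for k
      by (subst (2) h_sym) (rule complex_norm_square[symmetric])
    then show ?thesis by (simp add: p_def h_sum h_scale del: of_real_power)
  qed
  have px: "h p x = of_real (\<Sum>k\<in>J. (cmod (h (e k) x))\<^sup>2)"
    by (subst h_sym) (simp only: xp complex_cnj_complex_of_real)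
  have "0 \<le> Re (h (x - p) (x - p))" by (rule h_nonneg)
  then show ?thesis by (simp add: h_diff pp px xp)
qed

text \<open>A residual can be null for \<open>h\<close> without being the vector 0. It is then
  replaced by 0, which loses nothing that \<open>h\<close> can see, since null vectors are
  orthogonal to everything.\<close>

function gs :: "(nat \<Rightarrow> 'v) \<Rightarrow> nat \<Rightarrow> 'v" where
  "gs b k = (let r = b k - (\<Sum>j<k. scale (h (gs b j) (b k)) (gs b j)) in
     if h r r = 0 then 0 else scale (1 / of_real (sqrt (Re (h r r)))) r)"
  by auto
termination by (relation "measure snd") auto

declare gs.simps [simp del]

lemma gs_properties:
  defines "r \<equiv> \<lambda>b k. b k - (\<Sum>j<k. scale (h (gs b j) (b k)) (gs b j))"
  shows "gs b k = 0 \<or> h (gs b k) (gs b k) = 1"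
    and "l < k \<Longrightarrow> h (gs b l) (gs b k) = 0"
    and "h y (b k) = (\<Sum>j\<le>k. h y (gs b j) * h (gs b j) (b k))"
proof -
  have gs: "gs b k = (if h (r b k) (r b k) = 0 then 0
      else scale (1 / of_real (sqrt (Re (h (r b k) (r b k))))) (r b k))" for k
    by (subst gs.simps) (simp add: r_def Let_def)
  show norm1: "gs b k = 0 \<or> h (gs b k) (gs b k) = 1" for k
  proof (cases "h (r b k) (r b k) = 0")
    case False
    let ?n = "Re (h (r b k) (r b k))"
    have n: "?n > 0" using False h_nonneg h_self by (metis less_eq_real_def of_real_0)
    have "h (gs b k) (gs b k) = of_real (1 / sqrt ?n) * (of_real (1 / sqrt ?n) * h (r b k) (r b k))"
      using False by (subst (1 2) gs) (simp add: h_scale h_scale_left)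
    also have "\<dots> = of_real (1 / sqrt ?n * (1 / sqrt ?n) * ?n)"
      by (subst h_self) (simp only: of_real_mult mult.assoc)
    also have "1 / sqrt ?n * (1 / sqrt ?n) * ?n = 1"
      using n by (simp add: field_simps)
    finally show ?thesis by simp
  qed (simp add: gs)
  have orth: "\<forall>l<k. h (gs b l) (gs b k) = 0" for k
  proof (induction k rule: less_induct)
    case (less k)
    have o: "h (gs b i) (gs b j) = 0" if "i < k" "j < k" "i \<noteq> j" for i j
      using that less.IH by (metis complex_cnj_zero h_sym linorder_neqE_nat)
    have "h (gs b l) (r b k) = 0" if "l < k" for l
    proof -
      have "(\<Sum>j<k. h (gs b j) (b k) * h (gs b l) (gs b j)) =
         (\<Sum>j<k. if j = l then h (gs b l) (b k) * h (gs b l) (gs b l) else 0)"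
        using o that by (intro sum.cong) auto
      also have "\<dots> = h (gs b l) (b k) * h (gs b l) (gs b l)" using that by simp
      also have "\<dots> = h (gs b l) (b k)" using norm1[of l] by auto
      finally show ?thesis by (simp add: r_def h_diff h_sum h_scale)
    qed
    then show ?case by (subst gs) (auto simp: h_scale)
  qed
  then show "l < k \<Longrightarrow> h (gs b l) (gs b k) = 0" by blast
  \<comment> \<open>If the residual is null, both sides vanish; otherwise the residual is its own
    length times \<open>gs b k\<close>.\<close>
  have rgs: "h y (r b k) = h y (gs b k) * h (gs b k) (b k)" for y
  proof (cases "h (r b k) (r b k) = 0")
    case True
    then have "h y (r b k) = 0" using null_orthogonal h_sym by (metis complex_cnj_zero)
    then show ?thesis using True by (simp add: gs[of k])
  next
    case False
    let ?n = "Re (h (r b k) (r b k))"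
    have n: "?n > 0" using False h_nonneg h_self by (metis less_eq_real_def of_real_0)
    have "h (gs b k) (b k) = h (gs b k) (r b k)"
    proof -
      have "h (gs b k) (gs b j) = 0" if "j < k" for j
        using orth[of k] that h_sym[of "gs b j" "gs b k"] by simp
      then show ?thesis by (simp add: r_def h_diff h_sum h_scale)
    qed
    also have "\<dots> = of_real (1 / sqrt ?n) * of_real ?n"
      using False by (subst gs) (simp add: h_scale_left h_self[symmetric])
    finally have gb: "h (gs b k) (b k) = of_real (1 / sqrt ?n) * of_real ?n" .
    have "h y (gs b k) * h (gs b k) (b k) = of_real (1 / sqrt ?n * (1 / sqrt ?n) * ?n) * h y (r b k)"
    proof -
      have "h y (gs b k) = of_real (1 / sqrt ?n) * h y (r b k)"
        using False by (subst gs) (simp add: h_scale)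
      then show ?thesis by (simp only: gb of_real_mult mult_ac)
    qed
    also have "1 / sqrt ?n * (1 / sqrt ?n) * ?n = 1"
      using n by (simp add: field_simps)
    finally show ?thesis by simp
  qed
  have "h y (b k) = h y (r b k) + (\<Sum>j<k. h y (gs b j) * h (gs b j) (b k))"
    by (simp add: r_def h_diff h_sum h_scale mult.commute)
  then show "h y (b k) = (\<Sum>j\<le>k. h y (gs b j) * h (gs b j) (b k))"
    by (simp add: rgs lessThan_Suc_atMost[symmetric])
qed

lemma gs_subspace:
  assumes "subspace V" "range b \<subseteq> V" shows "gs b k \<in> V"
proof (induction k rule: less_induct)
  case (less k)
  have "b k - (\<Sum>j<k. scale (h (gs b j) (b k)) (gs b j)) \<in> V"
    using assms(2) less by (intro subspace_diff subspace_sum subspace_scale assms(1)) auto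
  then show ?case
    by (subst gs.simps) (simp add: Let_def subspace_0 subspace_scale assms(1))
qed

text \<open>The expansion of \<open>b k\<close> is stated inside \<open>h\<close> because it holds
  only modulo null vectors. Its upper limit may be any \<open>N\<close> above \<open>k\<close>, as
  later vectors of \<open>e\<close> are orthogonal to \<open>b k\<close>, so finitely many
  \<open>b k\<close> can share one limit.\<close>

lemma gram_schmidt:
  fixes b :: "nat \<Rightarrow> 'v"
  obtains e where "orthonormal_or_zero e (UNIV :: nat set)"
    and "\<And>V k. subspace V \<Longrightarrow> range b \<subseteq> V \<Longrightarrow> e k \<in> V"
    and "\<And>k N y. k \<le> N \<Longrightarrow> h y (b k) = (\<Sum>j\<le>N. h y (e j) * h (e j) (b k))"
proof
  have o: "h (gs b k) (gs b l) = 0" if "k \<noteq> l" for k l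
    using that gs_properties(2)[of k l b] gs_properties(2)[of l k b] h_sym
    by (metis complex_cnj_zero linorder_neqE_nat)
  show "orthonormal_or_zero (gs b) UNIV"
    unfolding orthonormal_or_zero_def using gs_properties(1) o by blast
  show "gs b k \<in> V" if "subspace V" "range b \<subseteq> V" for V k
    by (rule gs_subspace[OF that])
  show "h y (b k) = (\<Sum>j\<le>N. h y (gs b j) * h (gs b j) (b k))" if "k \<le> N" for k N y
  proof -
    have "h (gs b j) (b k) = 0" if "j > k" for j
      using that o[of j] by (subst gs_properties(3)) (auto intro!: sum.neutral)
    then show ?thesis
      using that by (subst gs_properties(3)) (intro sum.mono_neutral_left, auto simp: not_le)
  qed
qed

end

section \<open>Gram forms of lists of vectors and factorization through contractions\<close>

abbreviation lk :: "('b \<Rightarrow>\<^sub>0 complex) \<Rightarrow> 'b \<Rightarrow> complex" where "lk \<equiv> Poly_Mapping.lookup"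

lemma sum_lessThan_add:
  "(\<Sum>i<m + n. f i) = (\<Sum>i<m. f i) + (\<Sum>i<n. f (m + i :: nat) :: 'a :: comm_monoid_add)"
  by (induction n) (simp_all add: add.assoc)

lemma lookup_sum: "lk (\<Sum>i\<in>I. f i) b = (\<Sum>i\<in>I. lk (f i) b)"
  by (induction I rule: infinite_finite_induct) (auto simp: lookup_add)

text \<open>The matrix Y^* Y, where the list is read as a matrix whose rows are its vectors.\<close>

definition gram :: "('b \<Rightarrow>\<^sub>0 complex) list \<Rightarrow> 'b \<Rightarrow> 'b \<Rightarrow> complex" where
  "gram Y b b' = (\<Sum>y\<leftarrow>Y. cnj (lk y b) * lk y b')"

lemma gram_Nil [simp]: "gram [] b b' = 0"
  and gram_Cons [simp]: "gram (y # Y) b b' = cnj (lk y b) * lk y b' + gram Y b b'"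
  and gram_append [simp]: "gram (Y @ Z) b b' = gram Y b b' + gram Z b b'"
  by (simp_all add: gram_def)

lemma gram_scale [simp]: "gram (map (pm_scale c) Y) b b' = of_real ((cmod c)\<^sup>2) * gram Y b b'"
  by (induction Y) (auto simp: algebra_simps complex_norm_square simp del: of_real_power)

lemma gram_sum: "gram Y b b' = (\<Sum>i<length Y. cnj (lk (Y ! i) b) * lk (Y ! i) b')"
  by (simp add: gram_def sum_list_sum_nth atLeast0LessThan)

definition contraction :: "nat \<Rightarrow> nat \<Rightarrow> (nat \<Rightarrow> nat \<Rightarrow> complex) \<Rightarrow> bool" where
  "contraction m k \<alpha> \<longleftrightarrow>
     (\<forall>v. (\<Sum>i<m. (cmod (\<Sum>j<k. \<alpha> i j * v j))\<^sup>2) \<le> (\<Sum>j<k. (cmod (v j))\<^sup>2))"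

lemma contraction_mono: "contraction m k \<alpha> \<Longrightarrow> m' \<le> m \<Longrightarrow> contraction m' k \<alpha>"
  unfolding contraction_def
  by (meson order_trans sum_mono2 finite_lessThan lessThan_subset_iff zero_le_power2)

definition mat_apply ::
    "nat \<Rightarrow> (nat \<Rightarrow> nat \<Rightarrow> complex) \<Rightarrow> ('b \<Rightarrow>\<^sub>0 complex) list \<Rightarrow> ('b \<Rightarrow>\<^sub>0 complex) list" where
  "mat_apply m \<alpha> Z = map (\<lambda>i. \<Sum>j<length Z. pm_scale (\<alpha> i j) (Z ! j)) [0..<m]"

lemma length_mat_apply [simp]: "length (mat_apply m \<alpha> Z) = m"
  by (simp add: mat_apply_def)

text \<open>The block matrix of \<alpha> and an identity, which lets \<alpha> act on some rows while
  the others are carried along.\<close>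

lemma contraction_block:
  assumes "contraction m k \<alpha>"
  shows "contraction (m + l) (k + l) (\<lambda>i j. if i < m then (if j < k then \<alpha> i j else 0)
     else if j = i - m + k then 1 else 0)" (is "contraction _ _ ?\<beta>")
  unfolding contraction_def
proof
  fix v
  have "(\<Sum>j<k + l. ?\<beta> i j * v j) = (\<Sum>j<k. \<alpha> i j * v j)" if "i < m" for i
    using that by (simp add: sum_lessThan_add)
  moreover have "(\<Sum>j<k + l. ?\<beta> (m + i) j * v j) = v (k + i)" if "i < l" for i
  proof -
    have "(\<Sum>j<k + l. ?\<beta> (m + i) j * v j) = (\<Sum>j<k + l. if j = k + i then v (k + i) else 0)"
      by (intro sum.cong) auto
    then show ?thesis using that by simp
  qed
  ultimately show "(\<Sum>i<m + l. (cmod (\<Sum>j<k + l. ?\<beta> i j * v j))\<^sup>2) \<le> (\<Sum>j<k + l. (cmod (v j))\<^sup>2)"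
    using assms[unfolded contraction_def, rule_format, of v]
    by (simp add: sum_lessThan_add[of _ m] sum_lessThan_add[of "\<lambda>j. (cmod (v j))\<^sup>2"])
qed

lemma mat_apply_block:
  "mat_apply (m + length W) (\<lambda>i j. if i < m then (if j < length Z then \<alpha> i j else 0)
     else if j = i - m + length Z then 1 else 0) (Z @ W) = mat_apply m \<alpha> Z @ W"
    (is "mat_apply _ ?\<beta> _ = _")
proof (rule nth_equalityI)
  fix i assume i: "i < length (mat_apply (m + length W) ?\<beta> (Z @ W))"
  show "mat_apply (m + length W) ?\<beta> (Z @ W) ! i = (mat_apply m \<alpha> Z @ W) ! i"
  proof (cases "i < m")
    case True
    then show ?thesis
      by (simp add: mat_apply_def nth_append sum_lessThan_add)
  next
    case False
    then have "(\<Sum>j<length (Z @ W). pm_scale (?\<beta> i j) ((Z @ W) ! j)) =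
       (\<Sum>j<length (Z @ W). if j = i - m + length Z then W ! (i - m) else 0)"
      using i by (intro sum.cong) (auto simp: nth_append intro: poly_mapping_eqI)
    also have "\<dots> = W ! (i - m)"
    proof -
      have "i - m + length Z < length (Z @ W)" using i False by simp
      then show ?thesis by (simp only: sum.delta finite_lessThan lessThan_iff if_True)
    qed
    finally show ?thesis using i False by (simp add: mat_apply_def nth_append)
  qed
qed simp

text \<open>Equality of Y^* Y and Z^* Z makes the assignment Zx to Yx a well defined isometry on the
  range of Z. Extended by 0 on the orthogonal complement it is the contraction \<alpha>.\<close>

lemma douglas:
  fixes Y Z :: "('b \<Rightarrow>\<^sub>0 complex) list"
  assumes eq: "\<And>b b'. gram Y b b' = gram Z b b'"
  obtains \<alpha> where "contraction (length Y) (length Z) \<alpha>" "Y = mat_apply (length Y) \<alpha> Z"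
proof -
  define B where "B = (\<Union>z\<in>set (Y @ Z). Poly_Mapping.keys z)"
  have fin: "finite B" by (simp add: B_def)
  define ev where "ev z v = (\<Sum>p\<in>B. lk z p * lk v p)" for z v :: "'b \<Rightarrow>\<^sub>0 complex"
  have ev_add: "ev z (v + w) = ev z v + ev z w" for z v w
    by (simp add: ev_def lookup_add algebra_simps sum.distrib)
  have ev_scale: "ev z (pm_scale c v) = c * ev z v" for z c v
    by (simp add: ev_def sum_distrib_left algebra_simps)
  have ev_sum: "ev z (\<Sum>i\<in>I. f i) = (\<Sum>i\<in>I. ev z (f i))" for z f and I :: "nat set"
    by (simp add: ev_def lookup_sum sum_distrib_left, rule sum.swap)
  \<comment> \<open>The pullback of the standard inner product along Z; by hypothesis it is also the
    pullback along Y (\<open>hY\<close>).\<close>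
  define h where "h v w = (\<Sum>j<length Z. cnj (ev (Z ! j) v) * ev (Z ! j) w)" for v w
  have gr: "(\<Sum>j<length X. cnj (ev (X ! j) v) * ev (X ! j) w) =
      (\<Sum>p\<in>B. \<Sum>q\<in>B. cnj (lk v p) * lk w q * gram X p q)" for X v w
    unfolding ev_def gram_sum
    by (simp add: sum_product sum_distrib_left mult_ac)
       (subst sum.swap, rule sum.cong[OF HOL.refl], rule sum.swap)
  have hY: "h v w = (\<Sum>i<length Y. cnj (ev (Y ! i) v) * ev (Y ! i) w)" for v w
    unfolding h_def gr eq ..
  interpret semi_inner pm_scale h
  proof
    fix x y z :: "'b \<Rightarrow>\<^sub>0 complex" and c
    show "h x (y + z) = h x y + h x z" by (simp add: h_def ev_add sum.distrib algebra_simps)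
    show "h x (pm_scale c y) = c * h x y" by (simp add: h_def ev_scale sum_distrib_left algebra_simps)
    show "h y x = cnj (h x y)" by (simp add: h_def mult.commute)
    show "0 \<le> Re (h x x)"
      by (simp add: h_def sum_nonneg)
  qed
  define b where "b k = Poly_Mapping.single (from_nat_into B k) (1::complex)" for k
  obtain e where e: "orthonormal_or_zero e (UNIV :: nat set)"
    and exp: "\<And>k N y. k \<le> N \<Longrightarrow> h y (b k) = (\<Sum>j\<le>N. h y (e j) * h (e j) (b k))"
    by (rule gram_schmidt[of b], rule that; assumption)
  obtain N where N: "\<And>p. p \<in> B \<Longrightarrow> \<exists>k\<le>N. from_nat_into B k = p"
    using to_nat_on_finite[OF fin] from_nat_into_to_nat_on[OF countable_finite[OF fin]]
    by (metis bij_betwE less_or_eq_imp_le lessThan_iff)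
  have ev_single: "ev z (Poly_Mapping.single p 1) = lk z p" if "p \<in> B" for z p
  proof -
    have "ev z (Poly_Mapping.single p 1) = (\<Sum>q\<in>B. if q = p then lk z p else 0)"
      unfolding ev_def by (intro sum.cong) (auto simp: lookup_single when_def)
    then show ?thesis using that fin by simp
  qed
  \<comment> \<open>The sum of the rank-one operators (Y e_l)(Z e_l)^* over a basis orthonormal for
    \<open>h\<close>, that is, the partial isometry taking Z e_l to Y e_l.\<close>
  define \<alpha> where "\<alpha> i j = (\<Sum>l\<le>N. ev (Y ! i) (e l) * cnj (ev (Z ! j) (e l)))" for i j
  show ?thesis
  proof
    show "contraction (length Y) (length Z) \<alpha>"
      unfolding contraction_def
    proof
      fix v :: "nat \<Rightarrow> complex"
      define c where "c l = (\<Sum>j<length Z. cnj (ev (Z ! j) (e l)) * v j)" for l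
      define x where "x = (\<Sum>l\<le>N. pm_scale (c l) (e l))"
      define T where "T = (\<Sum>l\<le>N. (cmod (c l))\<^sup>2)"
      have c0: "of_real ((cmod (c l))\<^sup>2) * h (e l) (e l) = of_real ((cmod (c l))\<^sup>2)" for l
      proof -
        have "e l = 0 \<or> h (e l) (e l) = 1" using e by (auto simp: orthonormal_or_zero_def)
        moreover have "c l = 0" if "e l = 0" using that by (simp add: c_def ev_def)
        ultimately show ?thesis by auto
      qed
      have hxx: "h x x = of_real T"
        unfolding x_def T_def h_expand[OF e finite_atMost subset_UNIV] c0 of_real_sum ..
      have "(\<Sum>j<length Z. \<alpha> i j * v j) = ev (Y ! i) x" for i
        by (simp add: \<alpha>_def x_def ev_sum ev_scale c_def sum_distrib_left sum_distrib_right mult_ac)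
           (rule sum.swap)
      then have "(\<Sum>i<length Y. (cmod (\<Sum>j<length Z. \<alpha> i j * v j))\<^sup>2) = Re (h x x)"
        by (simp add: hY) (simp add: cmod_def power2_eq_square)
      also have "\<dots> \<le> (\<Sum>j<length Z. (cmod (v j))\<^sup>2)"
      proof -
        \<comment> \<open>Z applied to \<open>x\<close> is the orthogonal projection of
          \<open>v\<close> to the range of Z. Expanding the square of \<open>v\<close> minus this
          projection bounds the square of the projection, which equals that of \<alpha> applied to
          \<open>v\<close>.\<close>
        have "(\<Sum>j<length Z. cnj (v j) * ev (Z ! j) x) = (\<Sum>l\<le>N. c l * cnj (c l))"
          by (simp add: x_def ev_sum ev_scale sum_distrib_left, subst sum.swap)
             (simp add: c_def sum_distrib_left mult_ac)
        then have S: "(\<Sum>j<length Z. cnj (v j) * ev (Z ! j) x) = of_real T"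
          by (simp add: T_def complex_norm_square del: of_real_power)
        have "0 \<le> (\<Sum>j<length Z. (cmod (v j - ev (Z ! j) x))\<^sup>2)" by (simp add: sum_nonneg)
        also have "\<dots> = (\<Sum>j<length Z. (cmod (v j))\<^sup>2 - 2 * Re (cnj (v j) * ev (Z ! j) x)
            + Re (cnj (ev (Z ! j) x) * ev (Z ! j) x))"
          unfolding cmod_power2 by (intro sum.cong) (auto simp: power2_eq_square algebra_simps)
        also have "\<dots> = (\<Sum>j<length Z. (cmod (v j))\<^sup>2) - 2 * Re (\<Sum>j<length Z. cnj (v j) * ev (Z ! j) x)
            + Re (h x x)"
          by (simp add: h_def sum.distrib sum_subtractf sum_distrib_left del: complex_mult_cnj)
        finally show ?thesis by (simp add: S hxx)
      qed
      finally show "(\<Sum>i<length Y. (cmod (\<Sum>j<length Z. \<alpha> i j * v j))\<^sup>2) \<le> (\<Sum>j<length Z. (cmod (v j))\<^sup>2)" .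
    qed
    show "Y = mat_apply (length Y) \<alpha> Z"
    proof (rule nth_equalityI)
      fix i assume i: "i < length Y"
      have "lk (\<Sum>j<length Z. pm_scale (\<alpha> i j) (Z ! j)) p = lk (Y ! i) p" for p
      proof (cases "p \<in> B")
        case False
        then have "lk (Y ! i) p = 0" "\<And>j. j < length Z \<Longrightarrow> lk (Z ! j) p = 0"
          using i unfolding B_def by (auto simp: in_keys_iff)
        then show ?thesis by (simp add: lookup_sum)
      next
        case True
        then obtain k where k: "k \<le> N" "from_nat_into B k = p" using N by blast
        then have bk: "ev z (b k) = lk z p" for z using True by (simp add: b_def ev_single)
        \<comment> \<open>The part of a coordinate vector that the basis misses has length 0 for
          \<open>h\<close>, so by \<open>hY\<close> every row of Y annihilates it.\<close>
        define n where "n = b k - (\<Sum>l\<le>N. pm_scale (h (e l) (b k)) (e l))"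
        have "h n n = 0"
          using exp[OF k(1), of n] unfolding n_def[symmetric]
          by (subst (2) n_def) (simp add: h_diff h_sum h_scale mult.commute)
        then have "(\<Sum>i<length Y. (cmod (ev (Y ! i) n))\<^sup>2) = 0"
          unfolding hY mult.commute[of "cnj _"] complex_norm_square[symmetric]
            of_real_sum[symmetric] by (simp only: of_real_eq_0_iff)
        then have n0: "ev (Y ! i) n = 0" using i by (simp add: sum_nonneg_eq_0_iff)
        have bn: "b k = n + (\<Sum>l\<le>N. pm_scale (h (e l) (b k)) (e l))" by (simp add: n_def)
        have "ev (Y ! i) (b k) = (\<Sum>l\<le>N. h (e l) (b k) * ev (Y ! i) (e l))"
          by (subst bn) (simp only: n0 ev_add ev_sum ev_scale add_0)
        also have "\<dots> = (\<Sum>j<length Z. \<alpha> i j * lk (Z ! j) p)"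
          by (simp add: h_def bk \<alpha>_def sum_distrib_left sum_distrib_right mult_ac)
             (rule sum.swap)
        finally show ?thesis by (simp add: bk lookup_sum)
      qed
      then show "Y ! i = mat_apply (length Y) \<alpha> Z ! i"
        using i by (auto simp: mat_apply_def intro: poly_mapping_eqI)
    qed simp
  qed
qed

section \<open>Reachability of one list of vectors from another\<close>

locale contractive_reach =
  fixes \<Gamma> :: "(('b \<Rightarrow>\<^sub>0 complex) \<Rightarrow> ('b \<Rightarrow>\<^sub>0 complex)) set"
  assumes id_mem: "(\<lambda>x. x) \<in> \<Gamma>"
    and commute_scale: "T \<in> \<Gamma> \<Longrightarrow> T (pm_scale c x) = pm_scale c (T x)"
begin

text \<open>\<open>Y\<close> is produced from \<open>Z\<close>: a step mixes the vectors by a scalar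
  contraction or applies to each vector its own member of \<Gamma>. The condition
  \<open>0 < m\<close> keeps every list nonempty once \<open>Z\<close> is, as factors of a
  permissible factorization need at least one row.\<close>

inductive reach :: "('b \<Rightarrow>\<^sub>0 complex) list \<Rightarrow> ('b \<Rightarrow>\<^sub>0 complex) list \<Rightarrow> bool" where
  reach_refl: "reach Z Z"
| reach_mat: "reach Y Z \<Longrightarrow> contraction m (length Y) \<alpha> \<Longrightarrow> 0 < m \<Longrightarrow> reach (mat_apply m \<alpha> Y) Z"
| reach_act: "reach Y Z \<Longrightarrow> list_all2 (\<lambda>y y'. \<exists>T\<in>\<Gamma>. y' = T y) Y Y' \<Longrightarrow> reach Y' Z"

lemma reach_trans [trans]: "reach X Y \<Longrightarrow> reach Y Z \<Longrightarrow> reach X Z"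
  by (induction rule: reach.induct) (auto intro: reach.intros)

text \<open>Anything whose Gram form is dominated by that of \<open>Z\<close> is reachable in one
  step: \<open>W\<close> takes up the deficit, \<open>douglas\<close> gives a contraction onto
  \<open>Y @ W\<close>, and the rows for \<open>W\<close> are dropped.\<close>

lemma reach_gram:
  assumes "\<And>b b'. gram (Y @ W) b b' = gram Z b b'" "Y \<noteq> []"
  shows "reach Y Z"
proof -
  obtain \<alpha> where \<alpha>: "contraction (length (Y @ W)) (length Z) \<alpha>"
    and YW: "Y @ W = mat_apply (length (Y @ W)) \<alpha> Z"
    using douglas[OF assms(1)] by blast
  have "contraction (length Y) (length Z) \<alpha>" using \<alpha> by (rule contraction_mono) simp
  moreover have "Y = mat_apply (length Y) \<alpha> Z"
  proof (rule nth_equalityI)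
    fix i assume i: "i < length Y"
    then have "Y ! i = (Y @ W) ! i" by (simp add: nth_append)
    also have "\<dots> = mat_apply (length Y) \<alpha> Z ! i" by (subst YW) (use i in \<open>simp add: mat_apply_def\<close>)
    finally show "Y ! i = mat_apply (length Y) \<alpha> Z ! i" .
  qed simp
  ultimately show ?thesis using reach_mat[OF reach_refl] assms(2) by (metis length_greater_0_conv)
qed

lemma reach_append_right: "reach Y Z \<Longrightarrow> reach (Y @ W) (Z @ W)"
proof (induction rule: reach.induct)
  case (reach_mat Y Z m \<alpha>)
  show ?case
    unfolding mat_apply_block[symmetric]
    by (rule reach.reach_mat[OF reach_mat.IH]) (use reach_mat.hyps in \<open>auto intro: contraction_block\<close>)
next
  case (reach_act Y Z Y')
  have "list_all2 (\<lambda>y y'. \<exists>T\<in>\<Gamma>. y' = T y) W W"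
    by (rule list.rel_refl) (use id_mem in \<open>auto intro: bexI[of _ "\<lambda>x. x"]\<close>)
  then have "list_all2 (\<lambda>y y'. \<exists>T\<in>\<Gamma>. y' = T y) (Y @ W) (Y' @ W)"
    using reach_act.hyps(2) by (rule list_all2_appendI[rotated])
  then show ?case using reach_act.IH by (rule reach.reach_act[rotated])
qed (rule reach_refl)

lemma reach_swap: "reach (Y @ Z) (Z @ Y)"
proof (cases "Y @ Z = []")
  case True then show ?thesis by (simp add: reach_refl)
next
  case False
  then show ?thesis by (intro reach_gram[of "Y @ Z" "[]"]) (auto simp: add.commute)
qed

lemma reach_append:
  assumes "reach Y Y'" "reach Z Z'"
  shows "reach (Y @ Z) (Y' @ Z')"
proof -
  have "reach (Y @ Z) (Y' @ Z)" by (rule reach_append_right[OF assms(1)])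
  also have "reach (Y' @ Z) (Z @ Y')" by (rule reach_swap)
  also have "reach (Z @ Y') (Z' @ Y')" by (rule reach_append_right[OF assms(2)])
  also have "reach (Z' @ Y') (Y' @ Z')" by (rule reach_swap)
  finally show ?thesis .
qed

lemma reach_scale: "reach Y Z \<Longrightarrow> reach (map (pm_scale c) Y) (map (pm_scale c) Z)"
proof (induction rule: reach.induct)
  case (reach_mat Y Z m \<alpha>)
  have "map (pm_scale c) (mat_apply m \<alpha> Y) = mat_apply m \<alpha> (map (pm_scale c) Y)"
    by (simp add: mat_apply_def pm.scale_sum_right mult.commute cong: map_cong)
  then show ?case
    using reach.reach_mat[OF reach_mat.IH] reach_mat.hyps by auto
next
  case (reach_act Y Z Y')
  have "list_all2 (\<lambda>y y'. \<exists>T\<in>\<Gamma>. y' = T y) (map (pm_scale c) Y) (map (pm_scale c) Y')"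
    using reach_act.hyps(2) commute_scale
    by (auto simp: list.rel_map elim!: list_all2_mono)
  then show ?case using reach_act.IH by (rule reach.reach_act[rotated])
qed (rule reach_refl)

primrec copies :: "nat \<Rightarrow> 'c list \<Rightarrow> 'c list" where
  "copies 0 Y = []"
| "copies (Suc n) Y = Y @ copies n Y"

lemma gram_copies [simp]: "gram (copies n Y) b b' = of_nat n * gram Y b b'"
  by (induction n) (auto simp: algebra_simps)

text \<open>Running the reachability \<open>Y @ W\<close> from \<open>Z @ W\<close> as a cascade that hands on the state \<open>W\<close>.\<close>

lemma reach_cascade:
  assumes "reach (Y @ W) (Z @ W)"
  shows "reach (copies n Y @ W) (copies n Z @ W)"
proof (induction n)
  case (Suc n)
  have "reach (copies (Suc n) Y @ W) (copies n Y @ (Y @ W))"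
    using reach_append_right[OF reach_swap[of Y "copies n Y"], of W] by simp
  also have "reach \<dots> (copies n Y @ (Z @ W))"
    by (rule reach_append[OF reach_refl assms])
  also have "reach \<dots> (Z @ (copies n Y @ W))"
    using reach_append_right[OF reach_swap[of "copies n Y" Z], of W] by simp
  also have "reach \<dots> (Z @ (copies n Z @ W))"
    by (rule reach_append[OF reach_refl Suc])
  finally show ?case by simp
qed (simp add: reach_refl)

text \<open>A catalyst \<open>W\<close>, needed at the start and recovered at the end, can be
  removed if any \<open>s\<close> with s^2 above t is allowed. Since n copies share one catalyst,
  its cost per copy is w^2 / n.\<close>

lemma reach_cancel:
  assumes YZ: "reach (Y @ W) (map (pm_scale (of_real (sqrt t))) E @ W)"
    and W: "reach W (map (pm_scale (of_real w)) E)"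
    and ne: "Y \<noteq> []" "E \<noteq> []"
    and t: "0 \<le> t" "t < s\<^sup>2"
  shows "reach Y (map (pm_scale (of_real s)) E)"
proof -
  \<comment> \<open>So many copies that t + w^2 / n stays below s^2.\<close>
  obtain n where n: "w\<^sup>2 / (s\<^sup>2 - t) < of_nat n" using reals_Archimedean2 by blast
  moreover have "0 \<le> w\<^sup>2 / (s\<^sup>2 - t)" using t by simp
  ultimately have n0: "0 < real n" by linarith
  have nw: "t + w\<^sup>2 / n < s\<^sup>2" using n t(2) n0 by (simp add: field_simps)
  let ?c = "complex_of_real (1 / sqrt n)"
  have c: "complex_of_real ((cmod ?c)\<^sup>2) * of_nat n = 1" "(cmod ?c)\<^sup>2 = 1 / n"
    using n0 by (simp_all add: norm_divide power_divide)
  \<comment> \<open>Scaled by 1 / sqrt n, the n copies have together the Gram form of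
    \<open>Y\<close>; the scaled \<open>W\<close> at the end is simply discarded.\<close>
  have "reach Y (map (pm_scale ?c) (copies n Y @ W))"
  proof (rule reach_gram[OF _ ne(1)])
    fix b b'
    show "gram (Y @ map (pm_scale ?c) W) b b' = gram (map (pm_scale ?c) (copies n Y @ W)) b b'"
      by (simp only: gram_append gram_scale gram_copies distrib_left mult.assoc[symmetric] c(1) mult_1)
  qed
  also have "reach \<dots> (map (pm_scale ?c) (copies n (map (pm_scale (of_real (sqrt t))) E) @ W))"
    by (intro reach_scale reach_cascade YZ)
  also have "reach \<dots> (map (pm_scale ?c) (copies n (map (pm_scale (of_real (sqrt t))) E) @
      map (pm_scale (of_real w)) E))"
    by (intro reach_scale reach_append reach_refl W)
  also have "reach \<dots> (map (pm_scale (of_real s)) E)"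
  proof (rule reach_gram)
    \<comment> \<open>The multiple of \<open>E\<close> that fills the gap between t + w^2 / n and
      s^2, discarded by \<open>reach_gram\<close>.\<close>
    let ?r = "sqrt (s\<^sup>2 - t - w\<^sup>2 / n)"
    have r: "?r\<^sup>2 = s\<^sup>2 - t - w\<^sup>2 / n" using nw by simp
    show "gram (map (pm_scale ?c) (copies n (map (pm_scale (of_real (sqrt t))) E) @
      map (pm_scale (of_real w)) E) @ map (pm_scale (of_real ?r)) E) b b' =
      gram (map (pm_scale (of_real s)) E) b b'" for b b'
    proof -
      have sq: "(cmod (of_real (sqrt t)))\<^sup>2 = t" "(cmod (of_real w))\<^sup>2 = w\<^sup>2"
          "(cmod (of_real ?r))\<^sup>2 = s\<^sup>2 - t - w\<^sup>2 / n" "(cmod (of_real s))\<^sup>2 = s\<^sup>2"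
        using t(1) r by simp_all
      have "(1 / real n) * (real n * t + w\<^sup>2) + (s\<^sup>2 - t - w\<^sup>2 / n) = s\<^sup>2"
        using n0 by (simp add: field_simps)
      then have "complex_of_real ((1 / real n) * (real n * t + w\<^sup>2) + (s\<^sup>2 - t - w\<^sup>2 / n)) * gram E b b'
        = of_real (s\<^sup>2) * gram E b b'" by (simp only:)
      then show ?thesis
        by (simp only: map_append gram_append gram_scale gram_copies c(2) sq of_real_add
            of_real_mult of_real_of_nat_eq distrib_right distrib_left mult.assoc)
    qed
    show "map (pm_scale ?c) (copies n (map (pm_scale (of_real (sqrt t))) E) @
      map (pm_scale (of_real w)) E) \<noteq> []" using ne by simp
  qed
  finally show ?thesis .
qed

end

section \<open>The Hahn-Banach theorem for sublinear functionals\<close>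

locale real_vs = vector_space scale for scale :: "real \<Rightarrow> 'v::ab_group_add \<Rightarrow> 'v"
begin

definition sublinear :: "('v \<Rightarrow> real) \<Rightarrow> bool" where
  "sublinear p \<longleftrightarrow> (\<forall>x y. p (x + y) \<le> p x + p y) \<and> (\<forall>r>0. \<forall>x. p (scale r x) = r * p x)"

lemma sublinearD:
  assumes "sublinear p"
  shows "p (x + y) \<le> p x + p y" and "0 < r \<Longrightarrow> p (scale r x) = r * p x" and "p 0 = 0"
    and "- p (- x) \<le> p x" and "0 \<le> r \<Longrightarrow> p (scale r x) = r * p x"
proof -
  show a: "p (x + y) \<le> p x + p y" and b: "0 < r \<Longrightarrow> p (scale r x) = r * p x" for x y r
    using assms by (auto simp: sublinear_def)
  show z: "p 0 = 0" using b[of 2 0] by simp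
  show "- p (- x) \<le> p x" using a[of x "- x"] z by simp
  show "0 \<le> r \<Longrightarrow> p (scale r x) = r * p x" using b[of r x] z by (cases "r = 0") auto
qed

lemma sublinearI_le:
  assumes "\<And>x y. p (x + y) \<le> p x + p y" "\<And>r x. 0 < r \<Longrightarrow> p (scale r x) \<le> r * p x"
  shows "sublinear p"
  unfolding sublinear_def
proof (intro conjI allI impI antisym)
  fix r :: real and x assume r: "0 < r"
  have "p (scale (1 / r) (scale r x)) \<le> 1 / r * p (scale r x)" using r by (intro assms(2)) simp
  then show "r * p x \<le> p (scale r x)" using r by (simp add: field_simps)
qed (use assms in auto)

text \<open>Lowers a sublinear functional so that it becomes additive in the direction \<open>y\<close>.\<close>

definition lower :: "('v \<Rightarrow> real) \<Rightarrow> 'v \<Rightarrow> 'v \<Rightarrow> real" where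
  "lower p y x = (INF s\<in>{0..}. p (x + scale s y) - s * p y)"

context
  fixes p :: "'v \<Rightarrow> real" and y :: 'v
  assumes p: "sublinear p"
begin

lemma lower_le:
  assumes "0 \<le> s" shows "lower p y x \<le> p (x + scale s y) - s * p y"
proof -
  have "- p (- x) \<le> p (x + scale s y) - s * p y" if "0 \<le> s" for s
    using sublinearD(1)[OF p, of "x + scale s y" "- x"] sublinearD(5)[OF p that, of y] by simp
  then have "bdd_below ((\<lambda>s. p (x + scale s y) - s * p y) ` {0..})"
    by (intro bdd_belowI) auto
  then show ?thesis using assms unfolding lower_def by (intro cINF_lower) auto
qed

lemma lower_sublinear: "sublinear (lower p y)"
proof (rule sublinearI_le)
  fix x x'
  have "lower p y (x + x') - (p (x' + scale t y) - t * p y) \<le> p (x + scale s y) - s * p y"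
    if "0 \<le> s" "0 \<le> t" for s t
  proof -
    have "lower p y (x + x') \<le> p (x + x' + scale (s + t) y) - (s + t) * p y"
      using that by (intro lower_le) simp
    also have "x + x' + scale (s + t) y = (x + scale s y) + (x' + scale t y)"
      by (simp add: scale_left_distrib)
    also have "p \<dots> \<le> p (x + scale s y) + p (x' + scale t y)" by (rule sublinearD(1)[OF p])
    finally show ?thesis by (simp add: algebra_simps)
  qed
  then have "lower p y (x + x') - (p (x' + scale t y) - t * p y) \<le> lower p y x" if "0 \<le> t" for t
    using that unfolding lower_def[of p y x] by (intro cINF_greatest) auto
  then have "lower p y (x + x') - lower p y x \<le> p (x' + scale t y) - t * p y" if "0 \<le> t" for t
    using that by (simp add: algebra_simps)
  then have "lower p y (x + x') - lower p y x \<le> lower p y x'"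
    unfolding lower_def[of p y x'] by (intro cINF_greatest) auto
  then show "lower p y (x + x') \<le> lower p y x + lower p y x'" by simp
next
  fix r x assume r: "(0::real) < r"
  have "lower p y (scale r x) / r \<le> p (x + scale s y) - s * p y" if "0 \<le> s" for s
  proof -
    have "lower p y (scale r x) \<le> p (scale r x + scale (r * s) y) - (r * s) * p y"
      using that r by (intro lower_le) simp
    also have "scale r x + scale (r * s) y = scale r (x + scale s y)"
      by (simp add: scale_right_distrib)
    also have "p \<dots> = r * p (x + scale s y)" by (rule sublinearD(2)[OF p r])
    finally show ?thesis using r by (simp add: field_simps)
  qed
  then have "lower p y (scale r x) / r \<le> lower p y x"
    unfolding lower_def[of p y x] by (intro cINF_greatest) auto
  then show "lower p y (scale r x) \<le> r * lower p y x" using r by (simp add: field_simps)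
qed

end

text \<open>The infimum is finite because every member of the chain is bounded below by - q (- x).
  It is subadditive because two members can be replaced by the smaller one.\<close>

lemma sublinear_Inf_chain:
  assumes "C \<noteq> {}" and sub: "\<And>c. c \<in> C \<Longrightarrow> sublinear c \<and> (\<forall>x. c x \<le> q x)"
    and chain: "\<And>c c'. c \<in> C \<Longrightarrow> c' \<in> C \<Longrightarrow> (\<forall>x. c x \<le> c' x) \<or> (\<forall>x. c' x \<le> c x)"
  shows "sublinear (\<lambda>x. INF c\<in>C. c x)" and "c \<in> C \<Longrightarrow> (INF c\<in>C. c x) \<le> c x"
proof -
  have "- q (- x) \<le> c x" if "c \<in> C" for c x
  proof -
    have "- c (- x) \<le> c x" "c (- x) \<le> q (- x)" using sub[OF that] sublinearD(4)[of c x] by auto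
    then show ?thesis by linarith
  qed
  then have "bdd_below ((\<lambda>c. c x) ` C)" for x by (intro bdd_belowI) auto
  then show low: "(INF c\<in>C. c x) \<le> c x" if "c \<in> C" for c x
    using that by (intro cINF_lower)
  show "sublinear (\<lambda>x. INF c\<in>C. c x)"
  proof (rule sublinearI_le)
    fix x y
    have "(INF c\<in>C. c (x + y)) - c' y \<le> c x" if c: "c \<in> C" "c' \<in> C" for c c'
    proof -
      obtain e where e: "e \<in> C" "e x \<le> c x" "e y \<le> c' y" using chain[OF c] c by auto
      have "(INF c\<in>C. c (x + y)) \<le> e (x + y)" by (rule low[OF e(1)])
      also have "\<dots> \<le> e x + e y" using sub[OF e(1)] by (intro sublinearD(1)) simp
      finally show ?thesis using e by simp
    qed
    then have "(INF c\<in>C. c (x + y)) - c' y \<le> (INF c\<in>C. c x)" if "c' \<in> C" for c'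
      using that assms(1) by (intro cINF_greatest)
    then have "(INF c\<in>C. c (x + y)) - (INF c\<in>C. c x) \<le> c' y" if "c' \<in> C" for c'
      using that by (simp add: algebra_simps)
    then have "(INF c\<in>C. c (x + y)) - (INF c\<in>C. c x) \<le> (INF c\<in>C. c y)"
      using assms(1) by (intro cINF_greatest)
    then show "(INF c\<in>C. c (x + y)) \<le> (INF c\<in>C. c x) + (INF c\<in>C. c y)" by simp
  next
    fix r x assume r: "(0::real) < r"
    have "(INF c\<in>C. c (scale r x)) / r \<le> c x" if "c \<in> C" for c
      using low[OF that, of "scale r x"] sub[OF that] sublinearD(2)[of c r x] r
      by (simp add: field_simps)
    then have "(INF c\<in>C. c (scale r x)) / r \<le> (INF c\<in>C. c x)"
      using assms(1) by (intro cINF_greatest)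
    then show "(INF c\<in>C. c (scale r x)) \<le> r * (INF c\<in>C. c x)" using r by (simp add: field_simps)
  qed
qed

text \<open>A minimal sublinear functional is linear.\<close>

theorem hahn_banach:
  assumes q: "sublinear q"
  obtains f where "\<And>x y. f (x + y) = f x + f y" "\<And>r x. f (scale r x) = r * f x"
    "\<And>x. f x \<le> q x" "f u = q u"
proof -
  \<comment> \<open>Lowering in the direction \<open>u\<close> first gives q0 (- u) \<le> - q u, so
    that every linear functional below \<open>q0\<close> takes the value \<open>q u\<close> at
    \<open>u\<close>.\<close>
  define q0 where "q0 = lower q u"
  have q0: "sublinear q0" unfolding q0_def by (rule lower_sublinear[OF q])
  have q0_le: "q0 x \<le> q x" for x using lower_le[OF q, of 0 u x] by (simp add: q0_def)
  have q0_u: "q0 (- u) \<le> - q u"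
    using lower_le[OF q, of 1 u "- u"] sublinearD(3)[OF q] by (simp add: q0_def)
  define A where "A = {p. sublinear p \<and> (\<forall>x. p x \<le> q0 x)}"
  \<comment> \<open>The order is reversed, so the maximal element found by Zorn's lemma is a minimal
    sublinear functional.\<close>
  define P where "P = (\<lambda>(p :: 'v \<Rightarrow> real) p'. \<forall>x. p' x \<le> p x)"
  have ex: "\<exists>m\<in>A. \<forall>p\<in>A. P m p \<longrightarrow> p = m"
  proof (rule predicate_Zorn)
    show "partial_order_on A (relation_of P A)"
    proof (rule partial_order_on_relation_ofI)
      show "P p p'' " if "P p p'" "P p' p''" for p p' p''
        using that order_trans unfolding P_def by blast
      show "p = p'" if "P p p'" "P p' p" for p p'
        using that unfolding P_def by (intro ext antisym) auto
    qed (simp add: P_def)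
    fix C assume C: "C \<in> Chains (relation_of P A)"
    show "\<exists>l\<in>A. \<forall>p\<in>C. P p l"
    proof (cases "C = {}")
      case True
      then show ?thesis using q0 by (auto simp: A_def)
    next
      case False
      have CA: "sublinear c \<and> (\<forall>x. c x \<le> q0 x)" if "c \<in> C" for c
        using C that unfolding Chains_def relation_of_def A_def by auto
      have chain: "(\<forall>x. c x \<le> c' x) \<or> (\<forall>x. c' x \<le> c x)" if "c \<in> C" "c' \<in> C" for c c'
        using C that unfolding Chains_def relation_of_def P_def by auto
      have I1: "sublinear (\<lambda>x. INF c\<in>C. c x)"
        by (rule sublinear_Inf_chain(1)[OF False CA chain])
      have I2: "(INF c\<in>C. c x) \<le> c x" if "c \<in> C" for c x
        by (rule sublinear_Inf_chain(2)[OF False CA chain that])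
      have "(INF c\<in>C. c x) \<le> q0 x" for x
      proof -
        obtain c where c: "c \<in> C" using False by blast
        then have "c x \<le> q0 x" using CA by blast
        then show ?thesis using I2[OF c, of x] by linarith
      qed
      then show ?thesis using I1 I2
        by (intro bexI[of _ "\<lambda>x. INF c\<in>C. c x"]) (auto simp: A_def P_def)
    qed
  qed
  obtain m where m: "sublinear m" "\<And>x. m x \<le> q0 x"
    and min: "\<And>p. sublinear p \<Longrightarrow> (\<And>x. p x \<le> m x) \<Longrightarrow> p = m"
  proof -
    obtain m where mA: "m \<in> A" and mmin: "\<And>p. p \<in> A \<Longrightarrow> P m p \<Longrightarrow> p = m" using ex by blast
    show thesis
    proof (rule that)
      show "sublinear m" "m x \<le> q0 x" for x using mA by (auto simp: A_def)
      show "p = m" if p: "sublinear p" "\<And>x. p x \<le> m x" for p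
      proof (rule mmin)
        show "P m p" using p(2) by (simp add: P_def)
        have "p x \<le> q0 x" for x
          by (rule order_trans[OF p(2)]) (use mA in \<open>simp add: A_def\<close>)
        then show "p \<in> A" using p(1) by (simp add: A_def)
      qed
    qed
  qed
  have add: "m (x + y) = m x + m y" for x y
  proof (rule antisym)
    \<comment> \<open>By minimality lowering changes nothing, and the definition of
      \<open>lower\<close> with factor 1 is then the missing half of additivity.\<close>
    have "lower m y = m"
      using lower_le[OF m(1), of 0 y] by (intro min lower_sublinear m(1)) simp
    then show "m x + m y \<le> m (x + y)"
      using lower_le[OF m(1), of 1 y x] by simp
  qed (rule sublinearD(1)[OF m(1)])
  have neg: "m (- x) = - m x" for x
    using add[of x "- x"] sublinearD(3)[OF m(1)] by simp
  have scale: "m (scale r x) = r * m x" for r x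
    using sublinearD(5)[OF m(1), of r x] sublinearD(5)[OF m(1), of "- r" x] neg[of "scale r x"]
    by (cases "0 \<le> r") (auto simp: neg)
  have le: "m x \<le> q x" for x by (rule order_trans[OF m(2) q0_le])
  have "m (- u) \<le> - q u" by (rule order_trans[OF m(2) q0_u])
  then have "m u = q u" using le[of u] neg[of u] by simp
  then show thesis by (rule that[OF add scale le])
qed

end

section \<open>The gauge of a Hermitian form and the dual description of reachability\<close>

lemma poly_mapping_single_induct [case_names zero add]:
  assumes "P 0" "\<And>b c u. P u \<Longrightarrow> P (Poly_Mapping.single b c + u)"
  shows "P (u :: 'b \<Rightarrow>\<^sub>0 'c::comm_monoid_add)"
proof -
  have s: "P (\<Sum>b\<in>K. Poly_Mapping.single b (Poly_Mapping.lookup u b))" if "finite K" for K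
    using that by induction (use assms in auto)
  have "u = (\<Sum>b\<in>Poly_Mapping.keys u. Poly_Mapping.single b (Poly_Mapping.lookup u b))"
  proof (rule poly_mapping_eqI)
    fix b
    have "Poly_Mapping.lookup (\<Sum>b\<in>K. Poly_Mapping.single b (Poly_Mapping.lookup u b)) b =
        (if b \<in> K then Poly_Mapping.lookup u b else 0)" if "finite K" for K
      using that by induction (auto simp: lookup_add lookup_single when_def)
    then show "Poly_Mapping.lookup u b = Poly_Mapping.lookup
        (\<Sum>b\<in>Poly_Mapping.keys u. Poly_Mapping.single b (Poly_Mapping.lookup u b)) b"
      by (simp add: in_keys_iff)
  qed
  then show ?thesis using s[of "Poly_Mapping.keys u"] by simp
qed

text \<open>The rank-one matrix x^* y, conjugate-linear in \<open>x\<close>.\<close>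

definition tens :: "('b \<Rightarrow>\<^sub>0 complex) \<Rightarrow> ('b \<Rightarrow>\<^sub>0 complex) \<Rightarrow> ('b \<times> 'b \<Rightarrow>\<^sub>0 complex)" where
  "tens x y = (\<Sum>b\<in>Poly_Mapping.keys x. \<Sum>b'\<in>Poly_Mapping.keys y.
     Poly_Mapping.single (b, b') (cnj (lk x b) * lk y b'))"

lemma lookup_tens [simp]: "lk (tens x y) (b, b') = cnj (lk x b) * lk y b'"
proof -
  have "lk (tens x y) (b, b') = (\<Sum>p\<in>Poly_Mapping.keys x. \<Sum>p'\<in>Poly_Mapping.keys y.
      if p = b \<and> p' = b' then cnj (lk x b) * lk y b' else 0)"
    by (simp add: tens_def lookup_sum lookup_single when_def) (intro sum.cong HOL.refl, auto)
  also have "\<dots> = (\<Sum>p\<in>Poly_Mapping.keys x. if p = b then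
      (\<Sum>p'\<in>Poly_Mapping.keys y. if p' = b' then cnj (lk x b) * lk y b' else 0) else 0)"
    by (intro sum.cong) auto
  also have "\<dots> = cnj (lk x b) * lk y b'" by (auto simp: in_keys_iff)
  finally show ?thesis .
qed

text \<open>The Hermitian part of a matrix. Taking all finitely supported matrices as carrier and
  reading only their Hermitian parts gives a real vector space for Hahn-Banach without a
  subspace.\<close>

definition herm :: "('b \<times> 'b \<Rightarrow>\<^sub>0 complex) \<Rightarrow> 'b \<Rightarrow> 'b \<Rightarrow> complex" where
  "herm u b b' = (lk u (b, b') + cnj (lk u (b', b))) / 2"

lemma herm_add [simp]: "herm (u + v) b b' = herm u b b' + herm v b b'"
  by (simp add: herm_def lookup_add add_divide_distrib)

lemma herm_diff [simp]: "herm (u - v) b b' = herm u b b' - herm v b b'"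
  by (simp add: herm_def lookup_minus add_divide_distrib diff_divide_distrib)

lemma herm_scale [simp]: "herm (pm_scale (of_real r) u) b b' = of_real r * herm u b b'"
  by (simp add: herm_def algebra_simps add_divide_distrib)

lemma herm_tens [simp]: "herm (tens x x) b b' = gram [x] b b'"
  by (simp add: herm_def mult.commute)

lemma herm_zero [simp]: "herm 0 b b' = 0"
  by (simp add: herm_def)

text \<open>\<open>generating\<close> makes the Gram form of \<open>E\<close> an order unit on forms
  over \<open>B\<close>, and this is what keeps the gauge finite.\<close>

locale reach_duality = contractive_reach \<Gamma>
  for \<Gamma> :: "(('b \<Rightarrow>\<^sub>0 complex) \<Rightarrow> ('b \<Rightarrow>\<^sub>0 complex)) set" +
  fixes E :: "('b \<Rightarrow>\<^sub>0 complex) list" and B :: "'b set"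
  assumes E_ne: "E \<noteq> []"
    and E_keys: "e \<in> set E \<Longrightarrow> Poly_Mapping.keys e \<subseteq> B"
    and generating: "Poly_Mapping.keys x \<subseteq> B \<Longrightarrow> \<exists>w. reach [x] (map (pm_scale (of_real w)) E)"
begin

abbreviation scaled :: "real \<Rightarrow> ('b \<Rightarrow>\<^sub>0 complex) list" where
  "scaled r \<equiv> map (pm_scale (of_real r)) E"

lemma gram_scaled [simp]: "gram (scaled r) b b' = of_real (r\<^sup>2) * gram E b b'"
  by simp

lemma reach_scaled_append: "reach (scaled r @ scaled r' @ Z) (scaled (sqrt (r\<^sup>2 + r'\<^sup>2)) @ Z)"
proof (rule reach_gram[where W = "[]"])
  fix b b'
  show "gram ((scaled r @ scaled r' @ Z) @ []) b b' = gram (scaled (sqrt (r\<^sup>2 + r'\<^sup>2)) @ Z) b b'"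
    by (simp only: append_Nil2 gram_append gram_scaled real_sqrt_pow2 sum_power2_ge_zero
        of_real_add distrib_right add.assoc)
qed (use E_ne in simp)

lemma reach_scaled_ex:
  assumes "Y \<noteq> []" "\<And>y. y \<in> set Y \<Longrightarrow> Poly_Mapping.keys y \<subseteq> B"
  shows "\<exists>w. reach Y (scaled w)"
  using assms
proof (induction Y rule: list_nonempty_induct)
  case (single x) then show ?case using generating by simp
next
  case (cons x Y)
  obtain w w' where "reach [x] (scaled w)" "reach Y (scaled w')"
    using cons generating[of x] by auto
  then have "reach ([x] @ Y) (scaled w @ scaled w')" by (rule reach_append)
  also have "reach \<dots> (scaled (sqrt (w\<^sup>2 + w'\<^sup>2)))"
    using reach_scaled_append[of w w' "[]"] by simp
  finally show ?case by auto
qed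

text \<open>On \<open>B\<close> the form \<open>u\<close> lies below t times the Gram form of
  \<open>E\<close>, in the order where reachability decreases Gram forms. The catalyst
  \<open>Z\<close>, present on both sides, is what turns the relation into one between differences
  of Gram forms and so makes it additive in \<open>u\<close>.\<close>

definition adm :: "('b \<times> 'b \<Rightarrow>\<^sub>0 complex) \<Rightarrow> real \<Rightarrow> bool" where
  "adm u t \<longleftrightarrow> 0 \<le> t \<and> (\<exists>Y Z. Y \<noteq> [] \<and> Z \<noteq> [] \<and> (\<forall>y\<in>set (Y @ Z). Poly_Mapping.keys y \<subseteq> B) \<and>
     reach Y (scaled (sqrt t) @ Z) \<and>
     (\<forall>b\<in>B. \<forall>b'\<in>B. herm u b b' = gram Y b b' - gram Z b b'))"

lemma admI:
  assumes "0 \<le> t" "Y \<noteq> []" "Z \<noteq> []" "\<And>y. y \<in> set (Y @ Z) \<Longrightarrow> Poly_Mapping.keys y \<subseteq> B"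
    "reach Y (scaled (sqrt t) @ Z)"
    "\<And>b b'. b \<in> B \<Longrightarrow> b' \<in> B \<Longrightarrow> herm u b b' = gram Y b b' - gram Z b b'"
  shows "adm u t"
  unfolding adm_def using assms by blast

lemma adm_zero:
  assumes "Y \<noteq> []" "Z \<noteq> []" "\<And>y. y \<in> set (Y @ Z) \<Longrightarrow> Poly_Mapping.keys y \<subseteq> B"
    "reach Y Z"
    "\<And>b b'. b \<in> B \<Longrightarrow> b' \<in> B \<Longrightarrow> herm u b b' = gram Y b b' - gram Z b b'"
  shows "adm u 0"
proof (rule admI[OF _ assms(1-3) _ assms(5)])
  have "reach Z (scaled (sqrt 0) @ Z)"
    using assms(2) by (intro reach_gram[where W = "[]"]) auto
  then show "reach Y (scaled (sqrt 0) @ Z)" by (rule reach_trans[OF assms(4)])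
qed auto

lemma adm_add:
  assumes "adm u t" "adm u' t'" shows "adm (u + u') (t + t')"
proof -
  obtain Y Z Y' Z' where t: "0 \<le> t" "0 \<le> t'" and ne: "Y \<noteq> []" "Z \<noteq> []"
    and keys: "\<forall>y\<in>set (Y @ Z). Poly_Mapping.keys y \<subseteq> B" "\<forall>y\<in>set (Y' @ Z'). Poly_Mapping.keys y \<subseteq> B"
    and r: "reach Y (scaled (sqrt t) @ Z)" "reach Y' (scaled (sqrt t') @ Z')"
    and g: "\<forall>b\<in>B. \<forall>b'\<in>B. herm u b b' = gram Y b b' - gram Z b b'"
      "\<forall>b\<in>B. \<forall>b'\<in>B. herm u' b b' = gram Y' b b' - gram Z' b b'"
    using assms unfolding adm_def by blast
  show ?thesis
  proof (rule admI[of _ "Y @ Y'" "Z @ Z'"])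
    have "reach (Y @ Y') ((scaled (sqrt t) @ Z) @ (scaled (sqrt t') @ Z'))"
      by (rule reach_append[OF r])
    also have "reach \<dots> (scaled (sqrt t) @ scaled (sqrt t') @ Z @ Z')"
      using reach_append[OF reach_append[OF reach_refl reach_swap] reach_refl,
          of "scaled (sqrt t)" Z "scaled (sqrt t')" Z'] by simp
    also have "reach \<dots> (scaled (sqrt (t + t')) @ Z @ Z')"
      using reach_scaled_append[of "sqrt t" "sqrt t'"] t by simp
    finally show "reach (Y @ Y') (scaled (sqrt (t + t')) @ Z @ Z')" .
  qed (use t ne keys g in auto)
qed

lemma adm_scale:
  assumes "adm u t" "0 < r" shows "adm (pm_scale (of_real r) u) (r * t)"
proof -
  obtain Y Z where t: "0 \<le> t" and ne: "Y \<noteq> []" "Z \<noteq> []"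
    and keys: "\<forall>y\<in>set (Y @ Z). Poly_Mapping.keys y \<subseteq> B"
    and r: "reach Y (scaled (sqrt t) @ Z)"
    and g: "\<forall>b\<in>B. \<forall>b'\<in>B. herm u b b' = gram Y b b' - gram Z b b'"
    using assms unfolding adm_def by blast
  let ?s = "map (pm_scale (of_real (sqrt r)))"
  show ?thesis
  proof (rule admI[of _ "?s Y" "?s Z"])
    show "reach (?s Y) (scaled (sqrt (r * t)) @ ?s Z)"
      using reach_scale[OF r, of "of_real (sqrt r)"] by (simp add: comp_def real_sqrt_mult)
    show "Poly_Mapping.keys y \<subseteq> B" if y: "y \<in> set (?s Y @ ?s Z)" for y
    proof -
      obtain x where x: "x \<in> set (Y @ Z)" "y = pm_scale (of_real (sqrt r)) x" using y by auto
      then have "Poly_Mapping.keys y \<subseteq> Poly_Mapping.keys x" by (auto simp: in_keys_iff)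
      then show ?thesis using keys x(1) by blast
    qed
    show "herm (pm_scale (of_real r) u) b b' = gram (?s Y) b b' - gram (?s Z) b b'"
      if "b \<in> B" "b' \<in> B" for b b'
    proof -
      have "(cmod (of_real (sqrt r)))\<^sup>2 = r" using assms(2) by simp
      then show ?thesis using g that by (simp only: gram_scale herm_scale right_diff_distrib)
    qed
  qed (use t ne assms(2) in auto)
qed

lemma adm_ex: "\<exists>t. adm u t"
proof (induction u rule: poly_mapping_single_induct)
  case zero
  show ?case
    by (intro exI[of _ 0] adm_zero[of "[0]" "[0]"]) (simp_all add: reach_refl)
next
  case (add p c u)
  obtain b b' where p: "p = (b, b')" by (rule prod.exhaust)
  have "\<exists>t. adm (Poly_Mapping.single p c) t"
  proof (cases "b \<in> B \<and> b' \<in> B")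
    case False
    have "herm (Poly_Mapping.single p c) q q' = 0" if "q \<in> B" "q' \<in> B" for q q'
    proof -
      have "(b, b') \<noteq> (q, q')" "(b, b') \<noteq> (q', q)" using False that by auto
      then show ?thesis by (simp add: herm_def p lookup_single_not_eq)
    qed
    then have "adm (Poly_Mapping.single p c) 0"
      by (intro adm_zero[of "[0]" "[0]"]) (simp_all add: reach_refl)
    then show ?thesis ..
  next
    case True
    \<comment> \<open>Polarization: the Hermitian part of a single matrix entry is the difference of
      the squares of half a sum and half a difference.\<close>
    define y z where y: "y = Poly_Mapping.single b (1/2) + Poly_Mapping.single b' (c/2)"
      and z: "z = Poly_Mapping.single b (1/2) - Poly_Mapping.single b' (c/2)"
    have k: "Poly_Mapping.keys y \<subseteq> B" "Poly_Mapping.keys z \<subseteq> B"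
      using True keys_add[of "Poly_Mapping.single b (1/2)" "Poly_Mapping.single b' (c/2)"]
        keys_diff[of "Poly_Mapping.single b (1/2)" "Poly_Mapping.single b' (c/2)"]
      unfolding y z by (auto split: if_splits)
    obtain w where w: "reach [y] (scaled w)" using generating[OF k(1)] by blast
    have "reach [y] (scaled (sqrt (w\<^sup>2)) @ [z])"
    proof (rule reach_trans[OF w reach_gram[where W = "[z]"]])
      show "gram (scaled w @ [z]) b b' = gram (scaled (sqrt (w\<^sup>2)) @ [z]) b b'" for b b'
        by simp
    qed (use E_ne in simp)
    then have "adm (Poly_Mapping.single p c) (w\<^sup>2)"
    proof (rule admI[rotated 4])
      fix q q'
      define \<delta> \<delta>' where "\<delta> = (\<lambda>q. if q = b then 1 else 0 :: complex)"
        and "\<delta>' = (\<lambda>q. if q = b' then 1 else 0 :: complex)"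
      have lk: "lk (Poly_Mapping.single p c) (q, q') = c * \<delta> q * \<delta>' q'"
          "lk y q = \<delta> q / 2 + c * \<delta>' q / 2" "lk z q = \<delta> q / 2 - c * \<delta>' q / 2" for q q'
        by (auto simp: p y z \<delta>_def \<delta>'_def lookup_single lookup_add lookup_minus when_def)
      have cnj: "cnj (\<delta> q) = \<delta> q" "cnj (\<delta>' q) = \<delta>' q" for q
        by (auto simp: \<delta>_def \<delta>'_def)
      show "herm (Poly_Mapping.single p c) q q' = gram [y] q q' - gram [z] q q'"
      proof -
        have "(c * \<delta> q * \<delta>' q' + d * \<delta> q' * \<delta>' q) / 2 =
            (\<delta> q / 2 + d * \<delta>' q / 2) * (\<delta> q' / 2 + c * \<delta>' q' / 2) -
            (\<delta> q / 2 - d * \<delta>' q / 2) * (\<delta> q' / 2 - c * \<delta>' q' / 2)" for d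
          by (simp add: algebra_simps add_divide_distrib)
        from this[of "cnj c"] show ?thesis by (simp add: herm_def lk cnj)
      qed
      show "Poly_Mapping.keys x \<subseteq> B" if "x \<in> set ([y] @ [z])" for x using that k by auto
    qed simp_all
    then show ?thesis by blast
  qed
  then obtain t where "adm (Poly_Mapping.single p c) t" by blast
  moreover obtain t' where "adm u t'" using add by blast
  ultimately show ?case using adm_add[of "Poly_Mapping.single p c" t u t'] by blast
qed

definition gauge :: "('b \<times> 'b \<Rightarrow>\<^sub>0 complex) \<Rightarrow> real" where
  "gauge u = Inf {t. adm u t}"

lemma gauge_le: "adm u t \<Longrightarrow> gauge u \<le> t"
  unfolding gauge_def by (rule cInf_lower) (auto intro!: bdd_belowI[of _ 0] simp: adm_def)

lemma gauge_greatest: "(\<And>t. adm u t \<Longrightarrow> c \<le> t) \<Longrightarrow> c \<le> gauge u"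
  unfolding gauge_def using adm_ex by (intro cInf_greatest) auto

end

context reach_duality
begin

lemma real_vs_pm: "real_vs (\<lambda>r. pm_scale (complex_of_real r) :: ('c \<Rightarrow>\<^sub>0 complex) \<Rightarrow> _)"
  by unfold_locales (auto intro!: poly_mapping_eqI simp: lookup_add algebra_simps)

lemma gauge_sublinear: "real_vs.sublinear (\<lambda>r. pm_scale (complex_of_real r)) gauge"
proof -
  interpret real_vs "\<lambda>r. pm_scale (complex_of_real r) :: ('b \<times> 'b \<Rightarrow>\<^sub>0 complex) \<Rightarrow> _"
    by (rule real_vs_pm)
  show ?thesis
  proof (rule sublinearI_le)
    fix u v :: "'b \<times> 'b \<Rightarrow>\<^sub>0 complex"
    have "gauge (u + v) - t \<le> gauge v" if "adm u t" for t
    proof (rule gauge_greatest)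
      fix t' assume "adm v t'"
      then show "gauge (u + v) - t \<le> t'"
        using gauge_le[OF adm_add[OF that, of v t']] by simp
    qed
    then have "gauge (u + v) - gauge v \<le> gauge u"
      by (intro gauge_greatest) (simp add: algebra_simps)
    then show "gauge (u + v) \<le> gauge u + gauge v" by simp
  next
    fix r and u :: "'b \<times> 'b \<Rightarrow>\<^sub>0 complex" assume r: "(0::real) < r"
    have "gauge (pm_scale (of_real r) u) / r \<le> gauge u"
    proof (rule gauge_greatest)
      fix t assume "adm u t"
      from gauge_le[OF adm_scale[OF this r]] r
      show "gauge (pm_scale (of_real r) u) / r \<le> t" by (simp add: field_simps)
    qed
    then show "gauge (pm_scale (of_real r) u) \<le> r * gauge u" using r by (simp add: field_simps)
  qed
qed

lemma gram_outside:
  assumes "\<And>y. y \<in> set Y \<Longrightarrow> Poly_Mapping.keys y \<subseteq> B" "b \<notin> B \<or> b' \<notin> B"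
  shows "gram Y b b' = 0"
  using assms
proof (induction Y)
  case (Cons y Y)
  have "Poly_Mapping.keys y \<subseteq> B" using Cons.prems(1) by simp
  then have "lk y b = 0 \<or> lk y b' = 0" using Cons.prems(2) by (meson in_keys_iff subsetD)
  moreover have "gram Y b b' = 0" by (rule Cons.IH[OF _ Cons.prems(2)]) (simp add: Cons.prems(1))
  ultimately show ?case by auto
qed simp

text \<open>If some t below s^2 were admissible, \<open>A @ Z\<close> would have the Gram form of
  \<open>Y\<close> and so be reachable from sqrt t \<open>E\<close> together with \<open>Z\<close>;
  \<open>reach_cancel\<close> would remove \<open>Z\<close> and make \<open>A\<close>
  reachable.\<close>

lemma gauge_gram:
  assumes A: "A \<noteq> []" "\<And>x. x \<in> set A \<Longrightarrow> Poly_Mapping.keys x \<subseteq> B"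
    and u: "\<And>b b'. b \<in> B \<Longrightarrow> b' \<in> B \<Longrightarrow> herm u b b' = gram A b b'"
    and not_reach: "\<not> reach A (scaled s)"
  shows "s\<^sup>2 \<le> gauge u"
proof (rule gauge_greatest, rule ccontr)
  fix t assume "adm u t" and ts: "\<not> s\<^sup>2 \<le> t"
  then obtain Y Z where t: "0 \<le> t" and ne: "Y \<noteq> []" "Z \<noteq> []"
    and keys: "\<forall>y\<in>set (Y @ Z). Poly_Mapping.keys y \<subseteq> B"
    and r: "reach Y (scaled (sqrt t) @ Z)"
    and g: "\<forall>b\<in>B. \<forall>b'\<in>B. herm u b b' = gram Y b b' - gram Z b b'"
    unfolding adm_def by blast
  have "gram (A @ Z) b b' = gram Y b b'" for b b'
  proof (cases "b \<in> B \<and> b' \<in> B")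
    case True
    then have "gram Y b b' - gram Z b b' = gram A b b'" using g u[of b b'] by simp
    then show ?thesis by (metis gram_append diff_add_cancel)
  next
    case False
    then have o: "b \<notin> B \<or> b' \<notin> B" by blast
    have "gram (A @ Z) b b' = 0" by (rule gram_outside[OF _ o]) (use A keys in auto)
    moreover have "gram Y b b' = 0" by (rule gram_outside[OF _ o]) (use keys in auto)
    ultimately show ?thesis by simp
  qed
  then have "reach (A @ Z) Y" using A(1) by (intro reach_gram[where W = "[]"]) auto
  then have "reach (A @ Z) (scaled (sqrt t) @ Z)" using r by (rule reach_trans)
  moreover obtain w where "reach Z (scaled w)" using reach_scaled_ex[OF ne(2)] keys by auto
  ultimately have "reach A (scaled s)"
    by (rule reach_cancel) (use A E_ne t ts in auto)
  then show False using not_reach by blast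
qed

lemma gauge_zero:
  assumes "Y \<noteq> []" "Z \<noteq> []" "\<And>y. y \<in> set (Y @ Z) \<Longrightarrow> Poly_Mapping.keys y \<subseteq> B"
    "reach Y Z"
    "\<And>b b'. b \<in> B \<Longrightarrow> b' \<in> B \<Longrightarrow> herm u b b' = gram Y b b' - gram Z b b'"
  shows "gauge u \<le> 0"
  by (rule gauge_le[OF adm_zero[OF assms]])

text \<open>A linear functional below the gauge that attains it at the Gram form of \<open>A\<close>
  yields \<open>h\<close>. It is positive since minus a square has gauge at most 0 (the zero vector
  is reachable from any vector), it does not increase under \<Gamma> since T x is reachable from x,
  and it has mass at most 1 on \<open>E\<close> since \<open>E\<close> itself has gauge at most
  1.\<close>

theorem dual_form:
  assumes A: "A \<noteq> []" "\<And>x. x \<in> set A \<Longrightarrow> Poly_Mapping.keys x \<subseteq> B"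
    and not_reach: "\<not> reach A (scaled s)"
  obtains h where "semi_inner pm_scale h"
    and "\<And>T x. T \<in> \<Gamma> \<Longrightarrow> Poly_Mapping.keys x \<subseteq> B \<Longrightarrow> Poly_Mapping.keys (T x) \<subseteq> B \<Longrightarrow>
      Re (h (T x) (T x)) \<le> Re (h x x)"
    and "(\<Sum>e\<leftarrow>E. Re (h e e)) \<le> 1" and "s\<^sup>2 \<le> (\<Sum>x\<leftarrow>A. Re (h x x))"
proof -
  interpret rv: real_vs "\<lambda>r. pm_scale (complex_of_real r) :: ('b \<times> 'b \<Rightarrow>\<^sub>0 complex) \<Rightarrow> _"
    by (rule real_vs_pm)
  define u where "u Y = (\<Sum>y\<leftarrow>Y. tens y y)" for Y :: "('b \<Rightarrow>\<^sub>0 complex) list"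
  have u: "herm (u Y) b b' = gram Y b b'" for Y b b'
    by (induction Y) (simp_all add: u_def)
  obtain f where f_add: "\<And>x y. f (x + y) = f x + f y"
    and f_scale: "\<And>r x. f (pm_scale (of_real r) x) = r * f x"
    and f_le: "\<And>x. f x \<le> gauge x" and f_A: "f (u A) = gauge (u A)"
    using rv.hahn_banach[OF gauge_sublinear] by blast
  have f_zero: "f 0 = 0" using f_add[of 0 0] by simp
  have f_minus: "f (- x) = - f x" for x using f_add[of x "- x"] f_zero by simp
  have f_diff: "f (x - y) = f x - f y" for x y using f_add[of x "- y"] f_minus by simp
  have f_list: "f (u Y) = (\<Sum>y\<leftarrow>Y. f (tens y y))" for Y
    by (induction Y) (simp_all add: u_def f_add f_zero)
  \<comment> \<open>If two matrices have the same Hermitian part, their difference and its negative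
    both have gauge at most 0.\<close>
  have f_herm: "f v = f w" if "\<And>b b'. herm v b b' = herm w b b'" for v w
  proof -
    have "gauge (v - w) \<le> 0" "gauge (w - v) \<le> 0"
      by (rule gauge_zero[of "[0]" "[0]"]; simp add: reach_refl that)+
    then show ?thesis using f_le[of "v - w"] f_le[of "w - v"] f_diff by simp
  qed
  \<comment> \<open>The usual complex-linear functional with real part \<open>f\<close>.\<close>
  define F where "F v = Complex (f v) (- f (pm_scale \<i> v))" for v
  have F_add: "F (v + w) = F v + F w" for v w
    by (simp add: F_def f_add pm.scale_right_distrib complex_eq_iff)
  have F_scale: "F (pm_scale c v) = c * F v" for c v
  proof -
    have split: "pm_scale z v = pm_scale (of_real (Re z)) v + pm_scale (of_real (Im z)) (pm_scale \<i> v)" for z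
      by (intro poly_mapping_eqI) (simp add: lookup_add complex_eq_iff algebra_simps)
    have "f (pm_scale z v) = Re z * f v + Im z * f (pm_scale \<i> v)" for z
      by (subst split) (simp only: f_add f_scale)
    from this[of c] this[of "\<i> * c"] show ?thesis
      by (simp add: F_def complex_eq_iff)
  qed
  define h where "h x y = F (tens x y)" for x y
  have tens_add: "tens x (y + z) = tens x y + tens x z" for x y z :: "'b \<Rightarrow>\<^sub>0 complex"
  proof (rule poly_mapping_eqI)
    fix p show "lk (tens x (y + z)) p = lk (tens x y + tens x z) p"
      by (cases p) (simp add: lookup_add algebra_simps)
  qed
  have tens_scale: "tens x (pm_scale c y) = pm_scale c (tens x y)" for c and x y :: "'b \<Rightarrow>\<^sub>0 complex"
  proof (rule poly_mapping_eqI)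
    fix p show "lk (tens x (pm_scale c y)) p = lk (pm_scale c (tens x y)) p"
      by (cases p) simp
  qed
  have h_re: "Re (h x x) = f (tens x x)" for x by (simp add: h_def F_def)
  have si: "semi_inner pm_scale h"
  proof
    fix x y z :: "'b \<Rightarrow>\<^sub>0 complex" and c
    show "h x (y + z) = h x y + h x z" by (simp add: h_def tens_add F_add)
    show "h x (pm_scale c y) = c * h x y" by (simp add: h_def tens_scale F_scale)
    have "f (tens y x) = f (tens x y)" by (rule f_herm) (simp add: herm_def algebra_simps)
    moreover have "f (pm_scale \<i> (tens y x)) = f (- pm_scale \<i> (tens x y))"
      by (rule f_herm) (simp add: herm_def algebra_simps)
    ultimately show "h y x = cnj (h x y)"
      by (simp add: h_def F_def complex_eq_iff f_minus)
    \<comment> \<open>The gauge sees only coordinates in \<open>B\<close>, whereas positivity is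
      claimed for all vectors; hence the restriction of \<open>x\<close> to
      \<open>B\<close>.\<close>
    define x' where "x' = (\<Sum>b\<in>Poly_Mapping.keys x \<inter> B. Poly_Mapping.single b (lk x b))"
    have x': "lk x' b = (if b \<in> B then lk x b else 0)" for b
    proof -
      have "lk x' b = (\<Sum>q\<in>Poly_Mapping.keys x \<inter> B. if q = b then lk x b else 0)"
        unfolding x'_def lookup_sum by (intro sum.cong) (simp_all add: lookup_single when_def)
      then show ?thesis by (simp add: in_keys_iff)
    qed
    have kx: "Poly_Mapping.keys x' \<subseteq> B" by (auto simp: in_keys_iff x' split: if_splits)
    have "gauge (- tens x x) \<le> 0"
    proof (rule gauge_zero[of "[0]" "[x']"])
      have "gram ([0] @ [x']) b b' = gram [x'] b b'" for b b' by simp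
      then show "reach [0] [x']" by (rule reach_gram) simp
      fix b b' assume "b \<in> B" "b' \<in> B"
      have "herm (- tens x x) b b' = - herm (tens x x) b b'" by (simp add: herm_def)
      then show "herm (- tens x x) b b' = gram [0] b b' - gram [x'] b b'"
        using \<open>b \<in> B\<close> \<open>b' \<in> B\<close> by (simp add: x')
    qed (use kx in auto)
    then show "0 \<le> Re (h x x)" using f_le[of "- tens x x"] by (simp add: h_re f_minus)
  qed
  show thesis
  proof (rule that[OF si])
    fix T x assume T: "T \<in> \<Gamma>" and k: "Poly_Mapping.keys x \<subseteq> B" "Poly_Mapping.keys (T x) \<subseteq> B"
    have "gauge (tens (T x) (T x) - tens x x) \<le> 0"
    proof (rule gauge_zero[of "[T x]" "[x]"])
      show "reach [T x] [x]" by (rule reach_act[OF reach_refl]) (use T in auto)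
    qed (use k in auto)
    then show "Re (h (T x) (T x)) \<le> Re (h x x)"
      using f_le[of "tens (T x) (T x) - tens x x"] by (simp add: h_re f_diff)
  next
    have "gauge (u E) \<le> 1"
    proof (rule gauge_le, rule admI[of 1 E "[0]"])
      have "gram (E @ []) b b' = gram (scaled (sqrt 1) @ [0]) b b'" for b b' by simp
      then show "reach E (scaled (sqrt 1) @ [0])" by (rule reach_gram[OF _ E_ne])
      show "Poly_Mapping.keys y \<subseteq> B" if "y \<in> set (E @ [0])" for y
        using that E_keys[of y] by auto
    qed (use E_ne in \<open>simp_all add: u\<close>)
    then show "(\<Sum>e\<leftarrow>E. Re (h e e)) \<le> 1"
      using f_le[of "u E"] by (simp add: h_re f_list)
    show "s\<^sup>2 \<le> (\<Sum>x\<leftarrow>A. Re (h x x))"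
      using gauge_gram[OF A u not_reach] f_A by (simp add: h_re f_list)
  qed
qed

end

section \<open>Square-summable functions and unitary operators on them\<close>

lemma ell2_zero_outside: "f \<in> ell2 X \<Longrightarrow> i \<notin> X \<Longrightarrow> f i = 0"
  and ell2_summable: "f \<in> ell2 X \<Longrightarrow> (\<lambda>i. (cmod (f i))\<^sup>2) summable_on X"
  by (auto simp: ell2_def)

lemma ell2_norm_nonneg [simp]: "0 \<le> ell2_norm X f"
  by (simp add: ell2_norm_def infsum_nonneg)

lemma ell2_norm_sq: "(ell2_norm X f)\<^sup>2 = (\<Sum>\<^sub>\<infinity>i\<in>X. (cmod (f i))\<^sup>2)"
  by (simp add: ell2_norm_def infsum_nonneg)

lemma ell2_finite_le:
  assumes "f \<in> ell2 X" "finite F" "F \<subseteq> X"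
  shows "(\<Sum>i\<in>F. (cmod (f i))\<^sup>2) \<le> (ell2_norm X f)\<^sup>2"
  unfolding ell2_norm_sq using assms by (intro finite_sum_le_infsum ell2_summable) auto

lemma ell2I:
  assumes "\<And>i. i \<notin> X \<Longrightarrow> f i = 0"
    and "\<And>F. finite F \<Longrightarrow> F \<subseteq> X \<Longrightarrow> (\<Sum>i\<in>F. (cmod (f i))\<^sup>2) \<le> c\<^sup>2"
  shows "f \<in> ell2 X" and "0 \<le> c \<Longrightarrow> ell2_norm X f \<le> c"
proof -
  have s: "(\<lambda>i. (cmod (f i))\<^sup>2) summable_on X"
    using assms(2) by (intro nonneg_bdd_above_summable_on bdd_aboveI[where M = "c\<^sup>2"]) auto
  then show "f \<in> ell2 X" using assms(1) by (simp add: ell2_def)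
  have "(ell2_norm X f)\<^sup>2 \<le> c\<^sup>2"
    unfolding ell2_norm_sq using s assms(2) by (rule infsum_le_finite_sums)
  then show "0 \<le> c \<Longrightarrow> ell2_norm X f \<le> c" by (rule power2_le_imp_le)
qed

lemma L2_set_sq: "(L2_set f A)\<^sup>2 = (\<Sum>i\<in>A. (f i)\<^sup>2)"
  by (simp add: L2_set_def sum_nonneg)

lemma ell2_add:
  assumes "f \<in> ell2 X" "g \<in> ell2 X"
  shows "(\<lambda>i. f i + g i) \<in> ell2 X"
    and "ell2_norm X (\<lambda>i. f i + g i) \<le> ell2_norm X f + ell2_norm X g"
proof -
  have "(\<Sum>i\<in>F. (cmod (f i + g i))\<^sup>2) \<le> (ell2_norm X f + ell2_norm X g)\<^sup>2"
    if F: "finite F" "F \<subseteq> X" for F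
  proof -
    have "L2_set (\<lambda>i. cmod (f i + g i)) F \<le> L2_set (\<lambda>i. cmod (f i) + cmod (g i)) F"
      by (intro L2_set_mono norm_triangle_ineq) simp
    also have "\<dots> \<le> L2_set (\<lambda>i. cmod (f i)) F + L2_set (\<lambda>i. cmod (g i)) F"
      by (rule L2_set_triangle_ineq)
    also have "\<dots> \<le> ell2_norm X f + ell2_norm X g"
      using assms F by (intro add_mono power2_le_imp_le[of "L2_set _ _"])
        (simp_all add: L2_set_sq ell2_finite_le)
    finally have "(L2_set (\<lambda>i. cmod (f i + g i)) F)\<^sup>2 \<le> (ell2_norm X f + ell2_norm X g)\<^sup>2"
      by (rule power_mono) simp
    then show ?thesis by (simp add: L2_set_sq)
  qed
  from ell2I[OF _ this] show "(\<lambda>i. f i + g i) \<in> ell2 X"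
    "ell2_norm X (\<lambda>i. f i + g i) \<le> ell2_norm X f + ell2_norm X g"
    using assms by (auto simp: ell2_zero_outside)
qed

lemma ell2_scale:
  assumes "f \<in> ell2 X"
  shows "(\<lambda>i. c * f i) \<in> ell2 X" and "ell2_norm X (\<lambda>i. c * f i) = cmod c * ell2_norm X f"
proof -
  have "(\<lambda>i. (cmod c)\<^sup>2 * (cmod (f i))\<^sup>2) summable_on X"
    by (intro summable_on_cmult_right ell2_summable assms)
  then show "(\<lambda>i. c * f i) \<in> ell2 X"
    using assms by (auto simp: ell2_def norm_mult power_mult_distrib)
  show "ell2_norm X (\<lambda>i. c * f i) = cmod c * ell2_norm X f"
    by (simp add: ell2_norm_def norm_mult power_mult_distrib infsum_cmult_right' real_sqrt_mult)
qed

lemma ell2_0 [simp]: "(\<lambda>i. 0) \<in> ell2 X" "ell2_norm X (\<lambda>i. 0) = 0"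
  by (simp_all add: ell2_def ell2_norm_def)

lemma ell2_sum:
  assumes "\<And>j. j \<in> J \<Longrightarrow> f j \<in> ell2 X"
  shows "(\<lambda>i. \<Sum>j\<in>J. f j i) \<in> ell2 X"
    and "ell2_norm X (\<lambda>i. \<Sum>j\<in>J. f j i) \<le> (\<Sum>j\<in>J. ell2_norm X (f j))"
proof -
  have "(\<lambda>i. \<Sum>j\<in>J. f j i) \<in> ell2 X \<and>
    ell2_norm X (\<lambda>i. \<Sum>j\<in>J. f j i) \<le> (\<Sum>j\<in>J. ell2_norm X (f j))"
    using assms
  proof (induction J rule: infinite_finite_induct)
    case (insert j J)
    have "f j \<in> ell2 X" using insert.prems by simp
    moreover have "(\<lambda>i. \<Sum>j\<in>J. f j i) \<in> ell2 X"
      "ell2_norm X (\<lambda>i. \<Sum>j\<in>J. f j i) \<le> (\<Sum>j\<in>J. ell2_norm X (f j))"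
      using insert.IH insert.prems by auto
    ultimately show ?case
      using insert.hyps ell2_add[of "f j" X "\<lambda>i. \<Sum>j\<in>J. f j i"] by auto
  qed auto
  then show "(\<lambda>i. \<Sum>j\<in>J. f j i) \<in> ell2 X"
    "ell2_norm X (\<lambda>i. \<Sum>j\<in>J. f j i) \<le> (\<Sum>j\<in>J. ell2_norm X (f j))" by auto
qed

lemma infsum_finite_sum:
  fixes f :: "'j \<Rightarrow> 'i \<Rightarrow> real"
  assumes "\<And>j. j \<in> J \<Longrightarrow> f j summable_on X"
  shows "(\<lambda>i. \<Sum>j\<in>J. f j i) summable_on X"
    and "(\<Sum>\<^sub>\<infinity>i\<in>X. \<Sum>j\<in>J. f j i) = (\<Sum>j\<in>J. \<Sum>\<^sub>\<infinity>i\<in>X. f j i)"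
proof -
  have "(\<lambda>i. \<Sum>j\<in>J. f j i) summable_on X \<and>
    (\<Sum>\<^sub>\<infinity>i\<in>X. \<Sum>j\<in>J. f j i) = (\<Sum>j\<in>J. \<Sum>\<^sub>\<infinity>i\<in>X. f j i)"
    using assms
    by (induction J rule: infinite_finite_induct) (auto intro: summable_on_add simp: infsum_add)
  then show "(\<lambda>i. \<Sum>j\<in>J. f j i) summable_on X"
    "(\<Sum>\<^sub>\<infinity>i\<in>X. \<Sum>j\<in>J. f j i) = (\<Sum>j\<in>J. \<Sum>\<^sub>\<infinity>i\<in>X. f j i)" by auto
qed

lemma ell2_inner_self: "f \<in> ell2 X \<Longrightarrow> ell2_inner X f f = of_real ((ell2_norm X f)\<^sup>2)"
  unfolding ell2_inner_def ell2_norm_sq complex_norm_square[symmetric]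
  by (rule infsumI, rule has_sum_of_real, rule has_sum_infsum, rule ell2_summable)

lemma ell2_polarization:
  assumes "f \<in> ell2 X" "g \<in> ell2 X"
  shows "ell2_inner X f g = (\<Sum>k<4. \<i> ^ k * of_real ((ell2_norm X (\<lambda>i. f i + \<i> ^ k * g i))\<^sup>2)) / 4"
proof -
  have s: "((\<lambda>i. complex_of_real ((cmod (f i + \<i> ^ k * g i))\<^sup>2)) has_sum
      of_real ((ell2_norm X (\<lambda>i. f i + \<i> ^ k * g i))\<^sup>2)) X" for k
    unfolding ell2_norm_sq
    by (intro has_sum_of_real has_sum_infsum ell2_summable ell2_add ell2_scale assms)
  have "((\<lambda>i. (\<Sum>k<4. \<i> ^ k * of_real ((cmod (f i + \<i> ^ k * g i))\<^sup>2)) / 4) has_sum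
      (\<Sum>k<4. \<i> ^ k * of_real ((ell2_norm X (\<lambda>i. f i + \<i> ^ k * g i))\<^sup>2)) / 4) X"
  proof -
    have "((\<lambda>i. \<Sum>k<n. \<i> ^ k * of_real ((cmod (f i + \<i> ^ k * g i))\<^sup>2)) has_sum
      (\<Sum>k<n. \<i> ^ k * of_real ((ell2_norm X (\<lambda>i. f i + \<i> ^ k * g i))\<^sup>2))) X" for n
      by (induction n) (simp_all only: sum.lessThan_Suc lessThan_0 sum.empty has_sum_0 has_sum_add
          has_sum_cmult_right s)
    then show ?thesis unfolding divide_inverse by (rule has_sum_cmult_left)
  qed
  moreover have "(\<Sum>k<4. \<i> ^ k * of_real ((cmod (x + \<i> ^ k * y))\<^sup>2)) / 4 = x * cnj y" for x y :: complex
  proof -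
    have "\<i> ^ 2 = -1" "\<i> ^ 3 = -\<i>" by (simp_all add: power3_eq_cube power2_eq_square)
    then have "(\<Sum>k<4. \<i> ^ k * of_real ((cmod (x + \<i> ^ k * y))\<^sup>2)) =
      (x + y) * cnj (x + y) + \<i> * ((x + \<i> * y) * cnj (x + \<i> * y)) - (x - y) * cnj (x - y)
       - \<i> * ((x - \<i> * y) * cnj (x - \<i> * y))"
      unfolding complex_norm_square by (simp add: numeral_eq_Suc)
    also have "\<dots> = 4 * (x * cnj y)"
      by (simp add: algebra_simps)
    finally show ?thesis by simp
  qed
  ultimately have "((\<lambda>i. f i * cnj (g i)) has_sum
      (\<Sum>k<4. \<i> ^ k * of_real ((ell2_norm X (\<lambda>i. f i + \<i> ^ k * g i))\<^sup>2)) / 4) X" by simp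
  then show ?thesis unfolding ell2_inner_def by (rule infsumI)
qed

text \<open>By polarization a linear map that preserves norms preserves inner products, so only
  norms have to be checked.\<close>

lemma unitary_opI:
  assumes surj: "U ` ell2 X = ell2 X"
    and add: "\<And>f g. f \<in> ell2 X \<Longrightarrow> g \<in> ell2 X \<Longrightarrow> U (\<lambda>i. f i + g i) = (\<lambda>i. U f i + U g i)"
    and scale: "\<And>c f. f \<in> ell2 X \<Longrightarrow> U (\<lambda>i. c * f i) = (\<lambda>i. c * U f i)"
    and norm: "\<And>f. f \<in> ell2 X \<Longrightarrow> ell2_norm X (U f) = ell2_norm X f"
  shows "unitary_op X U"
  unfolding unitary_op_def
proof (intro conjI ballI allI surj add scale)
  fix f g assume f: "f \<in> ell2 X" and g: "g \<in> ell2 X"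
  have U: "U f \<in> ell2 X" if "f \<in> ell2 X" for f using surj that by blast
  have "ell2_norm X (\<lambda>i. U f i + c * U g i) = ell2_norm X (\<lambda>i. f i + c * g i)" for c
    using norm[of "\<lambda>i. f i + c * g i"] add[of f "\<lambda>i. c * g i"] scale[of g c] f g
    by (simp add: ell2_add ell2_scale)
  then show "ell2_inner X (U f) (U g) = ell2_inner X f g"
    by (simp add: ell2_polarization f g U)
qed

lemma unitary_opD:
  assumes "unitary_op X U"
  shows "f \<in> ell2 X \<Longrightarrow> U f \<in> ell2 X"
    and "f \<in> ell2 X \<Longrightarrow> g \<in> ell2 X \<Longrightarrow> U (\<lambda>i. f i + g i) = (\<lambda>i. U f i + U g i)"
    and "f \<in> ell2 X \<Longrightarrow> U (\<lambda>i. c * f i) = (\<lambda>i. c * U f i)"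
    and "f \<in> ell2 X \<Longrightarrow> ell2_norm X (U f) = ell2_norm X f"
proof -
  show U: "f \<in> ell2 X \<Longrightarrow> U f \<in> ell2 X" using assms unfolding unitary_op_def by blast
  show "f \<in> ell2 X \<Longrightarrow> g \<in> ell2 X \<Longrightarrow> U (\<lambda>i. f i + g i) = (\<lambda>i. U f i + U g i)"
    and "f \<in> ell2 X \<Longrightarrow> U (\<lambda>i. c * f i) = (\<lambda>i. c * U f i)"
    using assms unfolding unitary_op_def by blast+
  assume f: "f \<in> ell2 X"
  have "ell2_inner X (U f) (U f) = ell2_inner X f f"
    using assms f unfolding unitary_op_def by blast
  then have "(ell2_norm X (U f))\<^sup>2 = (ell2_norm X f)\<^sup>2"
    by (simp only: ell2_inner_self[OF f] ell2_inner_self[OF U[OF f]] of_real_eq_iff)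
  then show "ell2_norm X (U f) = ell2_norm X f" by (simp add: power2_eq_iff_nonneg)
qed

section \<open>A unitary representation extended to matrices over the group algebra\<close>

locale urep =
  fixes X :: "'i set" and \<rho> :: "'g::group_add \<Rightarrow> ('i \<Rightarrow> complex) \<Rightarrow> ('i \<Rightarrow> complex)"
  assumes unitary_rep: "unitary_rep X \<rho>"
begin

lemma rho:
  shows rho_ell2: "f \<in> ell2 X \<Longrightarrow> \<rho> g f \<in> ell2 X"
    and rho_add: "f \<in> ell2 X \<Longrightarrow> f' \<in> ell2 X \<Longrightarrow> \<rho> g (\<lambda>i. f i + f' i) = (\<lambda>i. \<rho> g f i + \<rho> g f' i)"
    and rho_scale: "f \<in> ell2 X \<Longrightarrow> \<rho> g (\<lambda>i. c * f i) = (\<lambda>i. c * \<rho> g f i)"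
    and rho_norm: "f \<in> ell2 X \<Longrightarrow> ell2_norm X (\<rho> g f) = ell2_norm X f"
    and rho_zero: "f \<in> ell2 X \<Longrightarrow> \<rho> 0 f = f"
    and rho_plus: "f \<in> ell2 X \<Longrightarrow> \<rho> (g + h) f = \<rho> g (\<rho> h f)"
proof -
  have u: "unitary_op X (\<rho> g)" for g using unitary_rep by (simp add: unitary_rep_def)
  show "f \<in> ell2 X \<Longrightarrow> \<rho> g f \<in> ell2 X" by (rule unitary_opD(1)[OF u])
  show "f \<in> ell2 X \<Longrightarrow> f' \<in> ell2 X \<Longrightarrow> \<rho> g (\<lambda>i. f i + f' i) = (\<lambda>i. \<rho> g f i + \<rho> g f' i)"
    by (rule unitary_opD(2)[OF u])
  show "f \<in> ell2 X \<Longrightarrow> \<rho> g (\<lambda>i. c * f i) = (\<lambda>i. c * \<rho> g f i)" by (rule unitary_opD(3)[OF u])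
  show "f \<in> ell2 X \<Longrightarrow> ell2_norm X (\<rho> g f) = ell2_norm X f" by (rule unitary_opD(4)[OF u])
  show "f \<in> ell2 X \<Longrightarrow> \<rho> 0 f = f" "f \<in> ell2 X \<Longrightarrow> \<rho> (g + h) f = \<rho> g (\<rho> h f)"
    using unitary_rep by (simp_all add: unitary_rep_def)
qed

lemma rep_ext_superset:
  assumes "finite K" "Poly_Mapping.keys x \<subseteq> K"
  shows "rep_ext \<rho> x f i = (\<Sum>g\<in>K. lk x g * \<rho> g f i)"
  unfolding rep_ext_def using assms by (intro sum.mono_neutral_left) (auto simp: in_keys_iff)

lemma rep_ext_zero [simp]: "rep_ext \<rho> 0 f i = 0"
  by (simp add: rep_ext_def)

lemma rep_ext_single [simp]: "rep_ext \<rho> (Poly_Mapping.single g c) f i = c * \<rho> g f i"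
  by (subst rep_ext_superset[of "{g}"]) auto

lemma rep_ext_plus: "rep_ext \<rho> (x + y) f i = rep_ext \<rho> x f i + rep_ext \<rho> y f i"
proof -
  let ?K = "Poly_Mapping.keys x \<union> Poly_Mapping.keys y"
  have "Poly_Mapping.keys (x + y) \<subseteq> ?K" by (rule keys_add)
  then show ?thesis
    by (simp add: rep_ext_superset[of ?K] lookup_add algebra_simps sum.distrib)
qed

lemma rep_ext_pm_scale: "rep_ext \<rho> (pm_scale c x) f i = c * rep_ext \<rho> x f i"
proof -
  have "Poly_Mapping.keys (pm_scale c x) \<subseteq> Poly_Mapping.keys x" by (auto simp: in_keys_iff)
  then show ?thesis
    by (simp add: rep_ext_superset[of "Poly_Mapping.keys x"] sum_distrib_left algebra_simps)
qed

lemma rep_ext_sum: "rep_ext \<rho> (\<Sum>j\<in>J. x j) f i = (\<Sum>j\<in>J. rep_ext \<rho> (x j) f i)"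
  by (induction J rule: infinite_finite_induct) (simp_all add: rep_ext_plus)

lemma rep_ext_ell2: "f \<in> ell2 X \<Longrightarrow> rep_ext \<rho> x f \<in> ell2 X"
  unfolding rep_ext_def by (intro ell2_sum ell2_scale rho_ell2)

lemma rep_ext_norm_le:
  assumes "f \<in> ell2 X" "finite K" "Poly_Mapping.keys x \<subseteq> K"
  shows "ell2_norm X (rep_ext \<rho> x f) \<le> (\<Sum>g\<in>K. cmod (lk x g)) * ell2_norm X f"
proof -
  have "ell2_norm X (rep_ext \<rho> x f) = ell2_norm X (\<lambda>i. \<Sum>g\<in>K. lk x g * \<rho> g f i)"
    using rep_ext_superset[OF assms(2,3)] by presburger
  also have "\<dots> \<le> (\<Sum>g\<in>K. ell2_norm X (\<lambda>i. lk x g * \<rho> g f i))"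
    by (intro ell2_sum ell2_scale rho_ell2 assms)
  also have "\<dots> = (\<Sum>g\<in>K. cmod (lk x g)) * ell2_norm X f"
    by (simp add: ell2_scale rho_ell2 assms rho_norm sum_distrib_right)
  finally show ?thesis .
qed

lemma rep_ext_add:
  assumes "f \<in> ell2 X" "f' \<in> ell2 X"
  shows "rep_ext \<rho> x (\<lambda>i. f i + f' i) = (\<lambda>i. rep_ext \<rho> x f i + rep_ext \<rho> x f' i)"
  by (simp add: rep_ext_def rho_add assms algebra_simps sum.distrib)

lemma rep_ext_scale:
  assumes "f \<in> ell2 X"
  shows "rep_ext \<rho> x (\<lambda>i. c * f i) = (\<lambda>i. c * rep_ext \<rho> x f i)"
  by (simp add: rep_ext_def rho_scale assms sum_distrib_left algebra_simps)

lemma rep_ext_of_sum: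
  assumes "\<And>j. j \<in> J \<Longrightarrow> f j \<in> ell2 X"
  shows "rep_ext \<rho> x (\<lambda>i. \<Sum>j\<in>J. f j i) = (\<lambda>i. \<Sum>j\<in>J. rep_ext \<rho> x (f j) i)"
proof -
  have z: "rep_ext \<rho> x (\<lambda>i. 0) = (\<lambda>i. 0)" using rep_ext_scale[of "\<lambda>i. 0" x 0] by simp
  show ?thesis
    using assms
  proof (induction J rule: infinite_finite_induct)
    case (insert j J)
    have "rep_ext \<rho> x (\<lambda>i. \<Sum>j\<in>insert j J. f j i) = rep_ext \<rho> x (\<lambda>i. f j i + (\<Sum>j\<in>J. f j i))"
      using insert.hyps by simp
    also have "\<dots> = (\<lambda>i. rep_ext \<rho> x (f j) i + rep_ext \<rho> x (\<lambda>i. \<Sum>j\<in>J. f j i) i)"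
      using insert.prems by (intro rep_ext_add ell2_sum) auto
    also have "rep_ext \<rho> x (\<lambda>i. \<Sum>j\<in>J. f j i) = (\<lambda>i. \<Sum>j\<in>J. rep_ext \<rho> x (f j) i)"
      using insert.IH insert.prems by simp
    finally show ?case using insert.hyps by simp
  qed (simp_all add: z)
qed

lemma rep_ext_mult:
  assumes f: "f \<in> ell2 X"
  shows "rep_ext \<rho> (x * y) f = rep_ext \<rho> x (rep_ext \<rho> y f)"
proof (induction x rule: poly_mapping_single_induct)
  case zero show ?case by (rule ext) simp
next
  case (add g c x)
  have s: "rep_ext \<rho> (Poly_Mapping.single g c * y) f = (\<lambda>i. c * \<rho> g (rep_ext \<rho> y f) i)"
  proof (induction y rule: poly_mapping_single_induct)
    case zero
    have "\<rho> g (\<lambda>i. 0 * 0) = (\<lambda>i. 0 * \<rho> g (\<lambda>i. 0) i)" by (rule rho_scale) simp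
    moreover have "rep_ext \<rho> 0 f = (\<lambda>i. 0)" by (rule ext) simp
    ultimately show ?case by (intro ext) simp
  next
    case (add h d y)
    have e: "rep_ext \<rho> (Poly_Mapping.single h d + y) f = (\<lambda>i. d * \<rho> h f i + rep_ext \<rho> y f i)"
      by (rule ext) (simp add: rep_ext_plus)
    have "\<rho> g (\<lambda>i. d * \<rho> h f i + rep_ext \<rho> y f i) =
       (\<lambda>i. d * \<rho> g (\<rho> h f) i + \<rho> g (rep_ext \<rho> y f) i)"
      by (simp add: rho_add ell2_scale rho_ell2 rep_ext_ell2 f rho_scale)
    then show ?case
      using add.IH[THEN fun_cong]
      by (intro ext) (simp add: distrib_left rep_ext_plus mult_single rho_plus[OF f] mult.assoc)
  qed
  show ?case
    using add.IH[THEN fun_cong] s[THEN fun_cong]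
    by (intro ext) (simp add: distrib_right rep_ext_plus)
qed

definition mat_op :: "('g \<Rightarrow>\<^sub>0 complex) mat \<Rightarrow> (nat \<Rightarrow> 'i \<Rightarrow> complex) \<Rightarrow> nat \<Rightarrow> 'i \<Rightarrow> complex" where
  "mat_op A \<xi> i = (\<lambda>t. \<Sum>j<dim_col A. rep_ext \<rho> (A $$ (i, j)) (\<xi> j) t)"

definition fam_norm :: "nat \<Rightarrow> (nat \<Rightarrow> 'i \<Rightarrow> complex) \<Rightarrow> real" where
  "fam_norm n \<xi> = L2_set (\<lambda>j. ell2_norm X (\<xi> j)) {..<n}"

lemma fam_norm_nonneg [simp]: "0 \<le> fam_norm n \<xi>"
  by (simp add: fam_norm_def)

lemma fam_norm_sq: "(fam_norm n \<xi>)\<^sup>2 = (\<Sum>j<n. (ell2_norm X (\<xi> j))\<^sup>2)"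
  by (simp add: fam_norm_def L2_set_sq)

lemma fam_norm_scale:
  assumes "\<And>j. j < n \<Longrightarrow> \<xi> j \<in> ell2 X"
  shows "fam_norm n (\<lambda>j i. c * \<xi> j i) = cmod c * fam_norm n \<xi>"
proof -
  have "fam_norm n (\<lambda>j i. c * \<xi> j i) = L2_set (\<lambda>j. cmod c * ell2_norm X (\<xi> j)) {..<n}"
    unfolding fam_norm_def by (intro L2_set_cong) (auto simp: ell2_scale assms)
  then show ?thesis by (simp add: fam_norm_def L2_set_right_distrib)
qed

lemma fam_norm_triangle:
  assumes "\<And>j. j < n \<Longrightarrow> \<xi> j \<in> ell2 X" "\<And>j. j < n \<Longrightarrow> \<eta> j \<in> ell2 X"
  shows "fam_norm n (\<lambda>j i. \<xi> j i + \<eta> j i) \<le> fam_norm n \<xi> + fam_norm n \<eta>"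
proof -
  have "fam_norm n (\<lambda>j i. \<xi> j i + \<eta> j i) \<le>
      L2_set (\<lambda>j. ell2_norm X (\<xi> j) + ell2_norm X (\<eta> j)) {..<n}"
    unfolding fam_norm_def by (intro L2_set_mono) (auto intro!: ell2_add assms)
  also have "\<dots> \<le> fam_norm n \<xi> + fam_norm n \<eta>"
    unfolding fam_norm_def by (rule L2_set_triangle_ineq)
  finally show ?thesis .
qed

lemma mat_op_ell2: "(\<And>j. j < dim_col A \<Longrightarrow> \<xi> j \<in> ell2 X) \<Longrightarrow> mat_op A \<xi> i \<in> ell2 X"
  unfolding mat_op_def by (intro ell2_sum rep_ext_ell2) auto

text \<open>Estimates are made with this predicate instead of the supremum
  \<open>rep_mat_norm\<close>, whose use needs a proof that the set is bounded.\<close>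

definition op_bound :: "('g \<Rightarrow>\<^sub>0 complex) mat \<Rightarrow> real \<Rightarrow> bool" where
  "op_bound A c \<longleftrightarrow> (\<forall>\<xi>. (\<forall>j<dim_col A. \<xi> j \<in> ell2 X) \<longrightarrow>
     fam_norm (dim_row A) (mat_op A \<xi>) \<le> c * fam_norm (dim_col A) \<xi>)"

lemma op_boundD:
  "op_bound A c \<Longrightarrow> (\<And>j. j < dim_col A \<Longrightarrow> \<xi> j \<in> ell2 X) \<Longrightarrow>
    fam_norm (dim_row A) (mat_op A \<xi>) \<le> c * fam_norm (dim_col A) \<xi>"
  by (simp add: op_bound_def)

lemma op_bound_mono: "op_bound A c \<Longrightarrow> c \<le> c' \<Longrightarrow> op_bound A c'"
  unfolding op_bound_def by (meson fam_norm_nonneg mult_right_mono order_trans)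

lemma op_bound_ex:
  assumes K: "\<And>i j. i < dim_row A \<Longrightarrow> j < dim_col A \<Longrightarrow>
      (\<Sum>g\<in>Poly_Mapping.keys (A $$ (i, j)). cmod (lk (A $$ (i, j)) g)) \<le> K"
    and K0: "0 \<le> K"
  shows "op_bound A (real (dim_row A) * K * real (dim_col A))"
  unfolding op_bound_def
proof (intro allI impI)
  fix \<xi> :: "nat \<Rightarrow> 'i \<Rightarrow> complex" assume \<xi>: "\<forall>j<dim_col A. \<xi> j \<in> ell2 X"
  let ?n = "fam_norm (dim_col A) \<xi>"
  have \<xi>n: "ell2_norm X (\<xi> j) \<le> ?n" if "j < dim_col A" for j
    unfolding fam_norm_def using that by (intro member_le_L2_set) auto
  have "ell2_norm X (mat_op A \<xi> i) \<le> K * real (dim_col A) * ?n" if i: "i < dim_row A" for i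
  proof -
    have "ell2_norm X (mat_op A \<xi> i) \<le> (\<Sum>j<dim_col A. ell2_norm X (rep_ext \<rho> (A $$ (i, j)) (\<xi> j)))"
      unfolding mat_op_def using \<xi> by (intro ell2_sum rep_ext_ell2) auto
    also have "\<dots> \<le> (\<Sum>j<dim_col A. K * ?n)"
    proof (rule sum_mono)
      fix j assume "j \<in> {..<dim_col A}"
      then have j: "j < dim_col A" by simp
      have "ell2_norm X (rep_ext \<rho> (A $$ (i, j)) (\<xi> j)) \<le>
        (\<Sum>g\<in>Poly_Mapping.keys (A $$ (i, j)). cmod (lk (A $$ (i, j)) g)) * ell2_norm X (\<xi> j)"
        using \<xi> j by (intro rep_ext_norm_le) auto
      also have "\<dots> \<le> K * ?n" by (intro mult_mono K i j \<xi>n K0) simp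
      finally show "ell2_norm X (rep_ext \<rho> (A $$ (i, j)) (\<xi> j)) \<le> K * ?n" .
    qed
    finally show ?thesis by (simp add: mult_ac)
  qed
  then have "(\<Sum>i<dim_row A. ell2_norm X (mat_op A \<xi> i)) \<le> (\<Sum>i<dim_row A. K * real (dim_col A) * ?n)"
    by (intro sum_mono) auto
  moreover have "fam_norm (dim_row A) (mat_op A \<xi>) \<le> (\<Sum>i<dim_row A. ell2_norm X (mat_op A \<xi> i))"
    unfolding fam_norm_def by (rule L2_set_le_sum) simp
  ultimately show "fam_norm (dim_row A) (mat_op A \<xi>) \<le> real (dim_row A) * K * real (dim_col A) * ?n"
    by (simp add: mult_ac)
qed

lemma rep_mat_norm_eq:
  "rep_mat_norm X \<rho> A = Sup {fam_norm (dim_row A) (mat_op A \<xi>) | \<xi>.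
     (\<forall>j<dim_col A. \<xi> j \<in> ell2 X) \<and> fam_norm (dim_col A) \<xi> \<le> 1}"
  by (simp add: rep_mat_norm_def fam_norm_def mat_op_def)

lemma rep_mat_norm_le:
  assumes "op_bound A c" "0 \<le> c" shows "rep_mat_norm X \<rho> A \<le> c"
  unfolding rep_mat_norm_eq
proof (rule cSup_least)
  have "fam_norm (dim_col A) (\<lambda>j i. 0) \<le> 1" by (simp add: fam_norm_def L2_set_def)
  then show "{fam_norm (dim_row A) (mat_op A \<xi>) | \<xi>.
     (\<forall>j<dim_col A. \<xi> j \<in> ell2 X) \<and> fam_norm (dim_col A) \<xi> \<le> 1} \<noteq> {}"
    by (auto intro!: exI[of _ "\<lambda>j i. 0"])
  fix r assume "r \<in> {fam_norm (dim_row A) (mat_op A \<xi>) | \<xi>.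
     (\<forall>j<dim_col A. \<xi> j \<in> ell2 X) \<and> fam_norm (dim_col A) \<xi> \<le> 1}"
  then obtain \<xi> where r: "r = fam_norm (dim_row A) (mat_op A \<xi>)"
    and \<xi>: "\<forall>j<dim_col A. \<xi> j \<in> ell2 X" "fam_norm (dim_col A) \<xi> \<le> 1" by blast
  have "r \<le> c * fam_norm (dim_col A) \<xi>" unfolding r using \<xi> by (intro op_boundD assms) auto
  also have "\<dots> \<le> c * 1" by (intro mult_left_mono \<xi> assms)
  finally show "r \<le> c" by simp
qed

lemma rep_mat_norm_upper:
  assumes c: "op_bound A c" "0 \<le> c"
    and \<xi>: "\<forall>j<dim_col A. \<xi> j \<in> ell2 X" "fam_norm (dim_col A) \<xi> \<le> 1"
  shows "fam_norm (dim_row A) (mat_op A \<xi>) \<le> rep_mat_norm X \<rho> A"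
  unfolding rep_mat_norm_eq
proof (rule cSup_upper)
  show "fam_norm (dim_row A) (mat_op A \<xi>) \<in> {fam_norm (dim_row A) (mat_op A \<xi>) | \<xi>.
     (\<forall>j<dim_col A. \<xi> j \<in> ell2 X) \<and> fam_norm (dim_col A) \<xi> \<le> 1}"
    using \<xi> by (intro CollectI exI[of _ \<xi>]) simp
  show "bdd_above {fam_norm (dim_row A) (mat_op A \<xi>) | \<xi>.
     (\<forall>j<dim_col A. \<xi> j \<in> ell2 X) \<and> fam_norm (dim_col A) \<xi> \<le> 1}"
  proof (rule bdd_aboveI[of _ c])
    fix r assume "r \<in> {fam_norm (dim_row A) (mat_op A \<xi>) | \<xi>.
     (\<forall>j<dim_col A. \<xi> j \<in> ell2 X) \<and> fam_norm (dim_col A) \<xi> \<le> 1}"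
    then obtain \<xi> where r: "r = fam_norm (dim_row A) (mat_op A \<xi>)"
      and \<xi>: "\<forall>j<dim_col A. \<xi> j \<in> ell2 X" "fam_norm (dim_col A) \<xi> \<le> 1" by blast
    have "r \<le> c * fam_norm (dim_col A) \<xi>" unfolding r using \<xi> by (intro op_boundD c) auto
    also have "\<dots> \<le> c * 1" by (intro mult_left_mono \<xi> c)
    finally show "r \<le> c" by simp
  qed
qed

lemma rep_mat_norm_nonneg:
  assumes "op_bound A c" "0 \<le> c" shows "0 \<le> rep_mat_norm X \<rho> A"
proof -
  have "fam_norm (dim_row A) (mat_op A (\<lambda>j i. 0)) \<le> rep_mat_norm X \<rho> A"
    by (rule rep_mat_norm_upper[OF assms]) (simp_all add: fam_norm_def L2_set_def)
  then show ?thesis by (rule order_trans[OF fam_norm_nonneg])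
qed

lemma op_bound_rep_mat_norm:
  assumes c: "op_bound A c" "0 \<le> c"
  shows "op_bound A (rep_mat_norm X \<rho> A)"
  unfolding op_bound_def
proof (intro allI impI)
  fix \<xi> :: "nat \<Rightarrow> 'i \<Rightarrow> complex" assume \<xi>: "\<forall>j<dim_col A. \<xi> j \<in> ell2 X"
  let ?n = "fam_norm (dim_col A) \<xi>"
  have c': "fam_norm (dim_row A) (mat_op A \<xi>) \<le> c * ?n" using \<xi> by (intro op_boundD c) auto
  show "fam_norm (dim_row A) (mat_op A \<xi>) \<le> rep_mat_norm X \<rho> A * ?n"
  proof (cases "?n = 0")
    case True then show ?thesis using c' by simp
  next
    case False
    then have n: "0 < ?n" by (simp add: less_le)
    define z where "z = complex_of_real (1 / ?n)"
    have cz: "cmod z = 1 / ?n" using n by (simp add: z_def norm_divide)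
    define \<eta> where "\<eta> j i = z * \<xi> j i" for j i
    have \<eta>: "\<forall>j<dim_col A. \<eta> j \<in> ell2 X" using \<xi> by (simp add: \<eta>_def[abs_def] ell2_scale)
    have n1: "fam_norm (dim_col A) \<eta> = 1"
      unfolding \<eta>_def using \<xi> n by (subst fam_norm_scale) (auto simp: cz)
    have "mat_op A \<eta> i = (\<lambda>t. z * mat_op A \<xi> i t)" for i
      unfolding mat_op_def \<eta>_def using \<xi>
      by (simp add: rep_ext_scale sum_distrib_left)
    then have "fam_norm (dim_row A) (mat_op A \<eta>) = fam_norm (dim_row A) (\<lambda>i t. z * mat_op A \<xi> i t)"
      by presburger
    also have "\<dots> = cmod z * fam_norm (dim_row A) (mat_op A \<xi>)"
      using \<xi> by (intro fam_norm_scale mat_op_ell2) auto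
    finally have e: "fam_norm (dim_row A) (mat_op A \<eta>) = fam_norm (dim_row A) (mat_op A \<xi>) / ?n"
      by (simp add: cz)
    have "fam_norm (dim_row A) (mat_op A \<eta>) \<le> rep_mat_norm X \<rho> A"
      using n1 by (intro rep_mat_norm_upper[OF c \<eta>]) simp
    then show ?thesis using n by (simp add: e field_simps)
  qed
qed

end

section \<open>The operator norm of scalar matrices\<close>

lemma l2norm_sq: "(l2norm v)\<^sup>2 = (\<Sum>i<dim_vec v. (cmod (v $ i))\<^sup>2)"
  by (simp add: l2norm_def L2_set_sq)

lemma l2norm_nonneg [simp]: "0 \<le> l2norm v"
  by (simp add: l2norm_def)

lemma l2norm_smult: "l2norm (c \<cdot>\<^sub>v v) = cmod c * l2norm v"
proof -
  have "l2norm (c \<cdot>\<^sub>v v) = L2_set (\<lambda>i. cmod c * cmod (v $ i)) {..<dim_vec v}"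
    unfolding l2norm_def by (intro L2_set_cong) (auto simp: norm_mult)
  then show ?thesis by (simp add: l2norm_def L2_set_right_distrib)
qed

lemma mult_mat_vec_nth: "i < dim_row \<alpha> \<Longrightarrow> v \<in> carrier_vec (dim_col \<alpha>) \<Longrightarrow>
    (\<alpha> *\<^sub>v v) $ i = (\<Sum>j<dim_col \<alpha>. \<alpha> $$ (i, j) * v $ j)"
  by (auto simp: scalar_prod_def atLeast0LessThan intro!: sum.cong)

lemma l2norm_mult_bound:
  "\<exists>c\<ge>0. \<forall>v\<in>carrier_vec (dim_col \<alpha>). l2norm (\<alpha> *\<^sub>v v) \<le> c * l2norm v"
proof (intro exI conjI ballI)
  let ?c = "\<Sum>i<dim_row \<alpha>. \<Sum>j<dim_col \<alpha>. cmod (\<alpha> $$ (i, j))"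
  show "0 \<le> ?c" by (simp add: sum_nonneg)
  fix v :: "complex vec" assume v: "v \<in> carrier_vec (dim_col \<alpha>)"
  have "l2norm (\<alpha> *\<^sub>v v) \<le> (\<Sum>i<dim_row \<alpha>. cmod ((\<alpha> *\<^sub>v v) $ i))"
    unfolding l2norm_def dim_mult_mat_vec by (rule L2_set_le_sum) simp
  also have "\<dots> \<le> (\<Sum>i<dim_row \<alpha>. \<Sum>j<dim_col \<alpha>. cmod (\<alpha> $$ (i, j)) * l2norm v)"
  proof (rule sum_mono)
    fix i assume "i \<in> {..<dim_row \<alpha>}"
    then have i: "(\<alpha> *\<^sub>v v) $ i = (\<Sum>j<dim_col \<alpha>. \<alpha> $$ (i, j) * v $ j)"
      using v by (intro mult_mat_vec_nth) auto
    have "cmod (v $ j) \<le> l2norm v" if "j < dim_col \<alpha>" for j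
      unfolding l2norm_def using that v by (intro member_le_L2_set) auto
    then show "cmod ((\<alpha> *\<^sub>v v) $ i) \<le> (\<Sum>j<dim_col \<alpha>. cmod (\<alpha> $$ (i, j)) * l2norm v)"
      unfolding i by (intro order_trans[OF norm_sum] sum_mono) (auto simp: norm_mult mult_left_mono)
  qed
  finally show "l2norm (\<alpha> *\<^sub>v v) \<le> ?c * l2norm v" by (simp add: sum_distrib_right)
qed

lemma opnorm_le:
  assumes "\<And>v. v \<in> carrier_vec (dim_col \<alpha>) \<Longrightarrow> l2norm (\<alpha> *\<^sub>v v) \<le> c * l2norm v" "0 \<le> c"
  shows "opnorm \<alpha> \<le> c"
  unfolding opnorm_def
proof (rule cSup_least)
  have "l2norm (0\<^sub>v (dim_col \<alpha>)) \<le> 1" by (simp add: l2norm_def L2_set_def)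
  then show "{l2norm (\<alpha> *\<^sub>v v) |v. v \<in> carrier_vec (dim_col \<alpha>) \<and> l2norm v \<le> 1} \<noteq> {}"
    by (auto intro!: exI[of _ "0\<^sub>v (dim_col \<alpha>)"])
  fix r assume "r \<in> {l2norm (\<alpha> *\<^sub>v v) |v. v \<in> carrier_vec (dim_col \<alpha>) \<and> l2norm v \<le> 1}"
  then obtain v where v: "r = l2norm (\<alpha> *\<^sub>v v)" "v \<in> carrier_vec (dim_col \<alpha>)" "l2norm v \<le> 1" by blast
  have "r \<le> c * l2norm v" unfolding v(1) by (rule assms(1)[OF v(2)])
  also have "\<dots> \<le> c * 1" by (intro mult_left_mono v(3) assms(2))
  finally show "r \<le> c" by simp
qed

lemma opnorm_upper:
  assumes "v \<in> carrier_vec (dim_col \<alpha>)" "l2norm v \<le> 1" shows "l2norm (\<alpha> *\<^sub>v v) \<le> opnorm \<alpha>"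
  unfolding opnorm_def
proof (rule cSup_upper)
  show "l2norm (\<alpha> *\<^sub>v v) \<in> {l2norm (\<alpha> *\<^sub>v v) |v. v \<in> carrier_vec (dim_col \<alpha>) \<and> l2norm v \<le> 1}"
    using assms by blast
  obtain c where c: "0 \<le> c" "\<And>v. v \<in> carrier_vec (dim_col \<alpha>) \<Longrightarrow> l2norm (\<alpha> *\<^sub>v v) \<le> c * l2norm v"
    using l2norm_mult_bound[of \<alpha>] by blast
  show "bdd_above {l2norm (\<alpha> *\<^sub>v v) |v. v \<in> carrier_vec (dim_col \<alpha>) \<and> l2norm v \<le> 1}"
  proof (rule bdd_aboveI[of _ c])
    fix r assume "r \<in> {l2norm (\<alpha> *\<^sub>v v) |v. v \<in> carrier_vec (dim_col \<alpha>) \<and> l2norm v \<le> 1}"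
    then obtain v where v: "r = l2norm (\<alpha> *\<^sub>v v)" "v \<in> carrier_vec (dim_col \<alpha>)" "l2norm v \<le> 1" by blast
    have "r \<le> c * l2norm v" unfolding v(1) by (rule c(2)[OF v(2)])
    also have "\<dots> \<le> c * 1" by (intro mult_left_mono v(3) c(1))
    finally show "r \<le> c" by simp
  qed
qed

lemma opnorm_nonneg [simp]: "0 \<le> opnorm \<alpha>"
proof -
  have "l2norm (0\<^sub>v (dim_col \<alpha>)) \<le> 1" by (simp add: l2norm_def L2_set_def)
  then have "l2norm (\<alpha> *\<^sub>v 0\<^sub>v (dim_col \<alpha>)) \<le> opnorm \<alpha>" by (intro opnorm_upper) auto
  then show ?thesis by (rule order_trans[OF l2norm_nonneg])
qed

lemma l2norm_mult_le:
  assumes v: "v \<in> carrier_vec (dim_col \<alpha>)" shows "l2norm (\<alpha> *\<^sub>v v) \<le> opnorm \<alpha> * l2norm v"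
proof (cases "l2norm v = 0")
  case True
  obtain c where "0 \<le> c" "l2norm (\<alpha> *\<^sub>v v) \<le> c * l2norm v"
    using l2norm_mult_bound[of \<alpha>] v by blast
  then show ?thesis using True by simp
next
  case False
  define z where "z = complex_of_real (1 / l2norm v)"
  have z: "cmod z * l2norm v = 1" using False by (simp add: z_def norm_divide)
  have "l2norm (\<alpha> *\<^sub>v (z \<cdot>\<^sub>v v)) \<le> opnorm \<alpha>"
    using v z by (intro opnorm_upper) (auto simp: l2norm_smult)
  moreover have "\<alpha> *\<^sub>v (z \<cdot>\<^sub>v v) = z \<cdot>\<^sub>v (\<alpha> *\<^sub>v v)"
    using v by (intro mult_mat_vec[of _ "dim_row \<alpha>" "dim_col \<alpha>"]) auto
  ultimately have "cmod z * l2norm (\<alpha> *\<^sub>v v) \<le> opnorm \<alpha>" by (simp add: l2norm_smult)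
  moreover have "cmod z = 1 / l2norm v" by (simp add: z_def norm_divide)
  moreover have "0 < l2norm v" using False by (simp add: less_le)
  ultimately show ?thesis by (simp add: field_simps)
qed

lemma opnorm_sum_le:
  "(\<Sum>i<dim_row \<alpha>. (cmod (\<Sum>j<dim_col \<alpha>. \<alpha> $$ (i, j) * v j))\<^sup>2) \<le>
    (opnorm \<alpha>)\<^sup>2 * (\<Sum>j<dim_col \<alpha>. (cmod (v j))\<^sup>2)"
proof -
  let ?v = "vec (dim_col \<alpha>) v"
  have "(l2norm (\<alpha> *\<^sub>v ?v))\<^sup>2 \<le> (opnorm \<alpha> * l2norm ?v)\<^sup>2"
    by (intro power_mono l2norm_mult_le) auto
  moreover have "(l2norm (\<alpha> *\<^sub>v ?v))\<^sup>2 =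
      (\<Sum>i<dim_row \<alpha>. (cmod (\<Sum>j<dim_col \<alpha>. \<alpha> $$ (i, j) * v j))\<^sup>2)"
    unfolding l2norm_sq dim_mult_mat_vec by (intro sum.cong) (auto simp: mult_mat_vec_nth simp del: index_mult_mat_vec)
  ultimately show ?thesis by (simp add: l2norm_sq power_mult_distrib)
qed

lemma dim_diag_of [simp]: "dim_row (diag_of r y) = r" "dim_col (diag_of r y) = r"
  by (simp_all add: diag_of_def)

lemma opnorm_one_le: "opnorm (1\<^sub>m n) \<le> 1"
  by (rule opnorm_le) auto

lemma mat_adjoint_index:
  "i < dim_col \<alpha> \<Longrightarrow> j < dim_row \<alpha> \<Longrightarrow> mat_adjoint \<alpha> $$ (i, j) = cnj (\<alpha> $$ (j, i))"
  for \<alpha> :: "complex mat"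
  by (simp add: mat_adjoint_def mat_of_rows_def)

lemma dim_mat_adjoint [simp]: "dim_row (mat_adjoint \<alpha>) = dim_col \<alpha>" "dim_col (mat_adjoint \<alpha>) = dim_row \<alpha>"
  by (simp_all add: mat_adjoint_def)

text \<open>With w the image of v under the adjoint, the square of w is the inner product of v with
  \<alpha> w. Cauchy-Schwarz bounds it by the product of the norms of v, \<alpha> and w, and one
  factor w is divided out.\<close>

lemma opnorm_adjoint_le: "opnorm (mat_adjoint \<alpha>) \<le> opnorm \<alpha>"
proof (rule opnorm_le)
  fix v :: "complex vec" assume v: "v \<in> carrier_vec (dim_col (mat_adjoint \<alpha>))"
  define w where "w = mat_adjoint \<alpha> *\<^sub>v v"
  have w: "w \<in> carrier_vec (dim_col \<alpha>)" unfolding w_def by (rule carrier_vecI) simp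
  have wi: "w $ i = (\<Sum>p<dim_row \<alpha>. cnj (\<alpha> $$ (p, i)) * v $ p)" if "i < dim_col \<alpha>" for i
  proof -
    have "w $ i = (\<Sum>p<dim_col (mat_adjoint \<alpha>). mat_adjoint \<alpha> $$ (i, p) * v $ p)"
      unfolding w_def using that v by (intro mult_mat_vec_nth) simp_all
    also have "\<dots> = (\<Sum>p<dim_row \<alpha>. cnj (\<alpha> $$ (p, i)) * v $ p)"
      using that by (intro sum.cong) (simp_all add: mat_adjoint_index)
    finally show ?thesis .
  qed
  have dv: "dim_vec v = dim_row \<alpha>" and dw: "dim_vec w = dim_col \<alpha>" using v w by simp_all
  have "complex_of_real ((l2norm w)\<^sup>2) = (\<Sum>i<dim_col \<alpha>. w $ i * cnj (w $ i))"
    by (simp only: l2norm_sq of_real_sum complex_norm_square dw)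
  also have "\<dots> = (\<Sum>i<dim_col \<alpha>. \<Sum>p<dim_row \<alpha>. cnj (w $ i) * (cnj (\<alpha> $$ (p, i)) * v $ p))"
  proof (rule sum.cong[OF HOL.refl])
    fix i assume "i \<in> {..<dim_col \<alpha>}"
    then have "cnj (w $ i) * (\<Sum>p<dim_row \<alpha>. cnj (\<alpha> $$ (p, i)) * v $ p) = cnj (w $ i) * w $ i"
      using wi[of i] by (simp only: lessThan_iff)
    then show "w $ i * cnj (w $ i) = (\<Sum>p<dim_row \<alpha>. cnj (w $ i) * (cnj (\<alpha> $$ (p, i)) * v $ p))"
      by (simp only: sum_distrib_left mult.commute)
  qed
  also have "\<dots> = (\<Sum>p<dim_row \<alpha>. \<Sum>i<dim_col \<alpha>. cnj (w $ i) * (cnj (\<alpha> $$ (p, i)) * v $ p))"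
    by (rule sum.swap)
  also have "\<dots> = (\<Sum>p<dim_row \<alpha>. v $ p * cnj ((\<alpha> *\<^sub>v w) $ p))"
  proof (rule sum.cong[OF HOL.refl])
    fix p assume "p \<in> {..<dim_row \<alpha>}"
    then have "(\<alpha> *\<^sub>v w) $ p = (\<Sum>i<dim_col \<alpha>. \<alpha> $$ (p, i) * w $ i)"
      using w by (intro mult_mat_vec_nth) auto
    then show "(\<Sum>i<dim_col \<alpha>. cnj (w $ i) * (cnj (\<alpha> $$ (p, i)) * v $ p)) = v $ p * cnj ((\<alpha> *\<^sub>v w) $ p)"
      by (simp only: cnj_sum complex_cnj_mult sum_distrib_left mult_ac)
  qed
  finally have "cmod (complex_of_real ((l2norm w)\<^sup>2)) = cmod (\<Sum>p<dim_row \<alpha>. v $ p * cnj ((\<alpha> *\<^sub>v w) $ p))"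
    by (rule arg_cong)
  then have "(l2norm w)\<^sup>2 = cmod (\<Sum>p<dim_row \<alpha>. v $ p * cnj ((\<alpha> *\<^sub>v w) $ p))"
    by (simp only: norm_of_real abs_power2)
  also have "\<dots> \<le> (\<Sum>p<dim_row \<alpha>. \<bar>cmod (v $ p)\<bar> * \<bar>cmod ((\<alpha> *\<^sub>v w) $ p)\<bar>)"
    using norm_sum[of "\<lambda>p. v $ p * cnj ((\<alpha> *\<^sub>v w) $ p)" "{..<dim_row \<alpha>}"]
    by (simp only: norm_mult complex_mod_cnj abs_norm_cancel)
  also have "\<dots> \<le> l2norm v * l2norm (\<alpha> *\<^sub>v w)"
    unfolding l2norm_def dim_mult_mat_vec dv by (rule L2_set_mult_ineq)
  also have "\<dots> \<le> l2norm v * (opnorm \<alpha> * l2norm w)"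
    by (intro mult_left_mono l2norm_mult_le w) simp
  finally have "l2norm w * l2norm w \<le> (opnorm \<alpha> * l2norm v) * l2norm w"
    by (simp add: power2_eq_square mult_ac)
  then have "l2norm w \<le> opnorm \<alpha> * l2norm v"
  proof (cases "l2norm w = 0")
    case False
    then have "0 < l2norm w" using l2norm_nonneg[of w] by linarith
    with \<open>l2norm w * l2norm w \<le> _\<close> show ?thesis by (rule mult_right_le_imp_le)
  qed simp
  then show "l2norm (mat_adjoint \<alpha> *\<^sub>v v) \<le> opnorm \<alpha> * l2norm v"
    by (simp only: w_def)
qed (rule opnorm_nonneg)

section \<open>Operator bounds for scalar matrices, products, diagonals and direct sums\<close>

context urep
begin

lemma op_bound_sqI:
  assumes "\<And>\<xi>. (\<forall>j<dim_col A. \<xi> j \<in> ell2 X) \<Longrightarrow>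
     (\<Sum>i<dim_row A. (ell2_norm X (mat_op A \<xi> i))\<^sup>2) \<le> c\<^sup>2 * (\<Sum>j<dim_col A. (ell2_norm X (\<xi> j))\<^sup>2)"
    and "0 \<le> c"
  shows "op_bound A c"
  unfolding op_bound_def
proof (intro allI impI, rule power2_le_imp_le)
  fix \<xi> :: "nat \<Rightarrow> 'i \<Rightarrow> complex" assume "\<forall>j<dim_col A. \<xi> j \<in> ell2 X"
  from assms(1)[OF this]
  show "(fam_norm (dim_row A) (mat_op A \<xi>))\<^sup>2 \<le> (c * fam_norm (dim_col A) \<xi>)\<^sup>2"
    by (simp add: fam_norm_sq power_mult_distrib)
qed (simp add: assms)

text \<open>The scalar matrix acts separately at each point \<open>t\<close> of X, on the vector of
  values at \<open>t\<close>; the pointwise bounds are summed over \<open>t\<close>.\<close>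

lemma op_bound_scalar: "op_bound (map_mat (Poly_Mapping.single 0) \<alpha>) (opnorm \<alpha>)"
proof (rule op_bound_sqI)
  fix \<xi> :: "nat \<Rightarrow> 'i \<Rightarrow> complex"
  assume "\<forall>j<dim_col (map_mat (Poly_Mapping.single (0::'g)) \<alpha>). \<xi> j \<in> ell2 X"
  then have \<xi>: "\<xi> j \<in> ell2 X" if "j < dim_col \<alpha>" for j using that by simp
  let ?A = "map_mat (Poly_Mapping.single (0::'g)) \<alpha>"
  have m: "mat_op ?A \<xi> i t = (\<Sum>j<dim_col \<alpha>. \<alpha> $$ (i, j) * \<xi> j t)" if "i < dim_row \<alpha>" for i t
    unfolding mat_op_def using that by (auto simp: rho_zero \<xi> intro!: sum.cong)
  have e: "mat_op ?A \<xi> i \<in> ell2 X" for i by (rule mat_op_ell2) (simp add: \<xi>)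
  have "(\<Sum>i<dim_row \<alpha>. (ell2_norm X (mat_op ?A \<xi> i))\<^sup>2) =
      (\<Sum>\<^sub>\<infinity>t\<in>X. \<Sum>i<dim_row \<alpha>. (cmod (mat_op ?A \<xi> i t))\<^sup>2)"
    unfolding ell2_norm_sq by (rule infsum_finite_sum(2)[symmetric]) (rule ell2_summable[OF e])
  also have "\<dots> \<le> (\<Sum>\<^sub>\<infinity>t\<in>X. (opnorm \<alpha>)\<^sup>2 * (\<Sum>j<dim_col \<alpha>. (cmod (\<xi> j t))\<^sup>2))"
  proof (rule infsum_mono)
    show "(\<lambda>t. \<Sum>i<dim_row \<alpha>. (cmod (mat_op ?A \<xi> i t))\<^sup>2) summable_on X"
      by (rule infsum_finite_sum(1)) (rule ell2_summable[OF e])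
    show "(\<lambda>t. (opnorm \<alpha>)\<^sup>2 * (\<Sum>j<dim_col \<alpha>. (cmod (\<xi> j t))\<^sup>2)) summable_on X"
      by (intro summable_on_cmult_right infsum_finite_sum(1) ell2_summable \<xi>) simp
    show "(\<Sum>i<dim_row \<alpha>. (cmod (mat_op ?A \<xi> i t))\<^sup>2) \<le>
        (opnorm \<alpha>)\<^sup>2 * (\<Sum>j<dim_col \<alpha>. (cmod (\<xi> j t))\<^sup>2)" for t
      using opnorm_sum_le[of \<alpha> "\<lambda>j. \<xi> j t"] by (simp add: m)
  qed
  also have "\<dots> = (opnorm \<alpha>)\<^sup>2 * (\<Sum>j<dim_col \<alpha>. (ell2_norm X (\<xi> j))\<^sup>2)"
    unfolding infsum_cmult_right' ell2_norm_sq
    by (subst infsum_finite_sum(2)) (auto intro!: ell2_summable \<xi>)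
  finally show "(\<Sum>i<dim_row ?A. (ell2_norm X (mat_op ?A \<xi> i))\<^sup>2) \<le>
      (opnorm \<alpha>)\<^sup>2 * (\<Sum>j<dim_col ?A. (ell2_norm X (\<xi> j))\<^sup>2)" by simp
qed simp

lemma mat_op_mult:
  assumes "dim_col A = dim_row B" "i < dim_row A" and \<xi>: "\<And>j. j < dim_col B \<Longrightarrow> \<xi> j \<in> ell2 X"
  shows "mat_op (A * B) \<xi> i = mat_op A (mat_op B \<xi>) i"
proof
  fix t
  have "mat_op (A * B) \<xi> i t = (\<Sum>j<dim_col B. rep_ext \<rho> (\<Sum>k<dim_row B. A $$ (i, k) * B $$ (k, j)) (\<xi> j) t)"
    unfolding mat_op_def using assms(1,2)
    by (auto simp: scalar_prod_def atLeast0LessThan intro!: sum.cong)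
  also have "\<dots> = (\<Sum>j<dim_col B. \<Sum>k<dim_row B. rep_ext \<rho> (A $$ (i, k)) (rep_ext \<rho> (B $$ (k, j)) (\<xi> j)) t)"
    by (intro sum.cong HOL.refl) (simp add: rep_ext_sum rep_ext_mult \<xi>)
  also have "\<dots> = (\<Sum>k<dim_row B. \<Sum>j<dim_col B. rep_ext \<rho> (A $$ (i, k)) (rep_ext \<rho> (B $$ (k, j)) (\<xi> j)) t)"
    by (rule sum.swap)
  also have "\<dots> = mat_op A (mat_op B \<xi>) i t"
    unfolding mat_op_def assms(1)
  proof (rule sum.cong[OF HOL.refl])
    fix k
    have "rep_ext \<rho> (A $$ (i, k)) (\<lambda>t. \<Sum>j<dim_col B. rep_ext \<rho> (B $$ (k, j)) (\<xi> j) t) =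
        (\<lambda>t. \<Sum>j<dim_col B. rep_ext \<rho> (A $$ (i, k)) (rep_ext \<rho> (B $$ (k, j)) (\<xi> j)) t)"
      by (rule rep_ext_of_sum) (simp add: rep_ext_ell2 \<xi>)
    then show "(\<Sum>j<dim_col B. rep_ext \<rho> (A $$ (i, k)) (rep_ext \<rho> (B $$ (k, j)) (\<xi> j)) t) =
        rep_ext \<rho> (A $$ (i, k)) (\<lambda>t. \<Sum>j<dim_col B. rep_ext \<rho> (B $$ (k, j)) (\<xi> j) t) t"
      by simp
  qed
  finally show "mat_op (A * B) \<xi> i t = mat_op A (mat_op B \<xi>) i t" .
qed

lemma fam_norm_cong: "(\<And>j. j < n \<Longrightarrow> \<xi> j = \<eta> j) \<Longrightarrow> fam_norm n \<xi> = fam_norm n \<eta>"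
  unfolding fam_norm_def by (intro L2_set_cong) auto

lemma op_bound_mult:
  assumes "op_bound A a" "op_bound B b" "dim_col A = dim_row B" "0 \<le> a"
  shows "op_bound (A * B) (a * b)"
  unfolding op_bound_def
proof (intro allI impI)
  fix \<xi> :: "nat \<Rightarrow> 'i \<Rightarrow> complex" assume "\<forall>j<dim_col (A * B). \<xi> j \<in> ell2 X"
  then have \<xi>: "\<xi> j \<in> ell2 X" if "j < dim_col B" for j using that by simp
  have "fam_norm (dim_row A) (mat_op (A * B) \<xi>) = fam_norm (dim_row A) (mat_op A (mat_op B \<xi>))"
    by (intro fam_norm_cong mat_op_mult assms(3) \<xi>)
  also have "\<dots> \<le> a * fam_norm (dim_row B) (mat_op B \<xi>)"
    using op_boundD[OF assms(1), of "mat_op B \<xi>"] mat_op_ell2[of B \<xi>] \<xi> assms(3) by auto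
  also have "\<dots> \<le> a * (b * fam_norm (dim_col B) \<xi>)"
    by (intro mult_left_mono op_boundD assms \<xi>)
  finally show "fam_norm (dim_row (A * B)) (mat_op (A * B) \<xi>) \<le> a * b * fam_norm (dim_col (A * B)) \<xi>"
    by simp
qed

text \<open>Each diagonal entry is sent to a combination of unitaries whose coefficients have
  absolute sum at most 1, hence to a contraction.\<close>

lemma op_bound_diag:
  assumes "\<And>l. l < r \<Longrightarrow> \<exists>K. finite K \<and> Poly_Mapping.keys (y l) \<subseteq> K \<and> (\<Sum>g\<in>K. cmod (lk (y l) g)) \<le> 1"
  shows "op_bound (diag_of r y) 1"
proof (rule op_bound_sqI)
  fix \<xi> :: "nat \<Rightarrow> 'i \<Rightarrow> complex" assume "\<forall>j<dim_col (diag_of r y). \<xi> j \<in> ell2 X"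
  then have \<xi>: "\<xi> j \<in> ell2 X" if "j < r" for j using that by (simp add: diag_of_def)
  have "(ell2_norm X (mat_op (diag_of r y) \<xi> i))\<^sup>2 \<le> (ell2_norm X (\<xi> i))\<^sup>2" if i: "i < r" for i
  proof (rule power_mono)
    have "mat_op (diag_of r y) \<xi> i = rep_ext \<rho> (y i) (\<xi> i)"
    proof
      fix t
      have "mat_op (diag_of r y) \<xi> i t = (\<Sum>j<r. if j = i then rep_ext \<rho> (y i) (\<xi> i) t else 0)"
        unfolding mat_op_def using i by (intro sum.cong) (auto simp: diag_of_def)
      then show "mat_op (diag_of r y) \<xi> i t = rep_ext \<rho> (y i) (\<xi> i) t" using i by simp
    qed
    moreover obtain K where "finite K" "Poly_Mapping.keys (y i) \<subseteq> K" "(\<Sum>g\<in>K. cmod (lk (y i) g)) \<le> 1"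
      using assms[OF i] by blast
    ultimately show "ell2_norm X (mat_op (diag_of r y) \<xi> i) \<le> ell2_norm X (\<xi> i)"
      using rep_ext_norm_le[OF \<xi>[OF i], of K "y i"]
        mult_right_mono[of "\<Sum>g\<in>K. cmod (lk (y i) g)" 1 "ell2_norm X (\<xi> i)"] by simp
  qed simp
  then have "(\<Sum>i<r. (ell2_norm X (mat_op (diag_of r y) \<xi> i))\<^sup>2) \<le> (\<Sum>j<r. (ell2_norm X (\<xi> j))\<^sup>2)"
    by (intro sum_mono) simp
  then show "(\<Sum>i<dim_row (diag_of r y). (ell2_norm X (mat_op (diag_of r y) \<xi> i))\<^sup>2) \<le>
      1\<^sup>2 * (\<Sum>j<dim_col (diag_of r y). (ell2_norm X (\<xi> j))\<^sup>2)"
    by simp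
qed simp

end

lemma pm_scale_eq_mult: "pm_scale c x = Poly_Mapping.single 0 c * x"
  for x :: "'g::monoid_add \<Rightarrow>\<^sub>0 complex"
proof (induction x rule: poly_mapping_single_induct)
  case (add b d u)
  have "pm_scale c (Poly_Mapping.single b d) = Poly_Mapping.single b (c * d)"
    by (rule poly_mapping_eqI) (simp add: lookup_single when_def)
  then show ?case using add by (simp add: pm.scale_right_distrib distrib_left mult_single)
qed simp

lemma mult_single_zero_commute: "x * Poly_Mapping.single 0 c = Poly_Mapping.single 0 c * x"
  for x :: "'g::monoid_add \<Rightarrow>\<^sub>0 complex"
  by (induction x rule: poly_mapping_single_induct)
    (simp_all add: distrib_left distrib_right mult_single mult.commute)

abbreviation scalar_mat :: "complex mat \<Rightarrow> ('g::group_add \<Rightarrow>\<^sub>0 complex) mat" where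
  "scalar_mat \<equiv> map_mat (Poly_Mapping.single 0)"

text \<open>Scalars embed as multiples of the identity, which commute with the group algebra. Scalar
  matrices thus become ordinary factors, and product estimates apply to them.\<close>

lemma sandwich_eq_mult:
  fixes A :: "('g::group_add \<Rightarrow>\<^sub>0 complex) mat"
  assumes "dim_col \<alpha> = dim_row A" "dim_row \<beta> = dim_col A"
  shows "sandwich \<alpha> A \<beta> = scalar_mat \<alpha> * (A * scalar_mat \<beta>)"
proof (rule eq_matI)
  fix i j assume "i < dim_row (scalar_mat \<alpha> * (A * scalar_mat \<beta>))"
    "j < dim_col (scalar_mat \<alpha> * (A * scalar_mat \<beta>))"
  then have ij: "i < dim_row \<alpha>" "j < dim_col \<beta>" by simp_all
  have "(scalar_mat \<alpha> * (A * scalar_mat \<beta>)) $$ (i, j) = (\<Sum>p<dim_row A. Poly_Mapping.single 0 (\<alpha> $$ (i, p)) *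
      (\<Sum>q<dim_col A. A $$ (p, q) * Poly_Mapping.single 0 (\<beta> $$ (q, j))))"
    using ij assms by (simp add: scalar_prod_def atLeast0LessThan)
  also have "\<dots> = (\<Sum>p<dim_row A. \<Sum>q<dim_col A. pm_scale (\<alpha> $$ (i, p) * \<beta> $$ (q, j)) (A $$ (p, q)))"
  proof -
    have "Poly_Mapping.single 0 a * (x * Poly_Mapping.single 0 b) = pm_scale (a * b) x"
      for a b and x :: "'g \<Rightarrow>\<^sub>0 complex"
      by (simp only: pm_scale_eq_mult mult_single_zero_commute[of x] mult.assoc[symmetric]
          mult_single add_0)
    then show ?thesis by (simp only: sum_distrib_left)
  qed
  finally show "sandwich \<alpha> A \<beta> $$ (i, j) = (scalar_mat \<alpha> * (A * scalar_mat \<beta>)) $$ (i, j)"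
    using ij by (simp add: sandwich_def)
qed (simp_all add: sandwich_def)

context urep
begin

lemma op_bound_sandwich:
  assumes "op_bound A a" "0 \<le> a" "dim_col \<alpha> = dim_row A" "dim_row \<beta> = dim_col A"
  shows "op_bound (sandwich \<alpha> A \<beta>) (opnorm \<alpha> * (a * opnorm \<beta>))"
  unfolding sandwich_eq_mult[OF assms(3,4)]
  by (intro op_bound_mult op_bound_scalar) (use assms in simp_all)

lemma op_bound_add:
  assumes "op_bound A a" "op_bound B b" "A \<in> carrier_mat n k" "B \<in> carrier_mat n k"
  shows "op_bound (A + B) (a + b)"
  unfolding op_bound_def
proof (intro allI impI)
  fix \<xi> :: "nat \<Rightarrow> 'i \<Rightarrow> complex" assume "\<forall>j<dim_col (A + B). \<xi> j \<in> ell2 X"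
  then have \<xi>: "\<xi> j \<in> ell2 X" if "j < k" for j using that assms by simp
  have "fam_norm n (mat_op (A + B) \<xi>) = fam_norm n (\<lambda>i t. mat_op A \<xi> i t + mat_op B \<xi> i t)"
    by (intro fam_norm_cong ext)
      (use assms(3,4) in \<open>simp add: mat_op_def rep_ext_plus sum.distrib\<close>)
  also have "\<dots> \<le> fam_norm n (mat_op A \<xi>) + fam_norm n (mat_op B \<xi>)"
    using assms(3,4) \<xi> by (intro fam_norm_triangle mat_op_ell2) auto
  also have "\<dots> \<le> a * fam_norm k \<xi> + b * fam_norm k \<xi>"
    using op_boundD[OF assms(1), of \<xi>] op_boundD[OF assms(2), of \<xi>] assms(3,4) \<xi>
    by (intro add_mono) auto
  finally show "fam_norm (dim_row (A + B)) (mat_op (A + B) \<xi>) \<le> (a + b) * fam_norm (dim_col (A + B)) \<xi>"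
    using assms(3,4) by (simp add: distrib_right)
qed

lemma op_bound_scale:
  assumes "op_bound A a" shows "op_bound (mat_scale c A) (cmod c * a)"
  unfolding op_bound_def
proof (intro allI impI)
  fix \<xi> :: "nat \<Rightarrow> 'i \<Rightarrow> complex" assume "\<forall>j<dim_col (mat_scale c A). \<xi> j \<in> ell2 X"
  then have \<xi>: "\<xi> j \<in> ell2 X" if "j < dim_col A" for j using that by (simp add: mat_scale_def)
  have "fam_norm (dim_row A) (mat_op (mat_scale c A) \<xi>) = fam_norm (dim_row A) (\<lambda>i t. c * mat_op A \<xi> i t)"
    by (intro fam_norm_cong ext) (simp add: mat_op_def mat_scale_def rep_ext_pm_scale sum_distrib_left)
  also have "\<dots> = cmod c * fam_norm (dim_row A) (mat_op A \<xi>)"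
    by (intro fam_norm_scale mat_op_ell2 \<xi>)
  also have "\<dots> \<le> cmod c * (a * fam_norm (dim_col A) \<xi>)"
    by (intro mult_left_mono op_boundD assms \<xi>) simp_all
  finally show "fam_norm (dim_row (mat_scale c A)) (mat_op (mat_scale c A) \<xi>) \<le>
      cmod c * a * fam_norm (dim_col (mat_scale c A)) \<xi>" by (simp add: mat_scale_def)
qed

lemma op_bound_zero: "op_bound (0\<^sub>m n k) 0"
  by (simp add: op_bound_def mat_op_def fam_norm_def L2_set_def)

lemma mat_op_direct_sum:
  assumes "\<And>j. j < dim_col A + dim_col B \<Longrightarrow> \<xi> j \<in> ell2 X"
  shows "i < dim_row A \<Longrightarrow> mat_op (direct_sum_mat A B) \<xi> i = mat_op A \<xi> i"
    and "i < dim_row B \<Longrightarrow> mat_op (direct_sum_mat A B) \<xi> (dim_row A + i) =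
      mat_op B (\<lambda>j. \<xi> (dim_col A + j)) i"
  unfolding mat_op_def
  by (rule ext; simp add: direct_sum_mat_def sum_lessThan_add)+

lemma op_bound_direct_sum:
  assumes "op_bound A a" "op_bound B b" "0 \<le> a" "0 \<le> b"
  shows "op_bound (direct_sum_mat A B) (max a b)"
proof (rule op_bound_sqI)
  fix \<xi> :: "nat \<Rightarrow> 'i \<Rightarrow> complex" assume "\<forall>j<dim_col (direct_sum_mat A B). \<xi> j \<in> ell2 X"
  then have \<xi>: "\<xi> j \<in> ell2 X" if "j < dim_col A + dim_col B" for j
    using that by (simp add: direct_sum_mat_def)
  let ?\<xi> = "\<lambda>j. \<xi> (dim_col A + j)" and ?m = "max a b"
  have "fam_norm (dim_row A) (mat_op A \<xi>) \<le> ?m * fam_norm (dim_col A) \<xi>"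
    by (rule op_boundD[OF op_bound_mono[OF assms(1)]]) (simp_all add: \<xi>)
  then have "(fam_norm (dim_row A) (mat_op A \<xi>))\<^sup>2 \<le> (?m * fam_norm (dim_col A) \<xi>)\<^sup>2"
    by (rule power_mono) simp
  moreover have "fam_norm (dim_row B) (mat_op B ?\<xi>) \<le> ?m * fam_norm (dim_col B) ?\<xi>"
    by (rule op_boundD[OF op_bound_mono[OF assms(2)]]) (simp_all add: \<xi>)
  then have "(fam_norm (dim_row B) (mat_op B ?\<xi>))\<^sup>2 \<le> (?m * fam_norm (dim_col B) ?\<xi>)\<^sup>2"
    by (rule power_mono) simp
  ultimately show "(\<Sum>i<dim_row (direct_sum_mat A B). (ell2_norm X (mat_op (direct_sum_mat A B) \<xi> i))\<^sup>2) \<le>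
      ?m\<^sup>2 * (\<Sum>j<dim_col (direct_sum_mat A B). (ell2_norm X (\<xi> j))\<^sup>2)"
    by (simp add: fam_norm_sq power_mult_distrib sum_lessThan_add mat_op_direct_sum \<xi> distrib_left
        direct_sum_mat_def[THEN arg_cong[where f = dim_row]]
        direct_sum_mat_def[THEN arg_cong[where f = dim_col]])
qed (use assms in simp)

lemma op_bound_direct_summand:
  assumes "op_bound (direct_sum_mat A B) c"
  shows "op_bound A c" and "op_bound B c"
proof -
  have dim: "dim_row (direct_sum_mat A B) = dim_row A + dim_row B"
      "dim_col (direct_sum_mat A B) = dim_col A + dim_col B"
    by (simp_all add: direct_sum_mat_def)
  have split: "fam_norm (m + n) \<eta> = sqrt ((fam_norm m \<eta>)\<^sup>2 + (fam_norm n (\<lambda>j. \<eta> (m + j)))\<^sup>2)"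
    for m n and \<eta> :: "nat \<Rightarrow> 'i \<Rightarrow> complex"
    by (simp add: fam_norm_def L2_set_def sum_lessThan_add sum_nonneg)
  show "op_bound A c"
    unfolding op_bound_def
  proof (intro allI impI)
    fix \<xi> :: "nat \<Rightarrow> 'i \<Rightarrow> complex" assume \<xi>: "\<forall>j<dim_col A. \<xi> j \<in> ell2 X"
    define \<eta> where "\<eta> = (\<lambda>j. if j < dim_col A then \<xi> j else (\<lambda>t. 0))"
    have \<eta>: "\<eta> j \<in> ell2 X" for j using \<xi> by (simp add: \<eta>_def)
    have "fam_norm (dim_row A) (mat_op A \<xi>) = fam_norm (dim_row A) (mat_op (direct_sum_mat A B) \<eta>)"
      by (rule fam_norm_cong) (simp add: mat_op_direct_sum \<eta>, simp add: mat_op_def \<eta>_def)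
    also have "\<dots> \<le> fam_norm (dim_row A + dim_row B) (mat_op (direct_sum_mat A B) \<eta>)"
      unfolding split by (rule real_le_rsqrt) simp
    also have "\<dots> \<le> c * fam_norm (dim_col A + dim_col B) \<eta>"
      using op_boundD[OF assms, of \<eta>] \<eta> by (simp add: dim)
    also have "fam_norm (dim_col A + dim_col B) \<eta> = fam_norm (dim_col A) \<xi>"
    proof -
      have "fam_norm (dim_col B) (\<lambda>j. \<eta> (dim_col A + j)) = 0"
        by (simp add: fam_norm_def L2_set_def \<eta>_def)
      moreover have "fam_norm (dim_col A) \<eta> = fam_norm (dim_col A) \<xi>"
        by (rule fam_norm_cong) (simp add: \<eta>_def)
      ultimately show ?thesis unfolding split by simp
    qed
    finally show "fam_norm (dim_row A) (mat_op A \<xi>) \<le> c * fam_norm (dim_col A) \<xi>" .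
  qed
  show "op_bound B c"
    unfolding op_bound_def
  proof (intro allI impI)
    fix \<xi> :: "nat \<Rightarrow> 'i \<Rightarrow> complex" assume \<xi>: "\<forall>j<dim_col B. \<xi> j \<in> ell2 X"
    define \<eta> where "\<eta> = (\<lambda>j. if dim_col A \<le> j \<and> j < dim_col A + dim_col B then \<xi> (j - dim_col A) else (\<lambda>t. 0))"
    have \<eta>: "\<eta> j \<in> ell2 X" for j using \<xi> by (auto simp: \<eta>_def)
    have \<eta>\<xi>: "\<eta> (dim_col A + j) = \<xi> j" if "j < dim_col B" for j using that by (simp add: \<eta>_def)
    have "fam_norm (dim_row B) (mat_op B \<xi>) =
        fam_norm (dim_row B) (\<lambda>i. mat_op (direct_sum_mat A B) \<eta> (dim_row A + i))"
      by (rule fam_norm_cong) (simp add: mat_op_direct_sum \<eta>, simp add: mat_op_def \<eta>\<xi>)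
    also have "\<dots> \<le> fam_norm (dim_row A + dim_row B) (mat_op (direct_sum_mat A B) \<eta>)"
      unfolding split by (rule real_le_rsqrt) simp
    also have "\<dots> \<le> c * fam_norm (dim_col A + dim_col B) \<eta>"
      using op_boundD[OF assms, of \<eta>] \<eta> by (simp add: dim)
    also have "fam_norm (dim_col A + dim_col B) \<eta> = fam_norm (dim_col B) \<xi>"
    proof -
      have "fam_norm (dim_col A) \<eta> = 0"
        by (simp add: fam_norm_def L2_set_def \<eta>_def)
      moreover have "fam_norm (dim_col B) (\<lambda>j. \<eta> (dim_col A + j)) = fam_norm (dim_col B) \<xi>"
        by (rule fam_norm_cong) (simp add: \<eta>\<xi>)
      ultimately show ?thesis unfolding split by simp
    qed
    finally show "fam_norm (dim_row B) (mat_op B \<xi>) \<le> c * fam_norm (dim_col B) \<xi>" .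
  qed
qed

end

section \<open>The matrix norms of the universal group C*-algebra\<close>

text \<open>Group elements act isometrically, so a bound made of the coefficients of A serves all
  representations at once. This keeps the supremum defining the C*-norm finite.\<close>

lemma op_bound_uniform:
  fixes A :: "('g::group_add \<Rightarrow>\<^sub>0 complex) mat"
  shows "\<exists>c\<ge>0. \<forall>(X :: 'i set) \<rho>. unitary_rep X \<rho> \<longrightarrow> urep.op_bound X \<rho> A c"
proof -
  define l where "l i j = (\<Sum>g\<in>Poly_Mapping.keys (A $$ (i, j)). cmod (lk (A $$ (i, j)) g))" for i j
  have l: "0 \<le> l i j" for i j by (simp add: l_def sum_nonneg)
  define K where "K = (\<Sum>i<dim_row A. \<Sum>j<dim_col A. l i j)"
  have K: "l i j \<le> K" if "i < dim_row A" "j < dim_col A" for i j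
  proof -
    have "l i j \<le> (\<Sum>j<dim_col A. l i j)" using that l by (intro member_le_sum) auto
    also have "\<dots> \<le> K"
      unfolding K_def using that l by (intro member_le_sum[of i]) (auto intro: sum_nonneg)
    finally show ?thesis .
  qed
  have K0: "0 \<le> K" by (simp add: K_def l sum_nonneg)
  show ?thesis
  proof (intro exI conjI allI impI)
    show "0 \<le> real (dim_row A) * K * real (dim_col A)" using K0 by simp
    fix X :: "'i set" and \<rho> :: "'g \<Rightarrow> ('i \<Rightarrow> complex) \<Rightarrow> 'i \<Rightarrow> complex" assume "unitary_rep X \<rho>"
    then interpret urep X \<rho> by unfold_locales
    show "op_bound A (real (dim_row A) * K * real (dim_col A))"
      by (rule op_bound_ex) (use K K0 in \<open>simp_all add: l_def\<close>)
  qed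
qed

text \<open>The representation on the zero space; it shows that the supremum over representations is
  not over the empty set.\<close>

lemma unitary_rep_trivial: "unitary_rep ({} :: 'i set) (\<lambda>g f. f)"
  by (simp add: unitary_rep_def unitary_op_def)

lemma cstar_least:
  fixes A :: "('g::group_add \<Rightarrow>\<^sub>0 complex) mat"
  assumes "\<And>(X :: 'i set) \<rho>. unitary_rep X \<rho> \<Longrightarrow> urep.op_bound X \<rho> A c" "0 \<le> c"
  shows "cstar_mat_norm TYPE('i) A \<le> c"
  unfolding cstar_mat_norm_def
proof (rule cSup_least)
  show "{rep_mat_norm X \<rho> A | (X :: 'i set) \<rho>. unitary_rep X \<rho>} \<noteq> {}"
    using unitary_rep_trivial by blast
  fix r assume "r \<in> {rep_mat_norm X \<rho> A | (X :: 'i set) \<rho>. unitary_rep X \<rho>}"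
  then obtain X :: "'i set" and \<rho> where r: "r = rep_mat_norm X \<rho> A" and u: "unitary_rep X \<rho>" by blast
  interpret urep X \<rho> using u by unfold_locales
  show "r \<le> c" unfolding r by (rule rep_mat_norm_le[OF assms(1)[OF u] assms(2)])
qed

lemma cstar_upper:
  fixes A :: "('g::group_add \<Rightarrow>\<^sub>0 complex) mat" and X :: "'i set"
  assumes u: "unitary_rep X \<rho>"
  shows "rep_mat_norm X \<rho> A \<le> cstar_mat_norm TYPE('i) A"
    and "urep.op_bound X \<rho> A (cstar_mat_norm TYPE('i) A)"
    and "0 \<le> cstar_mat_norm TYPE('i) A"
proof -
  obtain c where c: "0 \<le> c" "\<And>(X :: 'i set) \<rho>. unitary_rep X \<rho> \<Longrightarrow> urep.op_bound X \<rho> A c"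
    using op_bound_uniform[of A, where 'i = 'i] by blast
  interpret urep X \<rho> using u by unfold_locales
  show le: "rep_mat_norm X \<rho> A \<le> cstar_mat_norm TYPE('i) A"
    unfolding cstar_mat_norm_def
  proof (rule cSup_upper)
    show "rep_mat_norm X \<rho> A \<in> {rep_mat_norm X \<rho> A | (X :: 'i set) \<rho>. unitary_rep X \<rho>}"
      using u by (intro CollectI exI conjI) simp_all
    show "bdd_above {rep_mat_norm X \<rho> A | (X :: 'i set) \<rho>. unitary_rep X \<rho>}"
    proof (rule bdd_aboveI[of _ c])
      fix r assume "r \<in> {rep_mat_norm X \<rho> A | (X :: 'i set) \<rho>. unitary_rep X \<rho>}"
      then obtain X :: "'i set" and \<rho> where r: "r = rep_mat_norm X \<rho> A" and u: "unitary_rep X \<rho>" by blast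
      interpret u: urep X \<rho> using u by unfold_locales
      show "r \<le> c" unfolding r by (rule u.rep_mat_norm_le[OF c(2)[OF u] c(1)])
    qed
  qed
  show "op_bound A (cstar_mat_norm TYPE('i) A)"
    by (rule op_bound_mono[OF op_bound_rep_mat_norm[OF c(2)[OF u] c(1)] le])
  show "0 \<le> cstar_mat_norm TYPE('i) A"
    by (rule order_trans[OF rep_mat_norm_nonneg[OF c(2)[OF u] c(1)] le])
qed

lemmas cstar_nonneg = cstar_upper(3)[OF unitary_rep_trivial]

lemma cstar_sandwich:
  assumes "dim_col \<alpha> = dim_row A" "dim_row \<beta> = dim_col A"
  shows "cstar_mat_norm TYPE('i) (sandwich \<alpha> A \<beta>) \<le> opnorm \<alpha> * (cstar_mat_norm TYPE('i) A * opnorm \<beta>)"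
proof (rule cstar_least)
  fix X :: "'i set" and \<rho> :: "'a \<Rightarrow> ('i \<Rightarrow> complex) \<Rightarrow> 'i \<Rightarrow> complex" assume u: "unitary_rep X \<rho>"
  interpret urep X \<rho> using u by unfold_locales
  show "op_bound (sandwich \<alpha> A \<beta>) (opnorm \<alpha> * (cstar_mat_norm TYPE('i) A * opnorm \<beta>))"
    by (intro op_bound_sandwich cstar_upper(2) u cstar_nonneg assms)
qed (simp add: cstar_nonneg)

lemma cstar_add:
  assumes "A \<in> carrier_mat n k" "B \<in> carrier_mat n k"
  shows "cstar_mat_norm TYPE('i) (A + B) \<le> cstar_mat_norm TYPE('i) A + cstar_mat_norm TYPE('i) B"
proof (rule cstar_least)
  fix X :: "'i set" and \<rho> :: "'a \<Rightarrow> ('i \<Rightarrow> complex) \<Rightarrow> 'i \<Rightarrow> complex" assume u: "unitary_rep X \<rho>"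
  interpret urep X \<rho> using u by unfold_locales
  show "op_bound (A + B) (cstar_mat_norm TYPE('i) A + cstar_mat_norm TYPE('i) B)"
    by (intro op_bound_add cstar_upper(2) u) (use assms in auto)
qed (simp add: cstar_nonneg)

lemma cstar_scale_le: "cstar_mat_norm TYPE('i) (mat_scale c A) \<le> cmod c * cstar_mat_norm TYPE('i) A"
proof (rule cstar_least)
  fix X :: "'i set" and \<rho> :: "'a \<Rightarrow> ('i \<Rightarrow> complex) \<Rightarrow> 'i \<Rightarrow> complex" assume u: "unitary_rep X \<rho>"
  interpret urep X \<rho> using u by unfold_locales
  show "op_bound (mat_scale c A) (cmod c * cstar_mat_norm TYPE('i) A)"
    by (intro op_bound_scale cstar_upper(2) u)
qed (simp add: cstar_nonneg)

lemma cstar_scale: "cstar_mat_norm TYPE('i) (mat_scale c A) = cmod c * cstar_mat_norm TYPE('i) A"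
proof (cases "c = 0")
  case True
  then show ?thesis using cstar_scale_le[where 'i = 'i, of c A] cstar_nonneg[where 'i = 'i, of "mat_scale c A"] by simp
next
  case False
  then have "mat_scale (1 / c) (mat_scale c A) = A"
    by (intro eq_matI) (simp_all add: mat_scale_def)
  then have "cstar_mat_norm TYPE('i) A \<le> cmod (1 / c) * cstar_mat_norm TYPE('i) (mat_scale c A)"
    using cstar_scale_le[where 'i = 'i, of "1 / c" "mat_scale c A"] by simp
  then have "cmod c * cstar_mat_norm TYPE('i) A \<le> cstar_mat_norm TYPE('i) (mat_scale c A)"
    using False by (simp add: norm_divide field_simps)
  then show ?thesis using cstar_scale_le[where 'i = 'i, of c A] by simp
qed

lemma cstar_zero: "cstar_mat_norm TYPE('i) (0\<^sub>m n k :: ('g::group_add \<Rightarrow>\<^sub>0 complex) mat) = 0"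
proof (rule antisym)
  show "cstar_mat_norm TYPE('i) (0\<^sub>m n k :: ('g::group_add \<Rightarrow>\<^sub>0 complex) mat) \<le> 0"
    by (rule cstar_least) (simp_all add: urep.op_bound_zero urep.intro)
qed (rule cstar_nonneg)

lemma cstar_direct_sum:
  "cstar_mat_norm TYPE('i) (direct_sum_mat A B) =
    max (cstar_mat_norm TYPE('i) A) (cstar_mat_norm TYPE('i) B)" (is "?AB = max ?A ?B")
proof (rule antisym)
  show "?AB \<le> max ?A ?B"
  proof (rule cstar_least)
    fix X :: "'i set" and \<rho> :: "'a \<Rightarrow> ('i \<Rightarrow> complex) \<Rightarrow> 'i \<Rightarrow> complex" assume u: "unitary_rep X \<rho>"
    interpret urep X \<rho> using u by unfold_locales
    show "op_bound (direct_sum_mat A B) (max ?A ?B)"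
      by (intro op_bound_direct_sum cstar_upper(2) u cstar_nonneg)
  qed (simp add: cstar_nonneg le_max_iff_disj)
  have "?A \<le> ?AB"
  proof (rule cstar_least)
    fix X :: "'i set" and \<rho> :: "'a \<Rightarrow> ('i \<Rightarrow> complex) \<Rightarrow> 'i \<Rightarrow> complex" assume u: "unitary_rep X \<rho>"
    interpret urep X \<rho> using u by unfold_locales
    show "op_bound A ?AB" by (rule op_bound_direct_summand(1)[OF cstar_upper(2)[OF u]])
  qed (rule cstar_nonneg)
  moreover have "?B \<le> ?AB"
  proof (rule cstar_least)
    fix X :: "'i set" and \<rho> :: "'a \<Rightarrow> ('i \<Rightarrow> complex) \<Rightarrow> 'i \<Rightarrow> complex" assume u: "unitary_rep X \<rho>"
    interpret urep X \<rho> using u by unfold_locales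
    show "op_bound B ?AB" by (rule op_bound_direct_summand(2)[OF cstar_upper(2)[OF u]])
  qed (rule cstar_nonneg)
  ultimately show "max ?A ?B \<le> ?AB" by simp
qed

section \<open>The maximal structure on l1 and its quotient norm on S\<close>

lemma mats_iff: "A \<in> mats V n k \<longleftrightarrow> A \<in> carrier_mat n k \<and> (\<forall>i<n. \<forall>j<k. A $$ (i, j) \<in> V)"
  by (fastforce simp: mats_def elements_mat_def)

lemma matsI: "A \<in> carrier_mat n k \<Longrightarrow> (\<And>i j. i < n \<Longrightarrow> j < k \<Longrightarrow> A $$ (i, j) \<in> V) \<Longrightarrow> A \<in> mats V n k"
  and matsD: "A \<in> mats V n k \<Longrightarrow> i < n \<Longrightarrow> j < k \<Longrightarrow> A $$ (i, j) \<in> V"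
  and mats_dim: "A \<in> mats V n k \<Longrightarrow> dim_row A = n \<and> dim_col A = k"
  by (auto simp: mats_iff)

lemma sandwich_diag:
  assumes "i < dim_row \<alpha>" "j < dim_col \<beta>"
  shows "sandwich \<alpha> (diag_of r y) \<beta> $$ (i, j) = (\<Sum>p<r. pm_scale (\<alpha> $$ (i, p) * \<beta> $$ (p, j)) (y p))"
proof -
  have "(\<Sum>q<r. pm_scale (\<alpha> $$ (i, p) * \<beta> $$ (q, j)) (diag_of r y $$ (p, q))) =
      pm_scale (\<alpha> $$ (i, p) * \<beta> $$ (p, j)) (y p)" if "p < r" for p
  proof -
    have "(\<Sum>q<r. pm_scale (\<alpha> $$ (i, p) * \<beta> $$ (q, j)) (diag_of r y $$ (p, q))) =
      (\<Sum>q<r. if q = p then pm_scale (\<alpha> $$ (i, p) * \<beta> $$ (p, j)) (y p) else 0)"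
      using that by (intro sum.cong) (auto simp: diag_of_def)
    then show ?thesis using that by simp
  qed
  then show ?thesis using assms by (simp add: sandwich_def)
qed

lemma ell1_iff: "y \<in> ell1 d \<longleftrightarrow> (\<forall>t. t \<notin> {- int d..int d} \<longrightarrow> lk y t = 0)"
  unfolding ell1_def by (simp only: mem_Collect_eq subset_iff in_keys_iff) blast

lemma ell1_add: "y \<in> ell1 d \<Longrightarrow> z \<in> ell1 d \<Longrightarrow> y + z \<in> ell1 d"
  and ell1_diff: "y \<in> ell1 d \<Longrightarrow> z \<in> ell1 d \<Longrightarrow> y - z \<in> ell1 d"
  and ell1_scale: "y \<in> ell1 d \<Longrightarrow> pm_scale c y \<in> ell1 d"
  and ell1_0: "0 \<in> ell1 d"
  by (auto simp: ell1_iff lookup_add lookup_minus)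

lemma ell1_sum: "(\<And>i. i \<in> I \<Longrightarrow> f i \<in> ell1 d) \<Longrightarrow> (\<Sum>i\<in>I. f i) \<in> ell1 d"
  by (induction I rule: infinite_finite_induct) (auto intro: ell1_add ell1_0)

lemma ell1_norm_nonneg: "0 \<le> ell1_norm d y"
  by (simp add: ell1_norm_def sum_nonneg)

lemma ell1_norm_scale: "ell1_norm d (pm_scale c y) = cmod c * ell1_norm d y"
  by (simp add: ell1_norm_def norm_mult sum_distrib_left)

lemma ell1_norm_single: "t \<in> {- int d..int d} \<Longrightarrow> ell1_norm d (Poly_Mapping.single t 1) = 1"
proof -
  assume t: "t \<in> {- int d..int d}"
  have "ell1_norm d (Poly_Mapping.single t 1) = (\<Sum>u\<in>{- int d..int d}. if u = t then 1 else 0)"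
    unfolding ell1_norm_def by (rule sum.cong[OF HOL.refl]) (simp add: lookup_single when_def)
  then show ?thesis using t by simp
qed

lemma ell1_single: "t \<in> {- int d..int d} \<Longrightarrow> Poly_Mapping.single t c \<in> ell1 d"
  by (auto simp: ell1_iff lookup_single when_def)

definition max_factors :: "nat \<Rightarrow> (int \<Rightarrow>\<^sub>0 complex) mat \<Rightarrow> real set" where
  "max_factors d x = {opnorm \<alpha> * opnorm \<beta> | \<alpha> \<beta> r y.
     \<alpha> \<in> carrier_mat (dim_row x) r \<and> \<beta> \<in> carrier_mat r (dim_col x) \<and>
     (\<forall>l<r. y l \<in> ell1 d \<and> ell1_norm d (y l) \<le> 1) \<and>
     x = sandwich \<alpha> (diag_of r y) \<beta>}"

lemma max_norm_eq: "max_norm d x = Inf (max_factors d x)"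
  by (simp add: max_norm_def max_factors_def)

text \<open>The infimum of an empty set of reals would be meaningless; here the matrix is factored
  through a diagonal that lists its entries.\<close>

lemma max_factors_nonempty:
  assumes x: "x \<in> mats (ell1 d) n k"
  shows "max_factors d x \<noteq> {}"
proof -
  have dim: "dim_row x = n" "dim_col x = k" using x by (auto simp: mats_def)
  \<comment> \<open>A positive number above the l1 norms of all entries. The diagonal is divided by
    it and \<beta> multiplied by it.\<close>
  define c where "c = 1 + (\<Sum>i<n. \<Sum>j<k. ell1_norm d (x $$ (i, j)))"
  have "0 \<le> (\<Sum>i<n. \<Sum>j<k. ell1_norm d (x $$ (i, j)))"
    by (intro sum_nonneg ell1_norm_nonneg)
  then have c0: "0 < c" by (simp add: c_def)
  have c: "ell1_norm d (x $$ (i, j)) \<le> c" if "i < n" "j < k" for i j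
  proof -
    have "ell1_norm d (x $$ (i, j)) \<le> (\<Sum>j<k. ell1_norm d (x $$ (i, j)))"
      using that by (intro member_le_sum[of j "{..<k}" "\<lambda>j. ell1_norm d (x $$ (i, j))"] ell1_norm_nonneg) auto
    also have "\<dots> \<le> (\<Sum>i<n. \<Sum>j<k. ell1_norm d (x $$ (i, j)))"
      using that by (intro member_le_sum[of i "{..<n}" "\<lambda>i. \<Sum>j<k. ell1_norm d (x $$ (i, j))"]
          sum_nonneg ell1_norm_nonneg) auto
    finally show ?thesis by (simp add: c_def)
  qed
  \<comment> \<open>Position \<open>l\<close> of the diagonal stands for the matrix entry with row
    \<open>l div k\<close> and column \<open>l mod k\<close>.\<close>
  let ?y = "\<lambda>l. pm_scale (1 / of_real c) (x $$ (l div k, l mod k))"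
  let ?\<alpha> = "mat n (n * k) (\<lambda>(i, l). if l div k = i then 1 else 0) :: complex mat"
  let ?\<beta> = "mat (n * k) k (\<lambda>(l, j). if l mod k = j then of_real c else 0) :: complex mat"
  have lk: "l div k < n" "l mod k < k" if "l < n * k" for l
  proof -
    have "0 < k" using that by (cases k) auto
    then show "l div k < n" "l mod k < k" using that by (auto simp: less_mult_imp_div_less)
  qed
  have "opnorm ?\<alpha> * opnorm ?\<beta> \<in> max_factors d x"
    unfolding max_factors_def
  proof (intro CollectI exI conjI allI impI)
    show "?\<alpha> \<in> carrier_mat (dim_row x) (n * k)" "?\<beta> \<in> carrier_mat (n * k) (dim_col x)"
      by (simp_all add: dim)
    fix l assume l: "l < n * k"
    show "?y l \<in> ell1 d" using x lk[OF l] by (intro ell1_scale) (simp add: mats_iff)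
    show "ell1_norm d (?y l) \<le> 1"
      using c[OF lk[OF l]] c0 by (simp add: ell1_norm_scale norm_divide field_simps)
  next
    show "x = sandwich ?\<alpha> (diag_of (n * k) ?y) ?\<beta>"
    proof (rule eq_matI)
      fix i j assume "i < dim_row (sandwich ?\<alpha> (diag_of (n * k) ?y) ?\<beta>)"
        "j < dim_col (sandwich ?\<alpha> (diag_of (n * k) ?y) ?\<beta>)"
      then have ij: "i < n" "j < k" by (simp_all add: sandwich_def)
      have ijk: "i * k + j < n * k"
      proof -
        have "i * k + j < (i + 1) * k" using ij by simp
        also have "\<dots> \<le> n * k" using ij by (intro mult_right_mono) auto
        finally show ?thesis .
      qed
      have "sandwich ?\<alpha> (diag_of (n * k) ?y) ?\<beta> $$ (i, j) =
          (\<Sum>p<n * k. pm_scale (?\<alpha> $$ (i, p) * ?\<beta> $$ (p, j)) (?y p))"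
        using ij by (intro sandwich_diag) auto
      also have "\<dots> = (\<Sum>p<n * k. if p = i * k + j then x $$ (i, j) else 0)"
      proof (rule sum.cong[OF HOL.refl])
        fix p assume "p \<in> {..<n * k}"
        then have p: "p < n * k" by simp
        have "p = i * k + j \<longleftrightarrow> p div k = i \<and> p mod k = j"
        proof
          assume "p = i * k + j"
          then show "p div k = i \<and> p mod k = j" using ij by simp
        next
          assume "p div k = i \<and> p mod k = j"
          then show "p = i * k + j" using div_mult_mod_eq[of p k] by simp
        qed
        then show "pm_scale (?\<alpha> $$ (i, p) * ?\<beta> $$ (p, j)) (?y p) =
            (if p = i * k + j then x $$ (i, j) else 0)"
          using ij p c0 by auto
      qed
      also have "\<dots> = x $$ (i, j)" using ijk by simp
      finally show "x $$ (i, j) = sandwich ?\<alpha> (diag_of (n * k) ?y) ?\<beta> $$ (i, j)" by simp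
    qed (simp_all add: sandwich_def dim)
  qed (rule HOL.refl)
  then show ?thesis by auto
qed

lemma max_norm_nonneg: "x \<in> mats (ell1 d) n k \<Longrightarrow> 0 \<le> max_norm d x"
  unfolding max_norm_eq
  by (rule cInf_greatest[OF max_factors_nonempty]) (auto simp: max_factors_def)

lemma ell1_proj_superset:
  "ell1_proj a d y = (\<Sum>t\<in>{- int d..int d}. pm_scale (lk y t) (Poly_Mapping.single (signed_gen a t) 1))"
  unfolding ell1_proj_def
  by (rule sum.cong[OF HOL.refl], rule poly_mapping_eqI) (simp add: lookup_single when_def)

lemma ell1_proj_add: "ell1_proj a d (y + z) = ell1_proj a d y + ell1_proj a d z"
  by (simp add: ell1_proj_superset lookup_add pm.scale_left_distrib sum.distrib)

lemma ell1_proj_scale: "ell1_proj a d (pm_scale c y) = pm_scale c (ell1_proj a d y)"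
  by (simp add: ell1_proj_superset pm.scale_sum_right)

lemma ell1_proj_0: "ell1_proj a d 0 = 0"
  by (simp add: ell1_proj_superset)

lemma ell1_proj_diff: "ell1_proj a d (y - z) = ell1_proj a d y - ell1_proj a d z"
  using ell1_proj_add[of a d "y - z" z] by (simp add: algebra_simps)

lemma ell1_proj_sum: "ell1_proj a d (\<Sum>i\<in>I. f i) = (\<Sum>i\<in>I. ell1_proj a d (f i))"
  by (induction I rule: infinite_finite_induct) (simp_all add: ell1_proj_add ell1_proj_0)

lemma ell1_proj_single:
  assumes "t \<in> {- int d..int d}"
  shows "ell1_proj a d (Poly_Mapping.single t c) = pm_scale c (Poly_Mapping.single (signed_gen a t) 1)"
proof -
  have "ell1_proj a d (Poly_Mapping.single t c) =
      (\<Sum>u\<in>{- int d..int d}. if u = t then pm_scale c (Poly_Mapping.single (signed_gen a t) 1) else 0)"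
    unfolding ell1_proj_superset by (rule sum.cong[OF HOL.refl]) (simp add: lookup_single when_def)
  then show ?thesis using assms by simp
qed

lemma signed_gen_cases:
  assumes "t \<in> {- int d..int d}"
  shows "signed_gen a t = 0 \<or> (\<exists>i\<in>{1..d}. signed_gen a t = a i \<or> signed_gen a t = - a i)"
proof -
  have "nat t \<in> {1..d}" if "t > 0" using assms that by auto
  moreover have "nat (- t) \<in> {1..d}" if "t < 0" using assms that by auto
  ultimately show ?thesis unfolding signed_gen_def by (metis linorder_neqE_linordered_idom)
qed

lemma signed_gen_S:
  assumes "t \<in> {- int d..int d}" shows "Poly_Mapping.single (signed_gen a t) 1 \<in> gen_space a d"
  unfolding gen_space_def using signed_gen_cases[OF assms, of a]
  by (intro pm.span_base) auto

lemma ell1_proj_S: "ell1_proj a d y \<in> gen_space a d"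
  unfolding ell1_proj_superset using signed_gen_S[of _ d a]
  unfolding gen_space_def by (intro pm.span_sum pm.span_scale)

lemma ell1_proj_surj:
  assumes "s \<in> gen_space a d" shows "\<exists>y\<in>ell1 d. ell1_proj a d y = s"
  using assms unfolding gen_space_def
proof (induction rule: pm.span_induct_alt)
  case base
  show ?case by (rule bexI[of _ 0]) (simp_all add: ell1_proj_0 ell1_0)
next
  case (step c b s)
  then obtain y where y: "y \<in> ell1 d" "ell1_proj a d y = s" by blast
  have "\<exists>t\<in>{- int d..int d}. b = Poly_Mapping.single (signed_gen a t) 1"
  proof -
    consider "b = 1" | i where "i \<in> {1..d}" "b = Poly_Mapping.single (a i) 1"
      | i where "i \<in> {1..d}" "b = Poly_Mapping.single (- a i) 1"
      using step(1) by auto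
    then show ?thesis
    proof cases
      case 1 then show ?thesis by (intro bexI[of _ 0]) (simp_all add: signed_gen_def)
    next
      case (2 i) then show ?thesis by (intro bexI[of _ "int i"]) (simp_all add: signed_gen_def)
    next
      case (3 i) then show ?thesis by (intro bexI[of _ "- int i"]) (simp_all add: signed_gen_def)
    qed
  qed
  then obtain t where t: "t \<in> {- int d..int d}" "b = Poly_Mapping.single (signed_gen a t) 1" by blast
  show ?case
  proof (rule bexI[of _ "Poly_Mapping.single t c + y"])
    show "ell1_proj a d (Poly_Mapping.single t c + y) = pm_scale c b + s"
      by (simp only: ell1_proj_add ell1_proj_single[OF t(1)] t(2) y(2))
  qed (intro ell1_add ell1_single t(1) y(1))
qed

lemma lookup_ell1_proj: "lk (ell1_proj a d y) g =
    (\<Sum>t\<in>{- int d..int d}. if signed_gen a t = g then lk y t else 0)"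
  unfolding ell1_proj_def lookup_sum
  by (rule sum.cong[OF HOL.refl]) (simp add: lookup_single when_def)

text \<open>Different indices may name the same group element; their coefficients are then added,
  and the l1 norm can only drop.\<close>

lemma ell1_proj_norm:
  "Poly_Mapping.keys (ell1_proj a d y) \<subseteq> signed_gen a ` {- int d..int d} \<and>
    (\<Sum>g\<in>signed_gen a ` {- int d..int d}. cmod (lk (ell1_proj a d y) g)) \<le> ell1_norm d y"
proof
  let ?K = "signed_gen a ` {- int d..int d}"
  show "Poly_Mapping.keys (ell1_proj a d y) \<subseteq> ?K"
  proof
    fix g assume "g \<in> Poly_Mapping.keys (ell1_proj a d y)"
    then have "(\<Sum>t\<in>{- int d..int d}. if signed_gen a t = g then lk y t else 0) \<noteq> 0"
      by (simp add: in_keys_iff lookup_ell1_proj)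
    then obtain t where "t \<in> {- int d..int d}" "(if signed_gen a t = g then lk y t else 0) \<noteq> 0"
      by (rule sum.not_neutral_contains_not_neutral)
    then show "g \<in> ?K" by (auto split: if_splits)
  qed
  have "(\<Sum>g\<in>?K. cmod (lk (ell1_proj a d y) g)) \<le>
      (\<Sum>g\<in>?K. \<Sum>t\<in>{- int d..int d}. if signed_gen a t = g then cmod (lk y t) else 0)"
    unfolding lookup_ell1_proj
    by (intro sum_mono order_trans[OF norm_sum] sum_mono) (simp add: if_distrib)
  also have "\<dots> = (\<Sum>t\<in>{- int d..int d}. \<Sum>g\<in>?K. if signed_gen a t = g then cmod (lk y t) else 0)"
    by (rule sum.swap)
  also have "\<dots> = ell1_norm d y"
    unfolding ell1_norm_def by (rule sum.cong[OF HOL.refl]) simp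
  finally show "(\<Sum>g\<in>?K. cmod (lk (ell1_proj a d y) g)) \<le> ell1_norm d y" .
qed

lemma ell1_proj_sandwich:
  "map_mat (ell1_proj a d) (sandwich \<alpha> (diag_of r y) \<beta>) = sandwich \<alpha> (diag_of r (\<lambda>l. ell1_proj a d (y l))) \<beta>"
proof (rule eq_matI)
  fix i j assume "i < dim_row (sandwich \<alpha> (diag_of r (\<lambda>l. ell1_proj a d (y l))) \<beta>)"
    "j < dim_col (sandwich \<alpha> (diag_of r (\<lambda>l. ell1_proj a d (y l))) \<beta>)"
  then have ij: "i < dim_row \<alpha>" "j < dim_col \<beta>" by (simp_all add: sandwich_def)
  moreover have "dim_row (sandwich \<alpha> (diag_of r y) \<beta>) = dim_row \<alpha>" "dim_col (sandwich \<alpha> (diag_of r y) \<beta>) = dim_col \<beta>"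
    by (simp_all add: sandwich_def)
  ultimately show "map_mat (ell1_proj a d) (sandwich \<alpha> (diag_of r y) \<beta>) $$ (i, j) =
      sandwich \<alpha> (diag_of r (\<lambda>l. ell1_proj a d (y l))) \<beta> $$ (i, j)"
    by (simp add: sandwich_diag ell1_proj_sum ell1_proj_scale)
qed (simp_all add: sandwich_def)

definition reps :: "(nat \<Rightarrow> 'g::group_add) \<Rightarrow> nat \<Rightarrow> ('g \<Rightarrow>\<^sub>0 complex) mat \<Rightarrow> (int \<Rightarrow>\<^sub>0 complex) mat set" where
  "reps a d A = {x \<in> mats (ell1 d) (dim_row A) (dim_col A). map_mat (ell1_proj a d) x = A}"

lemma reps_nonempty:
  assumes "A \<in> mats (gen_space a d) n k" shows "reps a d A \<noteq> {}"
proof -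
  have A: "dim_row A = n" "dim_col A = k" "\<And>i j. i < n \<Longrightarrow> j < k \<Longrightarrow> A $$ (i, j) \<in> gen_space a d"
    using assms by (auto simp: mats_iff)
  define f where "f s = (SOME y. y \<in> ell1 d \<and> ell1_proj a d y = s)" for s
  have f: "f s \<in> ell1 d \<and> ell1_proj a d (f s) = s" if "s \<in> gen_space a d" for s
  proof -
    have "\<exists>y. y \<in> ell1 d \<and> ell1_proj a d y = s" using ell1_proj_surj[OF that] by blast
    then show ?thesis unfolding f_def by (rule someI_ex)
  qed
  have "map_mat f A \<in> reps a d A"
    unfolding reps_def
  proof (intro CollectI conjI)
    show "map_mat f A \<in> mats (ell1 d) (dim_row A) (dim_col A)"
      by (rule matsI) (rule carrier_matI, simp_all add: A f)
    show "map_mat (ell1_proj a d) (map_mat f A) = A"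
      by (rule eq_matI) (simp_all add: A f)
  qed
  then show ?thesis by blast
qed

text \<open>Adding the kernel to the chosen representative gives every representative of
  \<open>A\<close>, so the choice made in the definition does not matter.\<close>

lemma gen_space_norm_eq:
  assumes A: "A \<in> mats (gen_space a d) n k"
  shows "gen_space_norm a d A = Inf (max_norm d ` reps a d A)"
proof -
  have dA: "dim_row A = n" "dim_col A = k" using A by (auto simp: mats_def)
  define x0 where "x0 = (SOME x. x \<in> mats (ell1 d) (dim_row A) (dim_col A) \<and> map_mat (ell1_proj a d) x = A)"
  have "\<exists>x. x \<in> mats (ell1 d) (dim_row A) (dim_col A) \<and> map_mat (ell1_proj a d) x = A"
    using reps_nonempty[OF A] by (auto simp: reps_def)
  then have x0: "x0 \<in> mats (ell1 d) n k" "map_mat (ell1_proj a d) x0 = A"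
    using someI_ex[of "\<lambda>x. x \<in> mats (ell1 d) (dim_row A) (dim_col A) \<and> map_mat (ell1_proj a d) x = A"]
    unfolding x0_def[symmetric] by (simp_all add: dA)
  have d0: "dim_row x0 = n" "dim_col x0 = k" using x0(1) by (auto simp: mats_def)
  have "{max_norm d (x0 + y) | y. y \<in> mats (ell1_ker a d) (dim_row x0) (dim_col x0)} = max_norm d ` reps a d A"
  proof (intro equalityI subsetI)
    fix v assume "v \<in> {max_norm d (x0 + y) | y. y \<in> mats (ell1_ker a d) (dim_row x0) (dim_col x0)}"
    then obtain y where v: "v = max_norm d (x0 + y)" and y: "y \<in> mats (ell1_ker a d) n k" by (auto simp: d0)
    have "map_mat (ell1_proj a d) (x0 + y) = map_mat (ell1_proj a d) x0"
    proof (rule eq_matI)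
      fix i j assume "i < dim_row (map_mat (ell1_proj a d) x0)" "j < dim_col (map_mat (ell1_proj a d) x0)"
      then have ij: "i < n" "j < k" by (simp_all add: d0)
      show "map_mat (ell1_proj a d) (x0 + y) $$ (i, j) = map_mat (ell1_proj a d) x0 $$ (i, j)"
        using matsD[OF y ij] ij mats_dim[OF y] by (simp add: d0 ell1_proj_add ell1_ker_def)
    qed (use mats_dim[OF y] in \<open>simp_all add: d0\<close>)
    moreover have "x0 + y \<in> mats (ell1 d) n k"
    proof (rule matsI)
      fix i j assume ij: "i < n" "j < k"
      show "(x0 + y) $$ (i, j) \<in> ell1 d"
        using matsD[OF y ij] matsD[OF x0(1) ij] ij mats_dim[OF y] by (simp add: ell1_add ell1_ker_def)
    qed (use mats_dim[OF y] d0 in auto)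
    ultimately have "x0 + y \<in> reps a d A" using x0(2) by (simp add: reps_def dA)
    then show "v \<in> max_norm d ` reps a d A" unfolding v by (rule imageI)
  next
    fix v assume "v \<in> max_norm d ` reps a d A"
    then obtain x where v: "v = max_norm d x" and x: "x \<in> mats (ell1 d) n k" "map_mat (ell1_proj a d) x = A"
      by (auto simp: reps_def dA)
    have dx: "dim_row x = n" "dim_col x = k" using x(1) by (auto simp: mats_def)
    have eq: "ell1_proj a d (x $$ (i, j)) = ell1_proj a d (x0 $$ (i, j))" if "i < n" "j < k" for i j
    proof -
      have "ell1_proj a d (x $$ (i, j)) = map_mat (ell1_proj a d) x $$ (i, j)" using that dx by simp
      also have "\<dots> = map_mat (ell1_proj a d) x0 $$ (i, j)" by (simp only: x(2) x0(2))
      finally show ?thesis using that d0 by simp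
    qed
    have "x - x0 \<in> mats (ell1_ker a d) n k"
    proof (intro matsI)
      fix i j assume ij: "i < n" "j < k"
      show "(x - x0) $$ (i, j) \<in> ell1_ker a d"
        using matsD[OF x(1) ij] matsD[OF x0(1) ij] ij d0 eq[OF ij]
        by (simp add: ell1_diff ell1_ker_def ell1_proj_diff)
    qed (use dx d0 in auto)
    moreover have "x0 + (x - x0) = x" using dx d0 by (intro eq_matI) auto
    ultimately show "v \<in> {max_norm d (x0 + y) | y. y \<in> mats (ell1_ker a d) (dim_row x0) (dim_col x0)}"
      unfolding v d0 by (intro CollectI exI[of _ "x - x0"]) simp
  qed
  then show ?thesis by (simp only: gen_space_norm_def max_quot_norm_def x0_def[symmetric])
qed

text \<open>Together with \<open>gen_space_norm_ge\<close> this merges the two nested infima: the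
  quotient norm is the infimum over factorizations of A itself, with images under the projection of
  l1 unit vectors on the diagonal.\<close>

lemma gen_space_norm_le:
  assumes "\<alpha> \<in> carrier_mat n r" "\<beta> \<in> carrier_mat r k"
    and y: "\<And>l. l < r \<Longrightarrow> y l \<in> ell1 d \<and> ell1_norm d (y l) \<le> 1"
    and A: "A = sandwich \<alpha> (diag_of r (\<lambda>l. ell1_proj a d (y l))) \<beta>"
  shows "gen_space_norm a d A \<le> opnorm \<alpha> * opnorm \<beta>"
proof -
  let ?x = "sandwich \<alpha> (diag_of r y) \<beta>"
  have d: "dim_row ?x = n" "dim_col ?x = k" "dim_row A = n" "dim_col A = k"
    using assms(1,2) by (auto simp: A sandwich_def)
  have x: "?x \<in> mats (ell1 d) n k"
  proof (rule matsI)
    show "?x $$ (i, j) \<in> ell1 d" if "i < n" "j < k" for i j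
    proof -
      have "(\<Sum>p<r. pm_scale (\<alpha> $$ (i, p) * \<beta> $$ (p, j)) (y p)) \<in> ell1 d"
        by (intro ell1_sum ell1_scale) (use y in auto)
      then show ?thesis using that assms(1,2) by (simp add: sandwich_diag)
    qed
  qed (use d in auto)
  have Ax: "A = map_mat (ell1_proj a d) ?x" unfolding A by (rule ell1_proj_sandwich[symmetric])
  have xA: "?x \<in> reps a d A"
    unfolding reps_def d by (intro CollectI conjI x Ax[symmetric])
  have AS: "A \<in> mats (gen_space a d) n k"
  proof (rule matsI)
    show "A $$ (i, j) \<in> gen_space a d" if "i < n" "j < k" for i j
      unfolding Ax using that d by (simp add: ell1_proj_S)
  qed (use d in auto)
  have "gen_space_norm a d A \<le> max_norm d ?x"
    unfolding gen_space_norm_eq[OF AS]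
  proof (rule cInf_lower[OF imageI[OF xA]])
    show "bdd_below (max_norm d ` reps a d A)"
      by (rule bdd_belowI[of _ 0]) (auto simp: reps_def intro: max_norm_nonneg)
  qed
  also have "\<dots> \<le> opnorm \<alpha> * opnorm \<beta>"
    unfolding max_norm_eq
  proof (rule cInf_lower)
    show "opnorm \<alpha> * opnorm \<beta> \<in> max_factors d ?x"
      unfolding max_factors_def d
      by (intro CollectI exI[of _ \<alpha>] exI[of _ \<beta>] exI[of _ r] exI[of _ y] conjI allI impI y assms(1,2) HOL.refl)
    show "bdd_below (max_factors d ?x)"
      by (rule bdd_belowI[of _ 0]) (auto simp: max_factors_def)
  qed
  finally show ?thesis .
qed

lemma gen_space_norm_ge:
  assumes A: "A \<in> mats (gen_space a d) n k"
    and c: "\<And>\<alpha> \<beta> r y. \<alpha> \<in> carrier_mat n r \<Longrightarrow> \<beta> \<in> carrier_mat r k \<Longrightarrow>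
      (\<And>l. l < r \<Longrightarrow> y l \<in> ell1 d \<and> ell1_norm d (y l) \<le> 1) \<Longrightarrow>
      A = sandwich \<alpha> (diag_of r (\<lambda>l. ell1_proj a d (y l))) \<beta> \<Longrightarrow> c \<le> opnorm \<alpha> * opnorm \<beta>"
  shows "c \<le> gen_space_norm a d A"
  unfolding gen_space_norm_eq[OF A]
proof (rule cInf_greatest)
  show "max_norm d ` reps a d A \<noteq> {}" using reps_nonempty[OF A] by simp
  fix v assume "v \<in> max_norm d ` reps a d A"
  then obtain x where v: "v = max_norm d x" and x: "x \<in> mats (ell1 d) (dim_row A) (dim_col A)"
    and xA: "map_mat (ell1_proj a d) x = A" by (auto simp: reps_def)
  have dA: "dim_row A = n" "dim_col A = k" using A by (auto simp: mats_def)
  have dx: "dim_row x = n" "dim_col x = k" using x by (auto simp: mats_def dA)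
  show "c \<le> v"
    unfolding v max_norm_eq
  proof (rule cInf_greatest[OF max_factors_nonempty[OF x]])
    fix w assume "w \<in> max_factors d x"
    then obtain \<alpha> \<beta> r y where w: "w = opnorm \<alpha> * opnorm \<beta>" and "\<alpha> \<in> carrier_mat n r" "\<beta> \<in> carrier_mat r k"
      and y: "\<forall>l<r. y l \<in> ell1 d \<and> ell1_norm d (y l) \<le> 1" and xs: "x = sandwich \<alpha> (diag_of r y) \<beta>"
      unfolding max_factors_def dx by blast
    show "c \<le> w" unfolding w
    proof (rule c)
      show "A = sandwich \<alpha> (diag_of r (\<lambda>l. ell1_proj a d (y l))) \<beta>"
        unfolding ell1_proj_sandwich[symmetric] xs[symmetric] by (rule xA[symmetric])
    qed (use y in \<open>simp_all add: \<open>\<alpha> \<in> _\<close> \<open>\<beta> \<in> _\<close>\<close>)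
  qed
qed

text \<open>This and \<open>gen_space_norm_diag\<close> bound the two kinds of elementary factors
  from which factorizations will be assembled.\<close>

lemma gen_space_norm_scalar: "gen_space_norm a d (scalar_mat \<alpha>) \<le> opnorm \<alpha>"
proof -
  let ?k = "dim_col \<alpha>"
  have p: "ell1_proj a d 1 = 1"
    using ell1_proj_single[of 0 d a 1] by (simp add: signed_gen_def)
  have "gen_space_norm a d (scalar_mat \<alpha>) \<le> opnorm \<alpha> * opnorm (1\<^sub>m ?k)"
  proof (rule gen_space_norm_le[where y = "\<lambda>_. Poly_Mapping.single 0 1" and r = ?k])
    show "scalar_mat \<alpha> = sandwich \<alpha> (diag_of ?k (\<lambda>l. ell1_proj a d (Poly_Mapping.single 0 1))) (1\<^sub>m ?k)"
    proof (rule eq_matI)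
      fix i j assume "i < dim_row (sandwich \<alpha> (diag_of ?k (\<lambda>l. ell1_proj a d (Poly_Mapping.single 0 1))) (1\<^sub>m ?k))"
        "j < dim_col (sandwich \<alpha> (diag_of ?k (\<lambda>l. ell1_proj a d (Poly_Mapping.single 0 1))) (1\<^sub>m ?k))"
      then have ij: "i < dim_row \<alpha>" "j < ?k" by (simp_all add: sandwich_def)
      have "sandwich \<alpha> (diag_of ?k (\<lambda>l. ell1_proj a d (Poly_Mapping.single 0 1))) (1\<^sub>m ?k) $$ (i, j) =
          (\<Sum>q<?k. pm_scale (\<alpha> $$ (i, q) * 1\<^sub>m ?k $$ (q, j)) (Poly_Mapping.single 0 1))"
        using ij by (subst sandwich_diag) (auto simp: p)
      also have "\<dots> = (\<Sum>q<?k. if q = j then Poly_Mapping.single 0 (\<alpha> $$ (i, j)) else 0)"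
        using ij by (intro sum.cong HOL.refl poly_mapping_eqI) (auto simp: lookup_single lookup_one when_def)
      finally show "scalar_mat \<alpha> $$ (i, j) =
          sandwich \<alpha> (diag_of ?k (\<lambda>l. ell1_proj a d (Poly_Mapping.single 0 1))) (1\<^sub>m ?k) $$ (i, j)"
        using ij by simp
    qed (simp_all add: sandwich_def)
  qed (use ell1_single[of 0 d 1] ell1_norm_single[of 0 d] in auto)
  also have "\<dots> \<le> opnorm \<alpha> * 1" by (intro mult_left_mono opnorm_one_le) simp
  finally show ?thesis by simp
qed

lemma gen_space_norm_diag:
  assumes t: "\<And>i. i < n \<Longrightarrow> t i \<in> {- int d..int d}"
  shows "gen_space_norm a d (diag_of n (\<lambda>i. Poly_Mapping.single (signed_gen a (t i)) 1)) \<le> 1"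
proof -
  let ?D = "diag_of n (\<lambda>i. Poly_Mapping.single (signed_gen a (t i)) (1::complex))"
  have "gen_space_norm a d ?D \<le> opnorm (1\<^sub>m n) * opnorm (1\<^sub>m n)"
  proof (rule gen_space_norm_le[where y = "\<lambda>i. Poly_Mapping.single (t i) 1" and r = n])
    show "?D = sandwich (1\<^sub>m n) (diag_of n (\<lambda>i. ell1_proj a d (Poly_Mapping.single (t i) 1))) (1\<^sub>m n)"
    proof (rule eq_matI)
      fix i j assume "i < dim_row (sandwich (1\<^sub>m n) (diag_of n (\<lambda>i. ell1_proj a d (Poly_Mapping.single (t i) 1))) (1\<^sub>m n))"
        "j < dim_col (sandwich (1\<^sub>m n) (diag_of n (\<lambda>i. ell1_proj a d (Poly_Mapping.single (t i) 1))) (1\<^sub>m n))"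
      then have ij: "i < n" "j < n" by (simp_all add: sandwich_def)
      have "sandwich (1\<^sub>m n) (diag_of n (\<lambda>i. ell1_proj a d (Poly_Mapping.single (t i) 1))) (1\<^sub>m n) $$ (i, j) =
          (\<Sum>q<n. pm_scale (1\<^sub>m n $$ (i, q) * 1\<^sub>m n $$ (q, j)) (ell1_proj a d (Poly_Mapping.single (t q) 1)))"
        using ij by (subst sandwich_diag) auto
      also have "\<dots> = (\<Sum>q<n. if q = i then (if i = j then Poly_Mapping.single (signed_gen a (t i)) 1 else 0) else 0)"
        using ij t by (intro sum.cong) (auto simp: ell1_proj_single)
      finally show "?D $$ (i, j) =
          sandwich (1\<^sub>m n) (diag_of n (\<lambda>i. ell1_proj a d (Poly_Mapping.single (t i) 1))) (1\<^sub>m n) $$ (i, j)"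
        using ij by (simp add: diag_of_def)
    qed (simp_all add: sandwich_def)
  qed (use ell1_single[OF t] ell1_norm_single[OF t] in auto)
  also have "\<dots> \<le> 1 * 1" by (intro mult_mono opnorm_one_le) auto
  finally show ?thesis by simp
qed

text \<open>Complete contractivity on S: in a factorization of A through a diagonal, the scalar
  factors contribute their norms and the diagonal at most 1.\<close>

lemma (in urep) op_bound_gen_space_norm:
  assumes A: "A \<in> mats (gen_space a d) n k"
  shows "op_bound A (gen_space_norm a d A)" and "0 \<le> gen_space_norm a d A"
proof -
  obtain c where c: "0 \<le> c" "op_bound A c"
    using op_bound_uniform[of A, where 'i = 'i] unitary_rep by blast
  have le: "rep_mat_norm X \<rho> A \<le> gen_space_norm a d A"
  proof (rule gen_space_norm_ge[OF A])
    fix \<alpha> \<beta> r y assume ab: "\<alpha> \<in> carrier_mat n r" "\<beta> \<in> carrier_mat r k"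
      and y: "\<And>l. l < r \<Longrightarrow> y l \<in> ell1 d \<and> ell1_norm d (y l) \<le> 1"
      and s: "A = sandwich \<alpha> (diag_of r (\<lambda>l. ell1_proj a d (y l))) \<beta>"
    have "op_bound (diag_of r (\<lambda>l. ell1_proj a d (y l))) 1"
    proof (rule op_bound_diag)
      fix l assume l: "l < r"
      show "\<exists>K. finite K \<and> Poly_Mapping.keys (ell1_proj a d (y l)) \<subseteq> K \<and>
          (\<Sum>g\<in>K. cmod (lk (ell1_proj a d (y l)) g)) \<le> 1"
        using ell1_proj_norm[of a d "y l"] y[OF l]
        by (intro exI[of _ "signed_gen a ` {- int d..int d}"]) auto
    qed
    then have "op_bound A (opnorm \<alpha> * (1 * opnorm \<beta>))"
      unfolding s using ab by (intro op_bound_sandwich) auto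
    then show "rep_mat_norm X \<rho> A \<le> opnorm \<alpha> * opnorm \<beta>"
      by (intro rep_mat_norm_le) simp_all
  qed
  show "op_bound A (gen_space_norm a d A)"
    by (rule op_bound_mono[OF op_bound_rep_mat_norm[OF c(2,1)] le])
  show "0 \<le> gen_space_norm a d A"
    by (rule order_trans[OF rep_mat_norm_nonneg[OF c(2,1)] le])
qed

section \<open>Translations of row vectors and the GNS construction\<close>

definition act :: "'g::group_add \<Rightarrow> ('g \<times> nat \<Rightarrow>\<^sub>0 complex) \<Rightarrow> ('g \<times> nat \<Rightarrow>\<^sub>0 complex)" where
  "act g v = Poly_Mapping.map_key (\<lambda>(x, j). (- g + x, j)) v"

lemma lookup_act [simp]: "lk (act g v) (x, j) = lk v (- g + x, j)"
proof -
  have "inj (\<lambda>(x, j). (- g + x, j) :: 'a \<times> nat)" by (auto simp: inj_on_def)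
  then show ?thesis by (simp add: act_def map_key.rep_eq)
qed

lemma act_eqI: "(\<And>x j. lk u (x, j) = lk v (x, j)) \<Longrightarrow> u = v"
  for u v :: "'a \<times> nat \<Rightarrow>\<^sub>0 complex"
  by (rule poly_mapping_eqI) (metis surj_pair)

lemma act_zero_group [simp]: "act 0 v = v"
  by (rule act_eqI) simp

lemma act_act: "act g (act g' v) = act (g + g') v"
  by (rule act_eqI) (simp add: minus_add add.assoc del: add_uminus_conv_diff)

lemma act_add: "act g (u + v) = act g u + act g v"
  by (rule act_eqI) (simp add: lookup_add)

lemma act_scale: "act g (pm_scale c v) = pm_scale c (act g v)"
  by (rule act_eqI) simp

lemma act_0 [simp]: "act g 0 = 0"
  by (rule act_eqI) simp

lemma act_sum: "act g (\<Sum>i\<in>I. f i) = (\<Sum>i\<in>I. act g (f i))"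
  by (induction I rule: infinite_finite_induct) (simp_all add: act_add)

lemma act_single: "act g (Poly_Mapping.single (x, j) c) = Poly_Mapping.single (g + x, j) c"
proof (rule act_eqI)
  fix y l
  have "(x = - g + y) = (g + x = y)" by (metis add.assoc add_0 left_minus right_minus)
  then show "lk (act g (Poly_Mapping.single (x, j) c)) (y, l) = lk (Poly_Mapping.single (g + x, j) c) (y, l)"
    by (simp add: lookup_single when_def)
qed

definition row_space :: "nat \<Rightarrow> ('g \<times> nat \<Rightarrow>\<^sub>0 complex) set" where
  "row_space n = {v. Poly_Mapping.keys v \<subseteq> UNIV \<times> {..<n}}"

lemma row_space_iff: "v \<in> row_space n \<longleftrightarrow> (\<forall>x j. n \<le> j \<longrightarrow> lk v (x, j) = 0)"
  by (auto simp: row_space_def in_keys_iff not_le[symmetric])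

lemma subspace_rows: "pm.subspace (row_space n)"
  by (simp add: pm.subspace_def row_space_iff lookup_add)

lemma act_rows: "v \<in> row_space n \<Longrightarrow> act g v \<in> row_space n"
  by (simp add: row_space_iff)

definition row_vec :: "('g \<Rightarrow>\<^sub>0 complex) mat \<Rightarrow> nat \<Rightarrow> ('g \<times> nat \<Rightarrow>\<^sub>0 complex)" where
  "row_vec A i = (\<Sum>j<dim_col A. \<Sum>g\<in>Poly_Mapping.keys (A $$ (i, j)).
     Poly_Mapping.single (g, j) (lk (A $$ (i, j)) g))"

lemma lookup_row_vec: "lk (row_vec A i) (g, j) = (if j < dim_col A then lk (A $$ (i, j)) g else 0)"
proof -
  have "lk (\<Sum>x\<in>Poly_Mapping.keys (A $$ (i, l)). Poly_Mapping.single (x, l) (lk (A $$ (i, l)) x)) (g, j) =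
      (if l = j then lk (A $$ (i, j)) g else 0)" for l
  proof -
    have "lk (\<Sum>x\<in>Poly_Mapping.keys (A $$ (i, l)). Poly_Mapping.single (x, l) (lk (A $$ (i, l)) x)) (g, j) =
      (\<Sum>x\<in>Poly_Mapping.keys (A $$ (i, l)). if x = g then (if l = j then lk (A $$ (i, j)) g else 0) else 0)"
      unfolding lookup_sum by (rule sum.cong[OF HOL.refl]) (simp add: lookup_single when_def)
    then show ?thesis by (simp add: in_keys_iff)
  qed
  then show ?thesis unfolding row_vec_def lookup_sum[of _ "{..<dim_col A}"] by simp
qed

lemma row_vec_rows: "row_vec A i \<in> row_space (dim_col A)"
  by (simp add: row_space_iff lookup_row_vec)

text \<open>The Hilbert space is not built as a completion. An orthonormal family \<epsilon>,
  indexed by X and spanning the row space modulo null vectors, identifies it with the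
  square-summable functions on X. Expansions are finite, as Gram-Schmidt provides them.\<close>

locale gns = semi_inner pm_scale h
  for h :: "('g::group_add \<times> nat \<Rightarrow>\<^sub>0 complex) \<Rightarrow> ('g \<times> nat \<Rightarrow>\<^sub>0 complex) \<Rightarrow> complex" +
  fixes n :: nat and \<epsilon> :: "'i \<Rightarrow> ('g \<times> nat \<Rightarrow>\<^sub>0 complex)" and X :: "'i set"
  assumes invariant: "x \<in> row_space n \<Longrightarrow> y \<in> row_space n \<Longrightarrow> h (act g x) (act g y) = h x y"
    and eps_rows: "i \<in> X \<Longrightarrow> \<epsilon> i \<in> row_space n"
    and eps_orth: "i \<in> X \<Longrightarrow> k \<in> X \<Longrightarrow> h (\<epsilon> i) (\<epsilon> k) = (if i = k then 1 else 0)"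
    and eps_complete: "x \<in> row_space n \<Longrightarrow>
      \<exists>F. finite F \<and> F \<subseteq> X \<and> (\<forall>y. h y x = (\<Sum>i\<in>F. h y (\<epsilon> i) * h (\<epsilon> i) x))"
begin

definition supp :: "('g \<times> nat \<Rightarrow>\<^sub>0 complex) \<Rightarrow> 'i set" where
  "supp x = {i \<in> X. h x (\<epsilon> i) \<noteq> 0}"

lemma supp_iff: "i \<in> supp x \<longleftrightarrow> i \<in> X \<and> h x (\<epsilon> i) \<noteq> 0"
  by (simp add: supp_def)

lemma h_zero_iff: "h x y = 0 \<longleftrightarrow> h y x = 0"
  by (metis complex_cnj_zero h_sym)

lemma supp:
  assumes "x \<in> row_space n"
  shows finite_supp: "finite (supp x)"
    and parseval: "finite F \<Longrightarrow> supp x \<subseteq> F \<Longrightarrow> F \<subseteq> X \<Longrightarrow> h x y = (\<Sum>i\<in>F. h x (\<epsilon> i) * h (\<epsilon> i) y)"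
proof -
  obtain F0 where F0: "finite F0" "F0 \<subseteq> X" "\<And>y. h y x = (\<Sum>i\<in>F0. h y (\<epsilon> i) * h (\<epsilon> i) x)"
    using eps_complete[OF assms] by blast
  have s: "supp x \<subseteq> F0"
  proof
    fix k assume k: "k \<in> supp x"
    show "k \<in> F0"
    proof (rule ccontr)
      assume "k \<notin> F0"
      then have "h (\<epsilon> k) x = 0"
        using k F0(2) unfolding F0(3)[of "\<epsilon> k"] supp_iff
        by (intro sum.neutral) (auto simp: eps_orth)
      then show False using k h_zero_iff by (simp add: supp_iff)
    qed
  qed
  then show "finite (supp x)" using F0(1) by (rule finite_subset)
  show "h x y = (\<Sum>i\<in>F. h x (\<epsilon> i) * h (\<epsilon> i) y)" if F: "finite F" "supp x \<subseteq> F" "F \<subseteq> X"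
  proof -
    have "h x y = cnj (h y x)" by (rule h_sym)
    also have "\<dots> = (\<Sum>i\<in>F0. h x (\<epsilon> i) * h (\<epsilon> i) y)"
    proof -
      have "cnj (h y (\<epsilon> i) * h (\<epsilon> i) x) = h x (\<epsilon> i) * h (\<epsilon> i) y" for i
        by (simp only: complex_cnj_mult h_sym[of "\<epsilon> i" x] h_sym[of y "\<epsilon> i"] complex_cnj_cnj)
          (rule mult.commute)
      then show ?thesis by (simp only: F0(3)[of y] cnj_sum)
    qed
    also have "\<dots> = (\<Sum>i\<in>supp x. h x (\<epsilon> i) * h (\<epsilon> i) y)"
      using s F0 by (intro sum.mono_neutral_right) (auto simp: supp_iff)
    also have "\<dots> = (\<Sum>i\<in>F. h x (\<epsilon> i) * h (\<epsilon> i) y)"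
      using F by (intro sum.mono_neutral_left) (auto simp: supp_iff)
    finally show ?thesis .
  qed
qed

lemma eps_orthonormal: "orthonormal_or_zero \<epsilon> X"
  by (simp add: orthonormal_or_zero_def eps_orth)

definition pair :: "('g \<times> nat \<Rightarrow>\<^sub>0 complex) \<Rightarrow> ('i \<Rightarrow> complex) \<Rightarrow> complex" where
  "pair z f = (\<Sum>k\<in>supp z. h z (\<epsilon> k) * f k)"

lemma pair_eq:
  assumes "finite F" "supp z \<subseteq> F" "F \<subseteq> X"
  shows "pair z f = (\<Sum>k\<in>F. h z (\<epsilon> k) * f k)"
  unfolding pair_def using assms by (intro sum.mono_neutral_left) (auto simp: supp_iff)

lemma pair_sum:
  assumes "finite I" and z: "\<And>i. i \<in> I \<Longrightarrow> z i \<in> row_space n"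
  shows "pair (\<Sum>i\<in>I. pm_scale (c i) (z i)) f = (\<Sum>i\<in>I. cnj (c i) * pair (z i) f)"
proof -
  let ?z = "\<Sum>i\<in>I. pm_scale (c i) (z i)"
  have zr: "?z \<in> row_space n"
    by (intro pm.subspace_sum[OF subspace_rows] pm.subspace_scale[OF subspace_rows] z)
  define F where "F = supp ?z \<union> (\<Union>i\<in>I. supp (z i))"
  have F: "finite F" "F \<subseteq> X" "supp ?z \<subseteq> F" "\<And>i. i \<in> I \<Longrightarrow> supp (z i) \<subseteq> F"
    unfolding F_def using assms(1) finite_supp[OF zr] finite_supp[OF z] by (auto simp: supp_iff)
  have "pair ?z f = (\<Sum>k\<in>F. \<Sum>i\<in>I. cnj (c i) * (h (z i) (\<epsilon> k) * f k))"
    unfolding pair_eq[OF F(1,3,2)]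
    by (simp add: h_sum_left h_scale_left sum_distrib_right mult.assoc)
  also have "\<dots> = (\<Sum>i\<in>I. \<Sum>k\<in>F. cnj (c i) * (h (z i) (\<epsilon> k) * f k))" by (rule sum.swap)
  also have "\<dots> = (\<Sum>i\<in>I. cnj (c i) * pair (z i) f)"
    by (rule sum.cong[OF HOL.refl]) (simp add: pair_eq[OF F(1) F(4) F(2)] sum_distrib_left)
  finally show ?thesis .
qed

lemma pair_bound:
  assumes "z \<in> row_space n" "f \<in> ell2 X"
  shows "(cmod (pair z f))\<^sup>2 \<le> Re (h z z) * (ell2_norm X f)\<^sup>2"
proof -
  let ?S = "supp z"
  have S: "finite ?S" "?S \<subseteq> X" using finite_supp[OF assms(1)] by (auto simp: supp_iff)
  have "cmod (pair z f) \<le> (\<Sum>k\<in>?S. \<bar>cmod (h z (\<epsilon> k))\<bar> * \<bar>cmod (f k)\<bar>)"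
    unfolding pair_def by (rule order_trans[OF norm_sum]) (simp add: norm_mult)
  also have "\<dots> \<le> L2_set (\<lambda>k. cmod (h z (\<epsilon> k))) ?S * L2_set (\<lambda>k. cmod (f k)) ?S"
    by (rule L2_set_mult_ineq)
  finally have "(cmod (pair z f))\<^sup>2 \<le> (L2_set (\<lambda>k. cmod (h z (\<epsilon> k))) ?S * L2_set (\<lambda>k. cmod (f k)) ?S)\<^sup>2"
    by (rule power_mono) simp
  also have "\<dots> = (\<Sum>k\<in>?S. (cmod (h z (\<epsilon> k)))\<^sup>2) * (\<Sum>k\<in>?S. (cmod (f k))\<^sup>2)"
    by (simp only: power_mult_distrib L2_set_sq)
  also have "(\<Sum>k\<in>?S. (cmod (h z (\<epsilon> k)))\<^sup>2) = (\<Sum>k\<in>?S. (cmod (h (\<epsilon> k) z))\<^sup>2)"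
    by (rule sum.cong[OF HOL.refl]) (simp only: h_sym[of _ z] complex_mod_cnj)
  also have "(\<Sum>k\<in>?S. (cmod (h (\<epsilon> k) z))\<^sup>2) * (\<Sum>k\<in>?S. (cmod (f k))\<^sup>2) \<le> Re (h z z) * (ell2_norm X f)\<^sup>2"
    by (intro mult_mono bessel[OF eps_orthonormal] ell2_finite_le assms S h_nonneg sum_nonneg) simp
  finally show ?thesis .
qed

text \<open>The matrix of a group element in the family \<epsilon> has finitely supported rows,
  because translates of \<epsilon> stay in the row space. The operator is thus given by finite sums,
  and linearity and multiplicativity need no convergence argument.\<close>

definition rep :: "'g \<Rightarrow> ('i \<Rightarrow> complex) \<Rightarrow> ('i \<Rightarrow> complex)" where
  "rep g f = (\<lambda>i. if i \<in> X then pair (act (- g) (\<epsilon> i)) f else 0)"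

definition coords :: "('g \<times> nat \<Rightarrow>\<^sub>0 complex) \<Rightarrow> ('i \<Rightarrow> complex)" where
  "coords x = (\<lambda>i. if i \<in> X then h (\<epsilon> i) x else 0)"

lemma pair_vec: "z \<in> row_space n \<Longrightarrow> pair z (coords x) = h z x"
proof -
  assume z: "z \<in> row_space n"
  have "h z x = (\<Sum>i\<in>supp z. h z (\<epsilon> i) * h (\<epsilon> i) x)"
    by (rule parseval[OF z finite_supp[OF z]]) (auto simp: supp_iff)
  then show ?thesis unfolding pair_def coords_def by (auto simp: supp_iff intro!: sum.cong)
qed

lemma invariant_move:
  assumes "x \<in> row_space n" "y \<in> row_space n" shows "h (act (- g) x) y = h x (act g y)"
  using invariant[of "act (- g) x" y g] assms by (simp add: act_rows act_act)

lemma rep_vec: "x \<in> row_space n \<Longrightarrow> rep g (coords x) = coords (act g x)"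
  by (rule ext) (simp add: rep_def pair_vec act_rows eps_rows invariant_move, simp add: coords_def)

text \<open>The adjoint of a group element is its inverse; this gives multiplicativity of
  \<open>rep\<close>.\<close>

lemma pair_rep:
  assumes z: "z \<in> row_space n"
  shows "pair z (rep g f) = pair (act (- g) z) f"
proof -
  let ?a = "\<lambda>i. act (- g) (\<epsilon> i)"
  have S: "finite (supp z)" "supp z \<subseteq> X" using finite_supp[OF z] by (auto simp: supp_iff)
  have a: "?a i \<in> row_space n" if "i \<in> X" for i using that by (intro act_rows eps_rows)
  have az: "act (- g) z \<in> row_space n" by (rule act_rows[OF z])
  define F where "F = supp (act (- g) z) \<union> (\<Union>i\<in>supp z. supp (?a i))"
  have F: "finite F" "F \<subseteq> X" "supp (act (- g) z) \<subseteq> F" "\<And>i. i \<in> supp z \<Longrightarrow> supp (?a i) \<subseteq> F"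
    unfolding F_def using S finite_supp[OF az] finite_supp[OF a] by (auto simp: supp_iff)
  have "pair z (rep g f) = (\<Sum>i\<in>supp z. h z (\<epsilon> i) * (\<Sum>k\<in>F. h (?a i) (\<epsilon> k) * f k))"
    unfolding pair_def[of z]
    using S(2) by (intro sum.cong HOL.refl) (auto simp: rep_def pair_eq[OF F(1) F(4) F(2)])
  also have "\<dots> = (\<Sum>i\<in>supp z. \<Sum>k\<in>F. h z (\<epsilon> i) * h (?a i) (\<epsilon> k) * f k)"
    by (simp only: sum_distrib_left mult.assoc)
  also have "\<dots> = (\<Sum>k\<in>F. \<Sum>i\<in>supp z. h z (\<epsilon> i) * h (?a i) (\<epsilon> k) * f k)" by (rule sum.swap)
  also have "\<dots> = (\<Sum>k\<in>F. h (act (- g) z) (\<epsilon> k) * f k)"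
  proof (rule sum.cong[OF HOL.refl])
    fix k assume "k \<in> F"
    then have k: "\<epsilon> k \<in> row_space n" using F(2) eps_rows by blast
    have "h (act (- g) z) (\<epsilon> k) = h z (act g (\<epsilon> k))" by (rule invariant_move[OF z k])
    also have "\<dots> = (\<Sum>i\<in>supp z. h z (\<epsilon> i) * h (\<epsilon> i) (act g (\<epsilon> k)))"
      by (rule parseval[OF z S(1) subset_refl S(2)])
    also have "\<dots> = (\<Sum>i\<in>supp z. h z (\<epsilon> i) * h (?a i) (\<epsilon> k))"
      using S(2) by (intro sum.cong HOL.refl) (simp add: invariant_move eps_rows k subset_iff)
    finally show "(\<Sum>i\<in>supp z. h z (\<epsilon> i) * h (?a i) (\<epsilon> k) * f k) = h (act (- g) z) (\<epsilon> k) * f k"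
      by (simp add: sum_distrib_right)
  qed
  also have "\<dots> = pair (act (- g) z) f" by (rule pair_eq[OF F(1,3,2), symmetric])
  finally show ?thesis .
qed

lemma rep_plus: "rep (g + g') f = rep g (rep g' f)"
proof
  fix i
  show "rep (g + g') f i = rep g (rep g' f) i"
  proof (cases "i \<in> X")
    case True
    have "rep g (rep g' f) i = pair (act (- g') (act (- g) (\<epsilon> i))) f"
      using True by (subst rep_def) (simp add: pair_rep act_rows eps_rows)
    then show ?thesis using True by (simp add: rep_def act_act minus_add)
  qed (simp add: rep_def)
qed

lemma rep_zero: "f \<in> ell2 X \<Longrightarrow> rep 0 f = f"
proof
  fix i assume f: "f \<in> ell2 X"
  show "rep 0 f i = f i"
  proof (cases "i \<in> X")
    case True
    have "supp (\<epsilon> i) = {i}" using True by (auto simp: supp_iff eps_orth split: if_splits)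
    then show ?thesis using True by (simp add: rep_def pair_def eps_orth)
  qed (simp add: rep_def ell2_zero_outside[OF f])
qed

lemma rep_contraction:
  assumes f: "f \<in> ell2 X"
  shows "rep g f \<in> ell2 X" and "ell2_norm X (rep g f) \<le> ell2_norm X f"
proof -
  have "(\<Sum>i\<in>I. (cmod (rep g f i))\<^sup>2) \<le> (ell2_norm X f)\<^sup>2" if I: "finite I" "I \<subseteq> X" for I
  proof -
    let ?c = "rep g f"
    define S where "S = (\<Sum>i\<in>I. (cmod (rep g f i))\<^sup>2)"
    have er: "\<epsilon> i \<in> row_space n" if "i \<in> I" for i using that I(2) eps_rows by blast
    have ar: "act (- g) (\<epsilon> i) \<in> row_space n" if "i \<in> I" for i by (rule act_rows[OF er[OF that]])
    \<comment> \<open>The truncation of the image of \<open>f\<close> to I. Pairing its translate by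
      \<open>- g\<close> with \<open>f\<close> gives the partial sum S, which is also its square
      under \<open>h\<close>, so Cauchy-Schwarz says that S^2 is at most S times the square of
      \<open>f\<close>.\<close>
    define x where "x = (\<Sum>i\<in>I. pm_scale (?c i) (\<epsilon> i))"
    have x: "x \<in> row_space n"
      unfolding x_def by (intro pm.subspace_sum[OF subspace_rows] pm.subspace_scale[OF subspace_rows] er)
    have ax: "act (- g) x = (\<Sum>i\<in>I. pm_scale (?c i) (act (- g) (\<epsilon> i)))"
      by (simp add: x_def act_sum act_scale)
    have "pair (act (- g) x) f = (\<Sum>i\<in>I. cnj (?c i) * pair (act (- g) (\<epsilon> i)) f)"
      unfolding ax by (rule pair_sum[OF I(1) ar])
    also have "\<dots> = (\<Sum>i\<in>I. of_real ((cmod (?c i))\<^sup>2))"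
    proof (rule sum.cong[OF HOL.refl])
      fix i assume "i \<in> I"
      then have "pair (act (- g) (\<epsilon> i)) f = ?c i" using I(2) by (simp add: rep_def subset_iff)
      then show "cnj (?c i) * pair (act (- g) (\<epsilon> i)) f = of_real ((cmod (?c i))\<^sup>2)"
        by (simp only: complex_norm_square mult.commute)
    qed
    finally have p: "pair (act (- g) x) f = of_real S" by (simp only: S_def of_real_sum)
    have "h x x = (\<Sum>i\<in>I. of_real ((cmod (?c i))\<^sup>2) * h (\<epsilon> i) (\<epsilon> i))"
      unfolding x_def by (rule h_expand[OF eps_orthonormal I])
    also have "\<dots> = (\<Sum>i\<in>I. of_real ((cmod (?c i))\<^sup>2))"
      by (rule sum.cong[OF HOL.refl]) (use I(2) in \<open>simp add: eps_orth subset_iff\<close>)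
    finally have "h x x = of_real S" by (simp only: S_def of_real_sum)
    then have "Re (h x x) = S" by simp
    then have "Re (h (act (- g) x) (act (- g) x)) = S" using invariant[OF x x] by simp
    then have "S * S \<le> S * (ell2_norm X f)\<^sup>2"
      using pair_bound[OF act_rows[OF x, of "- g"] f] p by (simp add: power2_eq_square)
    moreover have "0 \<le> S" unfolding S_def by (rule sum_nonneg) simp
    ultimately have "S \<le> (ell2_norm X f)\<^sup>2" by (cases "S = 0") (auto simp: mult_le_cancel_left)
    then show ?thesis by (simp only: S_def)
  qed
  from ell2I[OF _ this] show "rep g f \<in> ell2 X" "ell2_norm X (rep g f) \<le> ell2_norm X f"
    by (simp_all add: rep_def)
qed

lemma unitary_rep_rep: "unitary_rep X rep"
  unfolding unitary_rep_def
proof (intro conjI allI ballI)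
  fix g
  show "unitary_op X (rep g)"
  proof (rule unitary_opI)
    have "f \<in> rep g ` ell2 X" if "f \<in> ell2 X" for f
    proof -
      have "f = rep (g + - g) f" using rep_zero[OF that] by simp
      then have "f = rep g (rep (- g) f)" by (simp only: rep_plus)
      then show ?thesis 
        by (rule image_eqI[where x = "rep (- g) f"]) (rule rep_contraction(1)[OF that])
    qed
    then show "rep g ` ell2 X = ell2 X"
      by (intro subset_antisym subsetI) (auto intro: rep_contraction(1))
    show "rep g (\<lambda>i. f i + f' i) = (\<lambda>i. rep g f i + rep g f' i)" for f f'
      by (rule ext) (simp add: rep_def pair_def distrib_left sum.distrib)
    show "rep g (\<lambda>i. c * f i) = (\<lambda>i. c * rep g f i)" for c f
      by (rule ext) (simp add: rep_def pair_def sum_distrib_left mult_ac)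
    show "ell2_norm X (rep g f) = ell2_norm X f" if f: "f \<in> ell2 X" for f
    proof (rule antisym)
      \<comment> \<open>Contractions whose inverses are contractions are isometries.\<close>
      have "ell2_norm X (rep (- g) (rep g f)) \<le> ell2_norm X (rep g f)"
        by (intro rep_contraction f)
      then show "ell2_norm X f \<le> ell2_norm X (rep g f)"
        using f by (simp add: rep_plus[symmetric] rep_zero)
    qed (rule rep_contraction(2)[OF f])
  qed
qed (simp_all add: rep_zero rep_plus)

lemma vec_ell2:
  assumes x: "x \<in> row_space n"
  shows "coords x \<in> ell2 X" and "(ell2_norm X (coords x))\<^sup>2 = Re (h x x)"
proof -
  have c: "cmod (coords x i) = cmod (h (\<epsilon> i) x)" if "i \<in> X" for i using that by (simp add: coords_def)
  have "(\<Sum>i\<in>F. (cmod (coords x i))\<^sup>2) \<le> (sqrt (Re (h x x)))\<^sup>2" if F: "finite F" "F \<subseteq> X" for F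
  proof -
    have "(\<Sum>i\<in>F. (cmod (coords x i))\<^sup>2) = (\<Sum>i\<in>F. (cmod (h (\<epsilon> i) x))\<^sup>2)"
      by (rule sum.cong[OF HOL.refl]) (use F c in auto)
    also have "\<dots> \<le> Re (h x x)" by (rule bessel[OF eps_orthonormal F])
    finally show ?thesis using h_nonneg by simp
  qed
  from ell2I[OF _ this] have v: "coords x \<in> ell2 X" and le: "ell2_norm X (coords x) \<le> sqrt (Re (h x x))"
    by (simp_all add: coords_def h_nonneg)
  show "coords x \<in> ell2 X" by (rule v)
  have "(ell2_norm X (coords x))\<^sup>2 \<le> (sqrt (Re (h x x)))\<^sup>2" by (rule power_mono[OF le]) simp
  moreover have "Re (h x x) \<le> (ell2_norm X (coords x))\<^sup>2"
  proof -
    have S: "finite (supp x)" "supp x \<subseteq> X" using finite_supp[OF x] by (auto simp: supp_iff)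
    have "h x x = (\<Sum>i\<in>supp x. h x (\<epsilon> i) * h (\<epsilon> i) x)"
      by (rule parseval[OF x S(1) subset_refl S(2)])
    also have "\<dots> = (\<Sum>i\<in>supp x. of_real ((cmod (coords x i))\<^sup>2))"
    proof (rule sum.cong[OF HOL.refl])
      fix i assume "i \<in> supp x"
      then have "cmod (coords x i) = cmod (h (\<epsilon> i) x)" using S c by blast
      then have "of_real ((cmod (coords x i))\<^sup>2) = h (\<epsilon> i) x * cnj (h (\<epsilon> i) x)"
        by (simp only: complex_norm_square)
      also have "cnj (h (\<epsilon> i) x) = h x (\<epsilon> i)" by (rule h_sym[symmetric])
      finally show "h x (\<epsilon> i) * h (\<epsilon> i) x = of_real ((cmod (coords x i))\<^sup>2)"
        by (simp only: mult.commute)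
    qed
    finally have "Re (h x x) = (\<Sum>i\<in>supp x. (cmod (coords x i))\<^sup>2)" by simp
    also have "\<dots> \<le> (ell2_norm X (coords x))\<^sup>2" by (rule ell2_finite_le[OF v S])
    finally show ?thesis .
  qed
  ultimately show "(ell2_norm X (coords x))\<^sup>2 = Re (h x x)" using h_nonneg[of x] by simp
qed

end

lemma lookup_pair_induct:
  assumes "v \<in> row_space n"
  shows "v = (\<Sum>p\<in>Poly_Mapping.keys v. pm_scale (lk v p) (Poly_Mapping.single p 1))"
proof (rule poly_mapping_eqI)
  fix q
  have "lk (\<Sum>p\<in>Poly_Mapping.keys v. pm_scale (lk v p) (Poly_Mapping.single p 1)) q =
      (\<Sum>p\<in>Poly_Mapping.keys v. if p = q then lk v q else 0)"
    unfolding lookup_sum by (rule sum.cong[OF HOL.refl]) (simp add: lookup_single when_def)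
  then show "lk v q = lk (\<Sum>p\<in>Poly_Mapping.keys v. pm_scale (lk v p) (Poly_Mapping.single p 1)) q"
    by (simp add: in_keys_iff)
qed

text \<open>The cyclic vectors \<xi> are the classes of the unit rows at the group identity.
  Applying A to them gives the classes of the rows of A, so norms in the representation are values
  of \<open>h\<close>. Countability makes the orthonormal family a sequence, which fits into any
  infinite index type.\<close>

theorem gns_representation:
  fixes h :: "('g::group_add \<times> nat \<Rightarrow>\<^sub>0 complex) \<Rightarrow> ('g \<times> nat \<Rightarrow>\<^sub>0 complex) \<Rightarrow> complex"
  assumes h: "semi_inner pm_scale h" and countable: "countable (UNIV :: 'g set)" and n: "0 < n"
    and inv: "\<And>g x y. x \<in> row_space n \<Longrightarrow> y \<in> row_space n \<Longrightarrow> h (act g x) (act g y) = h x y"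
  shows "\<exists>(X :: 'i::infinite set) \<rho> \<xi>. unitary_rep X \<rho> \<and> (\<forall>j<n. \<xi> j \<in> ell2 X) \<and>
    (urep.fam_norm X n \<xi>)\<^sup>2 = (\<Sum>j<n. Re (h (Poly_Mapping.single (0, j) 1) (Poly_Mapping.single (0, j) 1))) \<and>
    (\<forall>A. dim_col A = n \<longrightarrow> (urep.fam_norm X (dim_row A) (urep.mat_op \<rho> A \<xi>))\<^sup>2 =
      (\<Sum>i<dim_row A. Re (h (row_vec A i) (row_vec A i))))"
proof -
  interpret semi_inner pm_scale h by (rule h)
  let ?B = "UNIV \<times> {..<n} :: ('g \<times> nat) set"
  have cB: "countable ?B" using countable by (intro countable_SIGMA) auto
  have neB: "?B \<noteq> {}" using n by auto
  define b where "b k = Poly_Mapping.single (from_nat_into ?B k) (1::complex)" for k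
  obtain e where e: "orthonormal_or_zero e (UNIV :: nat set)"
    and sub: "\<And>V k. pm.subspace V \<Longrightarrow> range b \<subseteq> V \<Longrightarrow> e k \<in> V"
    and exp: "\<And>k N y. k \<le> N \<Longrightarrow> h y (b k) = (\<Sum>j\<le>N. h y (e j) * h (e j) (b k))"
    by (rule gram_schmidt[of b], rule that; assumption)
  have b_rows: "b k \<in> row_space n" for k
    using from_nat_into[OF neB, of k] by (auto simp: b_def row_space_def)
  have e_rows: "e k \<in> row_space n" for k by (rule sub[OF subspace_rows]) (use b_rows in auto)
  have e1: "e k = 0 \<or> h (e k) (e k) = 1" for k using e by (simp add: orthonormal_or_zero_def)
  obtain em :: "nat \<Rightarrow> 'i" where em: "inj em"
    using infinite_countable_subset[OF infinite_UNIV] by blast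
  \<comment> \<open>Only here are the zero vectors left over by Gram-Schmidt thrown out.\<close>
  define K where "K = {k. h (e k) (e k) = 1}"
  define X where "X = em ` K"
  define \<epsilon> where "\<epsilon> i = e (inv_into UNIV em i)" for i
  have \<epsilon>: "\<epsilon> (em k) = e k" for k using em by (simp add: \<epsilon>_def)
  have expand: "\<exists>N. \<forall>y. h y x = (\<Sum>j\<le>N. h y (e j) * h (e j) x)" if x: "x \<in> row_space n" for x
  proof -
    have "\<exists>k. from_nat_into ?B k = p" if "p \<in> Poly_Mapping.keys x" for p
    proof -
      have "p \<in> ?B" using that x by (auto simp: row_space_def)
      then show ?thesis by (rule from_nat_into_surj[OF cB])
    qed
    then obtain \<kappa> where \<kappa>: "\<And>p. p \<in> Poly_Mapping.keys x \<Longrightarrow> from_nat_into ?B (\<kappa> p) = p" by metis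
    \<comment> \<open>Any common bound of the positions \<kappa> p would do.\<close>
    define N where "N = (\<Sum>p\<in>Poly_Mapping.keys x. \<kappa> p)"
    have N: "\<kappa> p \<le> N" if "p \<in> Poly_Mapping.keys x" for p
      unfolding N_def using that by (intro member_le_sum) auto
    have hx: "h y x = (\<Sum>p\<in>Poly_Mapping.keys x. lk x p * h y (b (\<kappa> p)))" for y
    proof -
      have "h y x = h y (\<Sum>p\<in>Poly_Mapping.keys x. pm_scale (lk x p) (Poly_Mapping.single p 1))"
        using lookup_pair_induct[OF x] by (rule arg_cong)
      also have "\<dots> = (\<Sum>p\<in>Poly_Mapping.keys x. lk x p * h y (b (\<kappa> p)))"
        unfolding h_sum h_scale by (rule sum.cong[OF HOL.refl]) (simp add: b_def \<kappa>)
      finally show ?thesis .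
    qed
    have "h y x = (\<Sum>j\<le>N. h y (e j) * h (e j) x)" for y
    proof -
      have "h y x = (\<Sum>p\<in>Poly_Mapping.keys x. lk x p * (\<Sum>j\<le>N. h y (e j) * h (e j) (b (\<kappa> p))))"
        unfolding hx[of y] by (rule sum.cong[OF HOL.refl]) (simp add: exp[OF N, symmetric])
      also have "\<dots> = (\<Sum>p\<in>Poly_Mapping.keys x. \<Sum>j\<le>N. h y (e j) * (lk x p * h (e j) (b (\<kappa> p))))"
        by (simp only: sum_distrib_left mult.left_commute)
      also have "\<dots> = (\<Sum>j\<le>N. \<Sum>p\<in>Poly_Mapping.keys x. h y (e j) * (lk x p * h (e j) (b (\<kappa> p))))"
        by (rule sum.swap)
      also have "\<dots> = (\<Sum>j\<le>N. h y (e j) * h (e j) x)"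
        by (rule sum.cong[OF HOL.refl]) (simp only: hx[of "e _"] sum_distrib_left)
      finally show ?thesis .
    qed
    then show ?thesis by blast
  qed
  have gns: "gns h n \<epsilon> X"
  proof
    show "h (act g x) (act g y) = h x y" if "x \<in> row_space n" "y \<in> row_space n" for g x y
      using that by (rule inv)
    show "\<epsilon> i \<in> row_space n" if "i \<in> X" for i by (simp add: \<epsilon>_def e_rows)
    show "h (\<epsilon> i) (\<epsilon> k) = (if i = k then 1 else 0)" if ik: "i \<in> X" "k \<in> X" for i k
    proof -
      obtain p q where "i = em p" "k = em q" "p \<in> K" "q \<in> K" using ik by (auto simp: X_def)
      then show ?thesis using e em by (auto simp: \<epsilon> K_def orthonormal_or_zero_def inj_eq)
    qed
    fix x :: "'g \<times> nat \<Rightarrow>\<^sub>0 complex" assume "x \<in> row_space n"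
    then obtain N where N: "\<And>y. h y x = (\<Sum>j\<le>N. h y (e j) * h (e j) x)" using expand by blast
    have hF: "h y x = (\<Sum>i\<in>em ` (K \<inter> {..N}). h y (\<epsilon> i) * h (\<epsilon> i) x)" for y
    proof -
      have z: "e j = 0" if "j \<notin> K" for j using that e1[of j] by (simp add: K_def)
      have "h y x = (\<Sum>j\<in>K \<inter> {..N}. h y (e j) * h (e j) x)"
        unfolding N[of y]
      proof (rule sum.mono_neutral_right)
        show "\<forall>j\<in>{..N} - K \<inter> {..N}. h y (e j) * h (e j) x = 0"
        proof
          fix j assume "j \<in> {..N} - K \<inter> {..N}"
          then have "e j = 0" by (intro z) auto
          then show "h y (e j) * h (e j) x = 0" by simp
        qed
      qed auto
      also have "\<dots> = (\<Sum>i\<in>em ` (K \<inter> {..N}). h y (\<epsilon> i) * h (\<epsilon> i) x)"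
        using inj_on_subset[OF em subset_UNIV, of "K \<inter> {..N}"] by (simp add: sum.reindex \<epsilon>)
      finally show ?thesis .
    qed
    show "\<exists>F. finite F \<and> F \<subseteq> X \<and> (\<forall>y. h y x = (\<Sum>i\<in>F. h y (\<epsilon> i) * h (\<epsilon> i) x))"
    proof (rule exI, intro conjI allI)
      show "h y x = (\<Sum>i\<in>em ` (K \<inter> {..N}). h y (\<epsilon> i) * h (\<epsilon> i) x)" for y by (rule hF)
    qed (auto simp: X_def)
  qed
  interpret gns h n \<epsilon> X by (rule gns)
  interpret u: urep X rep by unfold_locales (rule unitary_rep_rep)
  define E :: "nat \<Rightarrow> ('g \<times> nat \<Rightarrow>\<^sub>0 complex)" where "E j = Poly_Mapping.single (0, j) 1" for j
  have E: "E j \<in> row_space n" if "j < n" for j using that by (auto simp: E_def row_space_def)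
  have vec_lin: "coords (\<Sum>i\<in>I. pm_scale (c i) (x i)) = (\<lambda>t. \<Sum>i\<in>I. c i * coords (x i) t)"
    for I :: "'x set" and c x
    by (rule ext) (simp add: coords_def h_sum h_scale)
  \<comment> \<open>The translate by g of the unit row at (0, j) is the unit row at (g, j), and A
    prescribes the coefficients.\<close>
  have op: "u.mat_op A (\<lambda>j. coords (E j)) i = coords (row_vec A i)" if A: "dim_col A = n" for A i
  proof
    fix t
    have ext: "rep_ext rep (A $$ (i, j)) (coords (E j)) t =
        coords (\<Sum>g\<in>Poly_Mapping.keys (A $$ (i, j)). Poly_Mapping.single (g, j) (lk (A $$ (i, j)) g)) t"
      if "j < n" for j
    proof -
      have "Poly_Mapping.single (g, j) c = pm_scale c (act g (E j))" for g c
        by (rule poly_mapping_eqI) (simp add: E_def act_single lookup_single when_def)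
      then show ?thesis using that by (simp add: rep_ext_def vec_lin rep_vec E)
    qed
    have "u.mat_op A (\<lambda>j. coords (E j)) i t = (\<Sum>j<n. 1 *
        coords (\<Sum>g\<in>Poly_Mapping.keys (A $$ (i, j)). Poly_Mapping.single (g, j) (lk (A $$ (i, j)) g)) t)"
      unfolding u.mat_op_def A by (rule sum.cong[OF HOL.refl]) (simp add: ext)
    also have "\<dots> = coords (row_vec A i) t"
      using vec_lin[of "\<lambda>_. 1" "\<lambda>j. \<Sum>g\<in>Poly_Mapping.keys (A $$ (i, j)). Poly_Mapping.single (g, j) (lk (A $$ (i, j)) g)" "{..<n}"]
      by (simp add: row_vec_def A)
    finally show "u.mat_op A (\<lambda>j. coords (E j)) i t = coords (row_vec A i) t" .
  qed
  show ?thesis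
  proof (intro exI conjI allI impI)
    show "unitary_rep X rep" by (rule unitary_rep_rep)
    show "coords (E j) \<in> ell2 X" if "j < n" for j by (rule vec_ell2(1)[OF E[OF that]])
    show "(u.fam_norm n (\<lambda>j. coords (E j)))\<^sup>2 =
        (\<Sum>j<n. Re (h (Poly_Mapping.single (0, j) 1) (Poly_Mapping.single (0, j) 1)))"
      unfolding u.fam_norm_sq by (rule sum.cong[OF HOL.refl]) (simp add: vec_ell2(2) E, simp add: E_def)
    fix A :: "('g \<Rightarrow>\<^sub>0 complex) mat" assume A: "dim_col A = n"
    have "row_vec A i \<in> row_space n" for i using row_vec_rows[of A i] A by simp
    then show "(u.fam_norm (dim_row A) (u.mat_op A (\<lambda>j. coords (E j))))\<^sup>2 =
      (\<Sum>i<dim_row A. Re (h (row_vec A i) (row_vec A i)))"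
      unfolding u.fam_norm_sq op[OF A] by (simp add: vec_ell2(2))
  qed
qed

section \<open>The free algebra, its evaluation and the congruence of F_m(S)\<close>

lemma pm_scale_mult_left: "pm_scale c x * y = pm_scale c (x * y)"
  for x y :: "'g::monoid_add \<Rightarrow>\<^sub>0 complex"
  by (simp only: pm_scale_eq_mult mult.assoc)

lemma pm_scale_mult_right: "x * pm_scale c y = pm_scale c (x * y)"
  for x y :: "'g::monoid_add \<Rightarrow>\<^sub>0 complex"
  by (simp only: pm_scale_eq_mult mult.assoc[symmetric] mult_single_zero_commute[of x])

lemma pm_scale_single [simp]: "pm_scale c (Poly_Mapping.single g d) = Poly_Mapping.single g (c * d)"
  by (rule poly_mapping_eqI) (simp add: lookup_single when_def)

lemma free_alg_add: "x \<in> free_alg V \<Longrightarrow> y \<in> free_alg V \<Longrightarrow> x + y \<in> free_alg V"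
  using keys_add[of x y] by (auto simp: free_alg_def)

lemma free_alg_scale: "x \<in> free_alg V \<Longrightarrow> pm_scale c x \<in> free_alg V"
  by (auto simp: free_alg_def in_keys_iff)

lemma free_alg_uminus: "x \<in> free_alg V \<Longrightarrow> - x \<in> free_alg V"
  by (auto simp: free_alg_def in_keys_iff)

lemma free_alg_0 [simp]: "0 \<in> free_alg V"
  by (simp add: free_alg_def)

lemma free_alg_1 [simp]: "1 \<in> free_alg V"
  by (auto simp: free_alg_def in_keys_iff lookup_one when_def zero_fword_def split: if_splits)

lemma free_alg_letter: "s \<in> V \<Longrightarrow> letter s \<in> free_alg V"
  by (simp add: free_alg_def letter_def)

lemma free_alg_mult: "x \<in> free_alg V \<Longrightarrow> y \<in> free_alg V \<Longrightarrow> x * y \<in> free_alg V"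
  using keys_mult[of x y] by (fastforce simp: free_alg_def plus_fword_def)

lemma free_alg_sum: "(\<And>i. i \<in> I \<Longrightarrow> f i \<in> free_alg V) \<Longrightarrow> (\<Sum>i\<in>I. f i) \<in> free_alg V"
  by (induction I rule: infinite_finite_induct) (auto intro: free_alg_add)

definition eval_word :: "('g::monoid_add \<Rightarrow>\<^sub>0 complex) fword \<Rightarrow> ('g \<Rightarrow>\<^sub>0 complex)" where
  "eval_word w = prod_list (letters w)"

text \<open>The algebra homomorphism to the group algebra that sends each letter to the vector it
  stands for.\<close>

definition eval_free ::
    "(('g::monoid_add \<Rightarrow>\<^sub>0 complex) fword \<Rightarrow>\<^sub>0 complex) \<Rightarrow> ('g \<Rightarrow>\<^sub>0 complex)" where
  "eval_free x = (\<Sum>w\<in>Poly_Mapping.keys x. pm_scale (lk x w) (eval_word w))"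

lemma eval_free_superset:
  assumes "finite K" "Poly_Mapping.keys x \<subseteq> K"
  shows "eval_free x = (\<Sum>w\<in>K. pm_scale (lk x w) (eval_word w))"
  unfolding eval_free_def using assms by (intro sum.mono_neutral_left) (auto simp: in_keys_iff)

lemma eval_free_add: "eval_free (x + y) = eval_free x + eval_free y"
proof -
  let ?K = "Poly_Mapping.keys x \<union> Poly_Mapping.keys y"
  have "Poly_Mapping.keys (x + y) \<subseteq> ?K" by (rule keys_add)
  then show ?thesis
    by (simp add: eval_free_superset[of ?K] lookup_add pm.scale_left_distrib sum.distrib)
qed

lemma eval_free_scale: "eval_free (pm_scale c x) = pm_scale c (eval_free x)"
proof -
  have "Poly_Mapping.keys (pm_scale c x) \<subseteq> Poly_Mapping.keys x" by (auto simp: in_keys_iff)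
  then show ?thesis
    by (simp add: eval_free_superset[of "Poly_Mapping.keys x"] pm.scale_sum_right)
qed

lemma eval_free_0 [simp]: "eval_free 0 = 0"
  by (simp add: eval_free_def)

lemma eval_free_diff: "eval_free (x - y) = eval_free x - eval_free y"
  using eval_free_add[of "x - y" y] by (simp add: algebra_simps)

lemma eval_free_single: "eval_free (Poly_Mapping.single w c) = pm_scale c (eval_word w)"
  by (subst eval_free_superset[of "{w}"]) auto

lemma eval_free_letter [simp]: "eval_free (letter s) = s"
  by (simp add: letter_def eval_free_single eval_word_def)

lemma single_FWord_Nil: "Poly_Mapping.single (FWord []) 1 = 1"
  by (simp only: zero_fword_def[symmetric] single_one)

lemma eval_free_1 [simp]: "eval_free 1 = 1"
  by (simp add: single_FWord_Nil[symmetric] eval_free_single eval_word_def)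

lemma eval_free_mult: "eval_free (x * y) = eval_free x * eval_free y"
proof (induction x rule: poly_mapping_single_induct)
  case (add w c x)
  have "eval_free (Poly_Mapping.single w c * y) = eval_free (Poly_Mapping.single w c) * eval_free y"
  proof (induction y rule: poly_mapping_single_induct)
    case (add v e y)
    have "eval_word (w + v) = eval_word w * eval_word v"
      by (simp add: eval_word_def plus_fword_def)
    then show ?case
      using add by (simp add: distrib_left eval_free_add mult_single eval_free_single
          pm_scale_mult_left pm_scale_mult_right)
  qed simp
  then show ?case using add by (simp add: distrib_right eval_free_add)
qed simp

lemma eval_free_sum: "eval_free (\<Sum>i\<in>I. f i) = (\<Sum>i\<in>I. eval_free (f i))"
  by (induction I rule: infinite_finite_induct) (simp_all add: eval_free_add)

context
  fixes V :: "'v set" and B :: "('v fword \<Rightarrow>\<^sub>0 complex) set"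
begin

lemma ideal_mult_left: "x \<in> gen_ideal (free_alg V) B \<Longrightarrow> u \<in> free_alg V \<Longrightarrow> u * x \<in> gen_ideal (free_alg V) B"
proof (induction rule: gen_ideal.induct)
  case (gen b u' v)
  then have "(u * u') * b * v \<in> gen_ideal (free_alg V) B"
    by (intro gen_ideal.gen free_alg_mult)
  then show ?case by (simp add: mult.assoc)
qed (auto simp: distrib_left intro: gen_ideal.zero gen_ideal.add)

lemma ideal_mult_right: "x \<in> gen_ideal (free_alg V) B \<Longrightarrow> u \<in> free_alg V \<Longrightarrow> x * u \<in> gen_ideal (free_alg V) B"
proof (induction rule: gen_ideal.induct)
  case (gen b u' v)
  then have "u' * b * (v * u) \<in> gen_ideal (free_alg V) B"
    by (intro gen_ideal.gen free_alg_mult)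
  then show ?case by (simp add: mult.assoc)
qed (auto simp: distrib_right intro: gen_ideal.zero gen_ideal.add)

lemma ideal_gen: "b \<in> B \<Longrightarrow> b \<in> gen_ideal (free_alg V) B"
  using gen_ideal.gen[of b B 1 "free_alg V" 1] by simp

end

locale partial_mult =
  fixes S :: "('g::group_add \<Rightarrow>\<^sub>0 complex) set"
    and D :: "(('g \<Rightarrow>\<^sub>0 complex) \<times> ('g \<Rightarrow>\<^sub>0 complex)) set"
    and m :: "('g \<Rightarrow>\<^sub>0 complex) \<times> ('g \<Rightarrow>\<^sub>0 complex) \<Rightarrow> ('g \<Rightarrow>\<^sub>0 complex)"
  assumes m: "(s, t) \<in> D \<Longrightarrow> m (s, t) = s * t"
begin

abbreviation equiv_Fm (infix "\<simeq>" 50) where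
  "x \<simeq> y \<equiv> Fm_eq S D m 1 x y"

lemma Fm_refl: "x \<simeq> x"
  by (simp add: Fm_eq_def gen_ideal.zero)

lemma Fm_sym: "x \<simeq> y \<Longrightarrow> y \<simeq> x"
  using ideal_mult_left[of "x - y" S _ "- 1"] free_alg_uminus[OF free_alg_1]
  by (auto simp: Fm_eq_def)

lemma Fm_trans [trans]: "x \<simeq> y \<Longrightarrow> y \<simeq> z \<Longrightarrow> x \<simeq> z"
  using gen_ideal.add[of "x - y" _ _ "y - z"] by (auto simp: Fm_eq_def)

lemma Fm_add: "x \<simeq> y \<Longrightarrow> x' \<simeq> y' \<Longrightarrow> x + x' \<simeq> y + y'"
  using gen_ideal.add[of "x - y" _ _ "x' - y'"] by (simp add: Fm_eq_def algebra_simps)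

text \<open>The membership conditions are there because the ideal absorbs only multipliers from
  \<open>free_alg S\<close>.\<close>

lemma Fm_mult: "x \<simeq> y \<Longrightarrow> x' \<simeq> y' \<Longrightarrow> y \<in> free_alg S \<Longrightarrow> x' \<in> free_alg S \<Longrightarrow> x * x' \<simeq> y * y'"
proof -
  assume a: "x \<simeq> y" "x' \<simeq> y'" "y \<in> free_alg S" "x' \<in> free_alg S"
  have "(x - y) * x' + y * (x' - y') \<in> gen_ideal (free_alg S) (Fm_rels S D m 1)"
    using a unfolding Fm_eq_def by (intro gen_ideal.add ideal_mult_left ideal_mult_right)
  then show ?thesis by (simp add: Fm_eq_def algebra_simps)
qed

lemma Fm_scale: "x \<simeq> y \<Longrightarrow> pm_scale c x \<simeq> pm_scale c y"
proof -
  assume "x \<simeq> y"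
  then have "pm_scale c 1 * (x - y) \<in> gen_ideal (free_alg S) (Fm_rels S D m 1)"
    unfolding Fm_eq_def by (intro ideal_mult_left free_alg_scale free_alg_1)
  then show ?thesis
    by (simp add: Fm_eq_def pm_scale_mult_left pm.scale_right_diff_distrib)
qed

lemma Fm_sum: "(\<And>i. i \<in> I \<Longrightarrow> f i \<simeq> g i) \<Longrightarrow> (\<Sum>i\<in>I. f i) \<simeq> (\<Sum>i\<in>I. g i)"
  by (induction I rule: infinite_finite_induct) (auto intro: Fm_refl Fm_add)

lemma Fm_letter_add: "s \<in> S \<Longrightarrow> t \<in> S \<Longrightarrow> letter (s + t) \<simeq> letter s + letter t"
proof -
  assume "s \<in> S" "t \<in> S"
  then have "letter (s + t) - letter s - letter t \<in> Fm_rels S D m 1"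
    by (auto simp: Fm_rels_def tensor_rels_def)
  then show ?thesis unfolding Fm_eq_def by (subst diff_diff_eq[symmetric]) (rule ideal_gen)
qed

lemma Fm_letter_scale: "s \<in> S \<Longrightarrow> letter (pm_scale c s) \<simeq> pm_scale c (letter s)"
  unfolding Fm_eq_def by (rule ideal_gen) (auto simp: Fm_rels_def tensor_rels_def)

lemma Fm_letter_mult: "(s, t) \<in> D \<Longrightarrow> letter s * letter t \<simeq> letter (s * t)"
  unfolding Fm_eq_def by (rule ideal_gen) (auto simp: Fm_rels_def m[symmetric])

lemma Fm_letter_1: "letter 1 \<simeq> 1"
  unfolding Fm_eq_def by (rule ideal_gen) (auto simp: Fm_rels_def)

lemma Fm_eval: "x \<simeq> y \<Longrightarrow> eval_free x = eval_free y"
proof -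
  have "eval_free z = 0" if "z \<in> gen_ideal (free_alg S) (Fm_rels S D m 1)" for z
    using that
  proof (induction rule: gen_ideal.induct)
    case (gen b u v)
    have "eval_free b = 0"
      using gen(1) unfolding Fm_rels_def tensor_rels_def
      by (auto simp: eval_free_diff eval_free_scale eval_free_mult m)
    then show ?case by (simp add: eval_free_mult)
  qed (simp_all add: eval_free_add)
  moreover assume "x \<simeq> y"
  ultimately have "eval_free (x - y) = 0" by (simp add: Fm_eq_def)
  then show ?thesis by (simp add: eval_free_diff)
qed

end

section \<open>For the presented group, F_m(S) is the group algebra\<close>

lemma pm_sum_singles: "x = (\<Sum>p\<in>Poly_Mapping.keys x. pm_scale (lk x p) (Poly_Mapping.single p 1))"
proof (rule poly_mapping_eqI)
  fix q
  have "lk (\<Sum>p\<in>Poly_Mapping.keys x. pm_scale (lk x p) (Poly_Mapping.single p 1)) q =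
      (\<Sum>p\<in>Poly_Mapping.keys x. if p = q then lk x q else 0)"
    unfolding lookup_sum by (rule sum.cong[OF HOL.refl]) (simp add: lookup_single when_def)
  then show "lk x q = lk (\<Sum>p\<in>Poly_Mapping.keys x. pm_scale (lk x p) (Poly_Mapping.single p 1)) q"
    by (simp add: in_keys_iff)
qed

locale presented = partial_mult "gen_space a d" "{(s, t). s \<in> gen_space a d \<and> t \<in> gen_space a d \<and> s * t \<in> gen_space a d}" m
  for a :: "nat \<Rightarrow> 'g::group_add" and d m +
  fixes R :: "((nat \<times> int) \<times> (nat \<times> int) \<times> (nat \<times> int)) set"
  assumes rel_range: "((i, x), (j, y), (k, z)) \<in> R \<Longrightarrow> {i, j, k} \<subseteq> {1..d} \<and> {x, y, z} \<subseteq> {- 1, 0, 1}"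
    and presented: "presented_by a d (relation_words R)"
begin

abbreviation S where "S \<equiv> gen_space a d"

abbreviation D where "D \<equiv> {(s, t). s \<in> S \<and> t \<in> S \<and> s * t \<in> S}"

abbreviation Fm_cong (infix "\<simeq>" 50) where "x \<simeq> y \<equiv> Fm_eq S D m 1 x y"

abbreviation alphabet :: "(nat \<times> bool) list set" where "alphabet \<equiv> lists ({1..d} \<times> UNIV)"

lemma one_S: "1 \<in> S"
  unfolding gen_space_def by (rule pm.span_base) simp

lemma gen_S: "i \<in> {1..d} \<Longrightarrow> Poly_Mapping.single (a i) 1 \<in> S" "i \<in> {1..d} \<Longrightarrow> Poly_Mapping.single (- a i) 1 \<in> S"
  unfolding gen_space_def by (rule pm.span_base; auto)+

definition word_elt :: "(nat \<times> bool) list \<Rightarrow> (('g \<Rightarrow>\<^sub>0 complex) fword \<Rightarrow>\<^sub>0 complex)" where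
  "word_elt w = prod_list (map (\<lambda>(i, b). letter (Poly_Mapping.single (if b then a i else - a i) 1)) w)"

lemma word_elt_Nil [simp]: "word_elt [] = 1"
  and word_elt_append [simp]: "word_elt (v @ w) = word_elt v * word_elt w"
  by (simp_all add: word_elt_def)

lemma word_elt_free: "w \<in> alphabet \<Longrightarrow> word_elt w \<in> free_alg S"
proof (induction w)
  case (Cons l w)
  obtain i b where l: "l = (i, b)" by (rule prod.exhaust)
  have "letter (Poly_Mapping.single (if b then a i else - a i) 1) \<in> free_alg S"
    using Cons.prems l gen_S[of i] by (intro free_alg_letter) auto
  then show ?case using Cons by (simp add: word_elt_def l free_alg_mult)
qed simp

lemma eval_word_elt: "eval_free (word_elt w) = Poly_Mapping.single (word_val a w) 1"
proof (induction w)
  case (Cons l w)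
  obtain i b where l: "l = (i, b)" by (rule prod.exhaust)
  show ?case using Cons by (simp add: word_elt_def word_val_def l eval_free_mult mult_single)
qed (simp add: word_val_def)

lemma word_val_append: "word_val a (v @ w) = word_val a v + word_val a w"
  by (simp add: word_val_def)

lemma word_elt_pow:
  assumes "i \<in> {1..d}"
  shows "pow_word (i, x) \<in> alphabet"
    and "Poly_Mapping.single (word_val a (pow_word (i, x))) 1 \<in> S"
    and "word_elt (pow_word (i, x)) \<simeq> letter (Poly_Mapping.single (word_val a (pow_word (i, x))) 1)"
proof -
  show "pow_word (i, x) \<in> alphabet" using assms by (simp add: pow_word_def)
  show "Poly_Mapping.single (word_val a (pow_word (i, x))) 1 \<in> S"
    using gen_S[OF assms] one_S by (simp add: pow_word_def word_val_def)
  show "word_elt (pow_word (i, x)) \<simeq> letter (Poly_Mapping.single (word_val a (pow_word (i, x))) 1)"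
    using Fm_sym[OF Fm_letter_1] by (simp add: pow_word_def word_val_def word_elt_def Fm_refl)
qed

lemma Fm_letter_mult_S: "s \<in> S \<Longrightarrow> t \<in> S \<Longrightarrow> s * t \<in> S \<Longrightarrow> letter s * letter t \<simeq> letter (s * t)"
  by (rule Fm_letter_mult) simp

text \<open>The place where the shape of the relations counts: the left side is a product of two
  elements of S, and its value, the right side, lies in S again. So the pair belongs to D and the
  relation is imposed in F_m(S).\<close>

lemma word_elt_rel:
  assumes "(l, r) \<in> relation_words R"
  shows "l \<in> alphabet" "r \<in> alphabet" "word_elt l \<simeq> word_elt r"
proof -
  obtain p q s where R: "(p, q, s) \<in> R" and lr: "l = pow_word p @ pow_word q" "r = pow_word s"
    using assms unfolding relation_words_def by auto
  obtain i x j y k z where pqs: "p = (i, x)" "q = (j, y)" "s = (k, z)" by (metis surj_pair)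
  have ijk: "i \<in> {1..d}" "j \<in> {1..d}" "k \<in> {1..d}" using rel_range[of i x j y k z] R pqs by auto
  note P = word_elt_pow[OF ijk(1), of x, folded pqs] and Q = word_elt_pow[OF ijk(2), of y, folded pqs]
    and T = word_elt_pow[OF ijk(3), of z, folded pqs]
  show l: "l \<in> alphabet" and r: "r \<in> alphabet" using P(1) Q(1) T(1) by (simp_all add: lr)
  have "word_eq d (relation_words R) ([] @ l @ []) ([] @ r @ [])" by (rule word_eq.rel[OF assms])
  then have val: "word_val a l = word_val a r" using presented l r by (simp add: presented_by_def)
  let ?e = "\<lambda>w. Poly_Mapping.single (word_val a w) (1 :: complex)"
  have pq: "?e (pow_word p) * ?e (pow_word q) = ?e r"
    using val by (simp add: mult_single lr word_val_append)
  have "word_elt l \<simeq> letter (?e (pow_word p)) * letter (?e (pow_word q))"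
    unfolding lr(1) word_elt_append
    by (intro Fm_mult P(3) Q(3) free_alg_letter P(2) word_elt_free Q(1))
  also have "\<dots> \<simeq> letter (?e r)"
    unfolding pq[symmetric] by (rule Fm_letter_mult_S[OF P(2) Q(2)]) (simp only: pq lr(2) T(2))
  also have "\<dots> \<simeq> word_elt r" unfolding lr(2) by (rule Fm_sym[OF T(3)])
  finally show "word_elt l \<simeq> word_elt r" .
qed

lemma word_elt_cancel: "i \<in> {1..d} \<Longrightarrow> word_elt [(i, b), (i, \<not> b)] \<simeq> 1"
proof -
  assume i: "i \<in> {1..d}"
  let ?s = "Poly_Mapping.single (if b then a i else - a i) (1 :: complex)"
  let ?t = "Poly_Mapping.single (if \<not> b then a i else - a i) (1 :: complex)"
  have st: "?s * ?t = 1" by (simp add: mult_single)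
  have "word_elt [(i, b), (i, \<not> b)] = letter ?s * letter ?t" by (simp add: word_elt_def)
  also have "\<dots> \<simeq> letter (?s * ?t)"
    by (rule Fm_letter_mult_S) (use gen_S[OF i] one_S st in auto)
  also have "letter (?s * ?t) \<simeq> 1" unfolding st by (rule Fm_letter_1)
  finally show ?thesis .
qed

text \<open>\<open>word_eq\<close> relates words over all letters, while the congruence is available
  only for words in the generators. The induction therefore carries along, in both directions, that
  the two words use only generators.\<close>

lemma word_eq_elt:
  assumes "word_eq d (relation_words R) v w"
  shows "(v \<in> alphabet \<longleftrightarrow> w \<in> alphabet) \<and> (v \<in> alphabet \<longrightarrow> word_elt v \<simeq> word_elt w)"
  using assms
proof (induction rule: word_eq.induct)
  case (trans u v w)
  then show ?case using Fm_trans by blast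
next
  case (cancel i u b v)
  have "word_elt (u @ [(i, b), (i, \<not> b)] @ v) \<simeq> word_elt (u @ v)" if "u \<in> alphabet" "v \<in> alphabet"
  proof -
    have "word_elt u * (word_elt [(i, b), (i, \<not> b)] * word_elt v) \<simeq> word_elt u * (1 * word_elt v)"
      using that cancel
      by (intro Fm_mult Fm_refl word_elt_cancel word_elt_free free_alg_mult free_alg_1) auto
    then show ?thesis by (simp only: word_elt_append mult_1)
  qed
  then show ?case using cancel by auto
next
  case (rel l r u v)
  note lr = word_elt_rel[OF rel]
  have "word_elt (u @ l @ v) \<simeq> word_elt (u @ r @ v)" if "u \<in> alphabet" "v \<in> alphabet"
  proof -
    have "word_elt u * (word_elt l * word_elt v) \<simeq> word_elt u * (word_elt r * word_elt v)"
      using that lr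
      by (intro Fm_mult Fm_refl lr(3) word_elt_free free_alg_mult) auto
    then show ?thesis by (simp only: word_elt_append)
  qed
  then show ?case using lr(1,2) by auto
qed (auto intro: Fm_refl Fm_sym)

lemma word_elt_eqI:
  "v \<in> alphabet \<Longrightarrow> w \<in> alphabet \<Longrightarrow> word_val a v = word_val a w \<Longrightarrow> word_elt v \<simeq> word_elt w"
  using presented word_eq_elt unfolding presented_by_def by blast

definition repr :: "'g \<Rightarrow> (nat \<times> bool) list" where
  "repr g = (SOME w. w \<in> alphabet \<and> word_val a w = g)"

lemma repr: "repr g \<in> alphabet" "word_val a (repr g) = g"
proof -
  have "g \<in> word_val a ` alphabet" using presented by (simp add: presented_by_def)
  then have "\<exists>w. w \<in> alphabet \<and> word_val a w = g" by auto
  then have "repr g \<in> alphabet \<and> word_val a (repr g) = g" unfolding repr_def by (rule someI_ex)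
  then show "repr g \<in> alphabet" "word_val a (repr g) = g" by auto
qed

lemma word_elt_repr: "w \<in> alphabet \<Longrightarrow> word_elt (repr (word_val a w)) \<simeq> word_elt w"
  by (rule word_elt_eqI[OF repr(1) _ repr(2)])

text \<open>A linear section of evaluation, built from one chosen word for each group element. It is
  multiplicative modulo the congruence, since words of equal value are congruent.\<close>

definition lift :: "('g \<Rightarrow>\<^sub>0 complex) \<Rightarrow> (('g \<Rightarrow>\<^sub>0 complex) fword \<Rightarrow>\<^sub>0 complex)" where
  "lift x = (\<Sum>g\<in>Poly_Mapping.keys x. pm_scale (lk x g) (word_elt (repr g)))"

lemma lift_superset:
  assumes "finite K" "Poly_Mapping.keys x \<subseteq> K"
  shows "lift x = (\<Sum>g\<in>K. pm_scale (lk x g) (word_elt (repr g)))"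
  unfolding lift_def using assms by (intro sum.mono_neutral_left) (auto simp: in_keys_iff)

lemma lift_add: "lift (x + y) = lift x + lift y"
proof -
  let ?K = "Poly_Mapping.keys x \<union> Poly_Mapping.keys y"
  have "Poly_Mapping.keys (x + y) \<subseteq> ?K" by (rule keys_add)
  then show ?thesis
    by (simp add: lift_superset[of ?K] lookup_add pm.scale_left_distrib sum.distrib)
qed

lemma lift_scale: "lift (pm_scale c x) = pm_scale c (lift x)"
proof -
  have "Poly_Mapping.keys (pm_scale c x) \<subseteq> Poly_Mapping.keys x" by (auto simp: in_keys_iff)
  then show ?thesis by (simp add: lift_superset[of "Poly_Mapping.keys x"] pm.scale_sum_right)
qed

lemma lift_0 [simp]: "lift 0 = 0"
  by (simp add: lift_def)

lemma lift_sum: "lift (\<Sum>i\<in>I. f i) = (\<Sum>i\<in>I. lift (f i))"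
  by (induction I rule: infinite_finite_induct) (simp_all add: lift_add)

lemma lift_single: "lift (Poly_Mapping.single g c) = pm_scale c (word_elt (repr g))"
  by (subst lift_superset[of "{g}"]) auto

lemma lift_free: "lift x \<in> free_alg S"
  unfolding lift_def by (intro free_alg_sum free_alg_scale word_elt_free repr)

lemma lift_word: "w \<in> alphabet \<Longrightarrow> lift (Poly_Mapping.single (word_val a w) 1) \<simeq> word_elt w"
  by (simp add: lift_single word_elt_repr)

lemma lift_mult: "lift (x * y) \<simeq> lift x * lift y"
proof (induction x rule: poly_mapping_single_induct)
  case (add g c x)
  have "lift (Poly_Mapping.single g c * y) \<simeq> lift (Poly_Mapping.single g c) * lift y"
  proof (induction y rule: poly_mapping_single_induct)
    case (add h e y)
    have "word_elt (repr (g + h)) \<simeq> word_elt (repr g @ repr h)"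
      by (rule word_elt_eqI[OF repr(1)]) (simp_all only: append_in_lists_conv repr word_val_append simp_thms)
    then have "pm_scale (c * e) (word_elt (repr (g + h))) \<simeq> pm_scale (c * e) (word_elt (repr g @ repr h))"
      by (rule Fm_scale)
    then have "lift (Poly_Mapping.single g c * Poly_Mapping.single h e) \<simeq>
        lift (Poly_Mapping.single g c) * lift (Poly_Mapping.single h e)"
      by (simp add: mult_single lift_single pm_scale_mult_left pm_scale_mult_right mult.commute)
    from Fm_add[OF this add] show ?case by (simp add: distrib_left lift_add)
  qed (simp add: Fm_refl)
  from Fm_add[OF this add] show ?case by (simp add: distrib_right lift_add)
qed (simp add: Fm_refl)

lemma lift_1: "lift 1 \<simeq> 1"
  using lift_word[of "[]"] by (simp add: word_val_def)

lemma lift_letter: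
  assumes "s \<in> S" shows "letter s \<simeq> lift s"
proof -
  have "letter s \<simeq> lift s \<and> s \<in> S"
    using assms unfolding gen_space_def
  proof (induction rule: pm.span_induct_alt)
    case base
    \<comment> \<open>The letter of the zero vector is not zero in the free algebra; it becomes so
      by the scaling relation with factor 0.\<close>
    have "letter (pm_scale 0 1) \<simeq> pm_scale 0 (letter (1 :: 'g \<Rightarrow>\<^sub>0 complex))"
      by (rule Fm_letter_scale[OF one_S])
    then show ?case unfolding gen_space_def[symmetric]
      using pm.subspace_0[OF pm.subspace_span] by (simp add: gen_space_def)
  next
    case (step c b y)
    have y: "letter y \<simeq> lift y" "y \<in> S" using step by (simp_all add: gen_space_def)
    have bS: "b \<in> S" unfolding gen_space_def by (rule pm.span_base[OF step(1)])
    have b: "letter b \<simeq> lift b"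
    proof -
      consider "b = 1" | i where "i \<in> {1..d}" "b = Poly_Mapping.single (a i) 1"
        | i where "i \<in> {1..d}" "b = Poly_Mapping.single (- a i) 1"
        using step(1) by auto
      then show ?thesis
      proof cases
        case 1
        show ?thesis unfolding 1 by (rule Fm_trans[OF Fm_letter_1 Fm_sym[OF lift_1]])
      next
        case (2 i)
        then show ?thesis using Fm_sym[OF lift_word[of "[(i, True)]"]]
          by (simp add: word_val_def word_elt_def)
      next
        case (3 i)
        then show ?thesis using Fm_sym[OF lift_word[of "[(i, False)]"]]
          by (simp add: word_val_def word_elt_def)
      qed
    qed
    have cb: "pm_scale c b \<in> S" using bS unfolding gen_space_def by (rule pm.span_scale)
    have "letter (pm_scale c b + y) \<simeq> letter (pm_scale c b) + letter y"
      by (rule Fm_letter_add[OF cb y(2)])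
    also have "\<dots> \<simeq> pm_scale c (lift b) + lift y"
      by (intro Fm_add y(1) Fm_trans[OF Fm_letter_scale[OF bS]] Fm_scale b)
    also have "\<dots> = lift (pm_scale c b + y)" by (simp add: lift_add lift_scale)
    finally have "letter (pm_scale c b + y) \<simeq> lift (pm_scale c b + y)" .
    moreover have "pm_scale c b + y \<in> S"
      using cb y(2) unfolding gen_space_def by (rule pm.span_add)
    ultimately show ?case by (simp add: gen_space_def)
  qed
  then show ?thesis by blast
qed

text \<open>Letters are congruent to lifts of their values and \<open>lift\<close> is
  multiplicative, so each word, and by linearity each element, is congruent to the lift of its
  value.\<close>

lemma lift_eval:
  assumes "x \<in> free_alg S" shows "x \<simeq> lift (eval_free x)"
proof -
  have word: "Poly_Mapping.single (FWord l) 1 \<simeq> lift (prod_list l)" if "set l \<subseteq> S" for l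
    using that
  proof (induction l)
    case Nil
    show ?case using Fm_sym[OF lift_1] by (simp add: single_FWord_Nil)
  next
    case (Cons s l)
    have "Poly_Mapping.single (FWord (s # l)) 1 = letter s * Poly_Mapping.single (FWord l) 1"
      by (simp add: letter_def mult_single plus_fword_def)
    also have "\<dots> \<simeq> lift s * lift (prod_list l)"
    proof (rule Fm_mult)
      show "Poly_Mapping.single (FWord l) 1 \<in> free_alg S" using Cons by (simp add: free_alg_def)
    qed (use Cons lift_letter lift_free in auto)
    also have "\<dots> \<simeq> lift (prod_list (s # l))" using Fm_sym[OF lift_mult] by simp
    finally show ?case .
  qed
  have "x = (\<Sum>w\<in>Poly_Mapping.keys x. pm_scale (lk x w) (Poly_Mapping.single w 1))"
    by (rule pm_sum_singles)
  also have "\<dots> \<simeq> (\<Sum>w\<in>Poly_Mapping.keys x. pm_scale (lk x w) (lift (eval_word w)))"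
  proof (intro Fm_sum Fm_scale)
    fix w assume "w \<in> Poly_Mapping.keys x"
    then have "set (letters w) \<subseteq> S" using assms by (auto simp: free_alg_def)
    from word[OF this] show "Poly_Mapping.single w 1 \<simeq> lift (eval_word w)"
      by (simp add: eval_word_def)
  qed
  also have "\<dots> = lift (eval_free x)" by (simp add: eval_free_def lift_sum lift_scale)
  finally show ?thesis .
qed

text \<open>Evaluation is injective on F_m(S): both elements are congruent to the lift of their
  common value.\<close>

theorem Fm_eq_iff_eval:
  assumes "x \<in> free_alg S" "y \<in> free_alg S"
  shows "x \<simeq> y \<longleftrightarrow> eval_free x = eval_free y"
  using Fm_eval Fm_trans[OF lift_eval[OF assms(1)]] Fm_sym[OF lift_eval[OF assms(2)]] by auto

end

section \<open>Reachable spans, and lists of rows as matrices\<close>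

context contractive_reach
begin

lemma reach_scaled_sum:
  assumes "E \<noteq> []"
  shows "reach (map (pm_scale (of_real r)) E @ map (pm_scale (of_real r')) E)
    (map (pm_scale (of_real (sqrt (r\<^sup>2 + r'\<^sup>2)))) E)"
proof (rule reach_gram[where W = "[]"])
  fix b b'
  have "(cmod (of_real (sqrt (r\<^sup>2 + r'\<^sup>2))))\<^sup>2 = (cmod (of_real r))\<^sup>2 + (cmod (of_real r'))\<^sup>2" by simp
  then show "gram ((map (pm_scale (of_real r)) E @ map (pm_scale (of_real r')) E) @ []) b b' =
    gram (map (pm_scale (of_real (sqrt (r\<^sup>2 + r'\<^sup>2)))) E) b b'"
    by (simp only: append_Nil2 gram_append gram_scale of_real_add distrib_right)
qed (use assms in simp)

lemma reach_span_scale: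
  assumes "E \<noteq> []" "reach [x] (map (pm_scale (of_real w)) E)"
  shows "\<exists>w. reach [pm_scale c x] (map (pm_scale (of_real w)) E)"
proof
  have "reach [pm_scale c x] (map (pm_scale c) (map (pm_scale (of_real w)) E))"
    using reach_scale[OF assms(2), of c] by simp
  also have "reach \<dots> (map (pm_scale (of_real (cmod c * w))) E)"
  proof (rule reach_gram[where W = "[]"])
    fix b b'
    have "(cmod (of_real (cmod c * w)))\<^sup>2 = (cmod c)\<^sup>2 * (cmod (of_real w))\<^sup>2"
      by (simp only: norm_of_real power2_abs power_mult_distrib)
    then show "gram (map (pm_scale c) (map (pm_scale (of_real w)) E) @ []) b b' =
      gram (map (pm_scale (of_real (cmod c * w))) E) b b'"
      by (simp only: append_Nil2 gram_scale of_real_mult mult.assoc)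
  qed (use assms in simp)
  finally show "reach [pm_scale c x] (map (pm_scale (of_real (cmod c * w))) E)" .
qed

lemma reach_span_add:
  assumes E: "E \<noteq> []" and x: "reach [x] (map (pm_scale (of_real w)) E)"
    and y: "reach [y] (map (pm_scale (of_real w')) E)"
  shows "\<exists>w. reach [x + y] (map (pm_scale (of_real w)) E)"
proof
  let ?r = "sqrt (w\<^sup>2 + w'\<^sup>2)"
  have "reach [x + y] (map (pm_scale (of_real (sqrt 2))) [x, y])"
  \<comment> \<open>The parallelogram law: the squares of x + y and x - y add up to twice those of x
    and y.\<close>
  proof (rule reach_gram[where W = "[x - y]"])
    fix b b'
    have "(cmod (of_real (sqrt 2)))\<^sup>2 = 2" by simp
    then have "gram (map (pm_scale (of_real (sqrt 2))) [x, y]) b b' = 2 * gram [x, y] b b'"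
      by (simp only: gram_scale of_real_numeral)
    then show "gram ([x + y] @ [x - y]) b b' = gram (map (pm_scale (of_real (sqrt 2))) [x, y]) b b'"
      by (simp add: lookup_add lookup_minus algebra_simps)
  qed simp
  also have "reach \<dots> (map (pm_scale (of_real (sqrt 2))) (map (pm_scale (of_real ?r)) E))"
    using reach_trans[OF reach_append[OF x y] reach_scaled_sum[OF E]] by (intro reach_scale) simp
  finally show "reach [x + y] (map (pm_scale (of_real (sqrt 2 * ?r))) E)"
    by (simp add: comp_def)
qed

end

definition row_entry :: "('g \<times> nat \<Rightarrow>\<^sub>0 complex) \<Rightarrow> nat \<Rightarrow> ('g \<Rightarrow>\<^sub>0 complex)" where
  "row_entry v j = Poly_Mapping.map_key (\<lambda>g. (g, j)) v"

lemma lookup_row_entry [simp]: "lk (row_entry v j) g = lk v (g, j)"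
proof -
  have "inj (\<lambda>g :: 'a. (g, j))" by (auto simp: inj_on_def)
  then show ?thesis by (simp add: row_entry_def map_key.rep_eq)
qed

lemma row_entry_add: "row_entry (u + v) j = row_entry u j + row_entry v j"
  by (rule poly_mapping_eqI) (simp add: lookup_add)

lemma row_entry_scale: "row_entry (pm_scale c v) j = pm_scale c (row_entry v j)"
  by (rule poly_mapping_eqI) simp

lemma row_entry_0 [simp]: "row_entry 0 j = 0"
  by (rule poly_mapping_eqI) simp

lemma row_entry_sum: "row_entry (\<Sum>i\<in>I. f i) j = (\<Sum>i\<in>I. row_entry (f i) j)"
  by (induction I rule: infinite_finite_induct) (simp_all add: row_entry_add)

lemma row_entry_single: "row_entry (Poly_Mapping.single (g, l) c) j = (if l = j then Poly_Mapping.single g c else 0)"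
  by (rule poly_mapping_eqI) (simp add: lookup_single when_def)

lemma row_entry_act: "row_entry (act g v) j = Poly_Mapping.single g 1 * row_entry v j"
proof (induction v rule: poly_mapping_single_induct)
  case (add p c v)
  obtain x l where p: "p = (x, l)" by (rule prod.exhaust)
  have "row_entry (act g (Poly_Mapping.single p c)) j = Poly_Mapping.single g 1 * row_entry (Poly_Mapping.single p c) j"
    by (simp add: p act_single row_entry_single mult_single)
  then show ?case using add by (simp add: act_add row_entry_add distrib_left)
qed simp

definition mat_of_list :: "nat \<Rightarrow> ('g \<times> nat \<Rightarrow>\<^sub>0 complex) list \<Rightarrow> ('g \<Rightarrow>\<^sub>0 complex) mat" where
  "mat_of_list n Y = mat (length Y) n (\<lambda>(i, j). row_entry (Y ! i) j)"

lemma dim_mat_of_list [simp]: "dim_row (mat_of_list n Y) = length Y" "dim_col (mat_of_list n Y) = n"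
  by (simp_all add: mat_of_list_def)

lemma mat_of_list_apply:
  fixes Y :: "('g::group_add \<times> nat \<Rightarrow>\<^sub>0 complex) list"
  shows "mat_of_list n (mat_apply m \<alpha> Y) = scalar_mat (mat m (length Y) (\<lambda>(i, j). \<alpha> i j)) * mat_of_list n Y"
proof (rule eq_matI)
  fix i j assume "i < dim_row (scalar_mat (mat m (length Y) (\<lambda>(i, j). \<alpha> i j)) * mat_of_list n Y)"
    "j < dim_col (scalar_mat (mat m (length Y) (\<lambda>(i, j). \<alpha> i j)) * mat_of_list n Y)"
  then have ij: "i < m" "j < n" by simp_all
  have "(scalar_mat (mat m (length Y) (\<lambda>(i, j). \<alpha> i j)) * mat_of_list n Y) $$ (i, j) =
      (\<Sum>k<length Y. Poly_Mapping.single 0 (\<alpha> i k) * row_entry (Y ! k) j)"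
    using ij by (simp add: scalar_prod_def atLeast0LessThan mat_of_list_def)
  also have "\<dots> = mat_of_list n (mat_apply m \<alpha> Y) $$ (i, j)"
    using ij by (simp add: mat_of_list_def mat_apply_def row_entry_sum row_entry_scale pm_scale_eq_mult[symmetric])
  finally show "mat_of_list n (mat_apply m \<alpha> Y) $$ (i, j) =
      (scalar_mat (mat m (length Y) (\<lambda>(i, j). \<alpha> i j)) * mat_of_list n Y) $$ (i, j)" by simp
qed simp_all

lemma mat_of_list_act:
  fixes Y :: "('g::group_add \<times> nat \<Rightarrow>\<^sub>0 complex) list"
  assumes "length Y' = length Y" "\<And>i. i < length Y \<Longrightarrow> Y' ! i = act (g i) (Y ! i)"
  shows "mat_of_list n Y' = diag_of (length Y) (\<lambda>i. Poly_Mapping.single (g i) 1) * mat_of_list n Y"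
proof (rule eq_matI)
  let ?D = "diag_of (length Y) (\<lambda>i. Poly_Mapping.single (g i) (1::complex))"
  fix i j assume "i < dim_row (?D * mat_of_list n Y)" "j < dim_col (?D * mat_of_list n Y)"
  then have ij: "i < length Y" "j < n" by simp_all
  have "(?D * mat_of_list n Y) $$ (i, j) = (\<Sum>k<length Y. ?D $$ (i, k) * row_entry (Y ! k) j)"
    using ij by (simp add: scalar_prod_def atLeast0LessThan mat_of_list_def diag_of_def)
  also have "\<dots> = (\<Sum>k<length Y. if k = i then Poly_Mapping.single (g i) 1 * row_entry (Y ! i) j else 0)"
    using ij by (intro sum.cong) (auto simp: diag_of_def)
  also have "\<dots> = mat_of_list n Y' $$ (i, j)"
    using ij assms by (simp add: mat_of_list_def row_entry_act)
  finally show "mat_of_list n Y' $$ (i, j) = (?D * mat_of_list n Y) $$ (i, j)" by simp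
qed (simp_all add: assms(1))

lemma opnorm_contraction:
  assumes "contraction m k \<alpha>" shows "opnorm (mat m k (\<lambda>(i, j). \<alpha> i j)) \<le> 1"
proof (rule opnorm_le)
  let ?M = "mat m k (\<lambda>(i, j). \<alpha> i j)"
  fix v :: "complex vec" assume v: "v \<in> carrier_vec (dim_col ?M)"
  have "(?M *\<^sub>v v) $ i = (\<Sum>j<k. \<alpha> i j * v $ j)" if "i < m" for i
    using mult_mat_vec_nth[of i ?M v] that v by simp
  then have "(l2norm (?M *\<^sub>v v))\<^sup>2 = (\<Sum>i<m. (cmod (\<Sum>j<k. \<alpha> i j * v $ j))\<^sup>2)"
    unfolding l2norm_sq by (intro sum.cong) auto
  also have "\<dots> \<le> (\<Sum>j<k. (cmod (v $ j))\<^sup>2)"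
    using assms by (simp add: contraction_def)
  also have "\<dots> = (l2norm v)\<^sup>2" using v by (simp add: l2norm_sq)
  finally have "l2norm (?M *\<^sub>v v) \<le> l2norm v" by (rule power2_le_imp_le) simp
  then show "l2norm (?M *\<^sub>v v) \<le> 1 * l2norm v" by simp
qed simp

text \<open>Sizes that fit together from \<open>p\<close> rows to \<open>q\<close> columns. The
  empty list is allowed, with \<open>p = q\<close>, for the case where nothing has been multiplied
  yet.\<close>

fun chain :: "nat \<Rightarrow> 'v mat list \<Rightarrow> nat \<Rightarrow> bool" where
  "chain p [] q \<longleftrightarrow> p = q"
| "chain p (A # As) q \<longleftrightarrow> dim_row A = p \<and> chain (dim_col A) As q"

lemma chain_snoc: "chain p (As @ [A]) q \<longleftrightarrow> chain p As (dim_row A) \<and> dim_col A = q"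
  by (induction As arbitrary: p) auto

lemma chain_nth: "chain p As q \<Longrightarrow> Suc k < length As \<Longrightarrow> dim_col (As ! k) = dim_row (As ! Suc k)"
proof (induction As arbitrary: p k)
  case (Cons A As)
  show ?case
  proof (cases k)
    case 0
    then obtain A' As' where "As = A' # As'" using Cons.prems by (cases As) auto
    then show ?thesis using Cons.prems 0 by simp
  next
    case (Suc l)
    then show ?thesis using Cons.IH[of "dim_col A" l] Cons.prems by simp
  qed
qed simp

lemma chain_of_nth:
  assumes "As \<noteq> []" "\<And>k. Suc k < length As \<Longrightarrow> dim_col (As ! k) = dim_row (As ! Suc k)"
  shows "chain (dim_row (hd As)) As (dim_col (last As))"
  using assms
proof (induction As)
  case (Cons A As)
  show ?case
  proof (cases "As = []")
    case False
    have "chain (dim_row (hd As)) As (dim_col (last As))"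
    proof (rule Cons.IH[OF False])
      fix k assume "Suc k < length As"
      then show "dim_col (As ! k) = dim_row (As ! Suc k)" using Cons.prems(2)[of "Suc k"] by simp
    qed
    moreover have "dim_col A = dim_row (hd As)"
      using Cons.prems(2)[of 0] False by (simp add: hd_conv_nth)
    ultimately show ?thesis using False by simp
  qed simp
qed simp

lemma mat_list_prod_dim:
  "chain p As q \<Longrightarrow> As \<noteq> [] \<Longrightarrow> dim_row (mat_list_prod As) = p \<and> dim_col (mat_list_prod As) = q"
  by (induction As arbitrary: p rule: mat_list_prod.induct) auto

lemma chain_map: "chain p As q \<Longrightarrow> chain p (map (map_mat f) As) q"
  by (induction As arbitrary: p) auto

lemma Fm_prod_dim: "chain p As q \<Longrightarrow> As \<noteq> [] \<Longrightarrow> dim_row (Fm_prod As) = p \<and> dim_col (Fm_prod As) = q"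
  unfolding Fm_prod_def by (rule mat_list_prod_dim) (auto intro: chain_map)

lemma Fm_prod_eval:
  assumes "chain p As q" "As \<noteq> []" "i < p" "j < q"
  shows "eval_free (Fm_prod As $$ (i, j)) = mat_list_prod As $$ (i, j)"
  using assms
proof (induction As arbitrary: p i rule: mat_list_prod.induct)
  case (2 A)
  then show ?case by (simp add: Fm_prod_def)
next
  case (3 A B As)
  let ?BA = "B # As"
  have c: "chain (dim_col A) ?BA q" and A: "dim_row A = p" using 3(2) by simp_all
  have d: "dim_row (Fm_prod ?BA) = dim_col A" "dim_col (Fm_prod ?BA) = q"
    "dim_row (mat_list_prod ?BA) = dim_col A" "dim_col (mat_list_prod ?BA) = q"
    using Fm_prod_dim[OF c] mat_list_prod_dim[OF c] by simp_all
  have "Fm_prod (A # ?BA) = map_mat letter A * Fm_prod ?BA" by (simp add: Fm_prod_def)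
  then have "Fm_prod (A # ?BA) $$ (i, j) = (\<Sum>k<dim_col A. letter (A $$ (i, k)) * Fm_prod ?BA $$ (k, j))"
    using 3(4,5) A d by (simp add: scalar_prod_def atLeast0LessThan)
  then have "eval_free (Fm_prod (A # ?BA) $$ (i, j)) =
      (\<Sum>k<dim_col A. A $$ (i, k) * eval_free (Fm_prod ?BA $$ (k, j)))"
    by (simp add: eval_free_sum eval_free_mult)
  also have "\<dots> = (\<Sum>k<dim_col A. A $$ (i, k) * mat_list_prod ?BA $$ (k, j))"
    by (rule sum.cong[OF HOL.refl]) (use 3(1)[OF c] 3(5) in simp)
  also have "\<dots> = mat_list_prod (A # ?BA) $$ (i, j)"
    using 3(4,5) A d by (simp add: scalar_prod_def atLeast0LessThan)
  finally show ?case .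
qed simp

lemma elements_mat_nth: "elements_mat A \<subseteq> S \<Longrightarrow> i < dim_row A \<Longrightarrow> j < dim_col A \<Longrightarrow> A $$ (i, j) \<in> S"
  by (rule subsetD, assumption, rule elements_matI[OF carrier_matI[OF HOL.refl HOL.refl]]) simp_all

lemma Fm_prod_free:
  fixes As :: "('g::group_add \<Rightarrow>\<^sub>0 complex) mat list"
  assumes "chain p As q" "As \<noteq> []" "i < p" "j < q" "\<And>A. A \<in> set As \<Longrightarrow> elements_mat A \<subseteq> S"
  shows "Fm_prod As $$ (i, j) \<in> free_alg S"
  using assms
proof (induction As arbitrary: p i rule: mat_list_prod.induct)
  case (2 A)
  have "elements_mat A \<subseteq> S" by (rule 2(5)) simp
  moreover have "i < dim_row A" "j < dim_col A" using 2(1,3,4) by simp_all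
  ultimately have "A $$ (i, j) \<in> S" by (rule elements_mat_nth)
  then have "letter (A $$ (i, j)) \<in> free_alg S" by (rule free_alg_letter)
  then show ?case using \<open>i < dim_row A\<close> \<open>j < dim_col A\<close> by (simp add: Fm_prod_def)
next
  case (3 A B As)
  let ?BA = "B # As"
  have c: "chain (dim_col A) ?BA q" and A: "dim_row A = p" using 3(2) by simp_all
  have d: "dim_row (Fm_prod ?BA) = dim_col A" "dim_col (Fm_prod ?BA) = q"
    using Fm_prod_dim[OF c] by simp_all
  have "A $$ (i, k) \<in> S" if "k < dim_col A" for k
  proof (rule elements_mat_nth)
    show "elements_mat A \<subseteq> S" by (rule 3(6)) simp
  qed (use 3(4) A that in simp_all)
  moreover have "Fm_prod ?BA $$ (k, j) \<in> free_alg S" if "k < dim_col A" for k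
    by (rule 3(1)[OF c _ that 3(5)]) (simp, rule 3(6), simp)
  moreover have "Fm_prod (A # ?BA) = map_mat letter A * Fm_prod ?BA" by (simp add: Fm_prod_def)
  then have "Fm_prod (A # ?BA) $$ (i, j) = (\<Sum>k<dim_col A. letter (A $$ (i, k)) * Fm_prod ?BA $$ (k, j))"
    using 3(4,5) A d by (simp add: scalar_prod_def atLeast0LessThan)
  ultimately show ?case by (simp only:) (intro free_alg_sum free_alg_mult free_alg_letter; simp)
qed simp

lemma foldr_mult_eq_mat_list_prod: "foldr (*) As M = mat_list_prod (As @ [M])"
proof (induction As)
  case (Cons A As)
  then show ?case by (cases "As @ [M]") auto
qed simp

section \<open>Factorizations from reachability, and the two norm estimates\<close>

context presented
begin

abbreviation N where "N \<equiv> gen_space_norm a d"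

lemma countable_group: "countable (UNIV :: 'g set)"
proof -
  have "range (word_val a) = UNIV"
  proof (rule antisym[OF subset_UNIV subsetI])
    fix g
    show "g \<in> range (word_val a)" using repr(2)[of g] by (rule range_eqI[OF HOL.sym])
  qed
  then show ?thesis using countable_image[OF countableI_type, of "word_val a" UNIV] by (rule subst)
qed

lemma signed_letter:
  assumes "i \<in> {1..d}"
  shows "\<exists>t\<in>{- int d..int d}. signed_gen a t = (if b then a i else - a i)"
proof (cases b)
  case True then show ?thesis using assms by (intro bexI[of _ "int i"]) (auto simp: signed_gen_def)
next
  case False then show ?thesis using assms by (intro bexI[of _ "- int i"]) (auto simp: signed_gen_def)
qed

text \<open>Every group element is the value of a word, so it is built from the identity by adding
  signed generators on the left.\<close>

lemma group_induct [case_names zero gen]: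
  assumes "P 0" "\<And>t g. t \<in> {- int d..int d} \<Longrightarrow> P g \<Longrightarrow> P (signed_gen a t + g)"
  shows "P g"
proof -
  have "P (word_val a w)" if "w \<in> alphabet" for w
    using that
  proof (induction w)
    case Nil
    then show ?case using assms(1) by (simp add: word_val_def)
  next
    case (Cons l w)
    obtain i b where l: "l = (i, b)" by (rule prod.exhaust)
    have "l \<in> {1..d} \<times> UNIV" by fact
    then have "i \<in> {1..d}" by (simp add: l)
    then obtain t where t: "t \<in> {- int d..int d}" "signed_gen a t = (if b then a i else - a i)"
      using signed_letter by blast
    have "P (signed_gen a t + word_val a w)" by (rule assms(2)[OF t(1)]) fact
    then show ?case by (simp add: word_val_def l t(2))
  qed
  from this[OF repr(1)] show ?thesis by (simp only: repr(2))
qed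

definition gen_actions :: "(('g \<times> nat \<Rightarrow>\<^sub>0 complex) \<Rightarrow> ('g \<times> nat \<Rightarrow>\<^sub>0 complex)) set" where
  "gen_actions = (\<lambda>t. act (signed_gen a t)) ` {- int d..int d}"

sublocale contractive_reach gen_actions
proof
  have "act (signed_gen a 0) = (\<lambda>x. x)" by (rule ext) (simp add: signed_gen_def)
  then show "(\<lambda>x. x) \<in> gen_actions" unfolding gen_actions_def by (metis (no_types, lifting)
      atLeastAtMost_iff image_eqI le_numeral_extra(3) neg_le_0_iff_le of_nat_0_le_iff)
  show "T (pm_scale c x) = pm_scale c (T x)" if "T \<in> gen_actions" for T c x
    using that by (auto simp: gen_actions_def act_scale)
qed

definition basis_rows :: "nat \<Rightarrow> ('g \<times> nat \<Rightarrow>\<^sub>0 complex) list" where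
  "basis_rows n = map (\<lambda>j. Poly_Mapping.single (0, j) 1) [0..<n]"

text \<open>Generators carry the unit row at (0, j) to the one at any (g, j), and multiples and sums
  stay reachable. This is the order unit property that the duality needs.\<close>

lemma reach_basis:
  assumes n: "0 < n" and x: "Poly_Mapping.keys x \<subseteq> UNIV \<times> {..<n}"
  shows "\<exists>w. reach [x] (map (pm_scale (of_real w)) (basis_rows n))"
proof -
  let ?E = "basis_rows n"
  have E: "?E \<noteq> []" using n by (simp add: basis_rows_def)
  have gen: "reach [Poly_Mapping.single (g, j) 1] (map (pm_scale (of_real 1)) ?E)" if j: "j < n" for g j
  proof (induction g rule: group_induct)
    case zero
    have "j < length ?E" "?E ! j = Poly_Mapping.single (0, j) 1" using j by (simp_all add: basis_rows_def)
    then obtain U W where split: "?E = U @ Poly_Mapping.single (0, j) 1 # W"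
      using id_take_nth_drop[of j ?E] by metis
    have one: "map (pm_scale (of_real 1)) ?E = ?E" by (rule map_idI) simp
    \<comment> \<open>One unit row is picked out of the list; the other rows are the discarded
      part.\<close>
    show ?case unfolding one
      by (rule reach_gram[where W = "U @ W"]) (simp_all add: split add.left_commute)
  next
    case (gen t g)
    have "list_all2 (\<lambda>y y'. \<exists>T\<in>gen_actions. y' = T y) [Poly_Mapping.single (g, j) 1]
        [Poly_Mapping.single (signed_gen a t + g, j) 1]"
      using gen(1) by (auto simp: gen_actions_def act_single)
    then show ?case using reach_act gen(2) by blast
  qed
  have "\<exists>w. reach [\<Sum>p\<in>K. pm_scale (lk x p) (Poly_Mapping.single p 1)] (map (pm_scale (of_real w)) ?E)"
    if "finite K" "K \<subseteq> UNIV \<times> {..<n}" for K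
    using that
  proof (induction K)
    case empty
    have "reach [0] (map (pm_scale (of_real 0)) ?E)"
    proof (rule reach_gram[where W = "[]"])
      show "gram ([0] @ []) b b' = gram (map (pm_scale (of_real 0)) ?E) b b'" for b b'
        by (simp only: append_Nil2 gram_scale) simp
    qed simp
    then show ?case unfolding sum.empty by (rule exI)
  next
    case (insert p K)
    obtain g j where p: "p = (g, j)" by (rule prod.exhaust)
    have "j < n" using insert.prems p by auto
    then obtain w where w: "reach [pm_scale (lk x p) (Poly_Mapping.single p 1)] (map (pm_scale (of_real w)) ?E)"
      using reach_span_scale[OF E gen] p by blast
    obtain w' where "reach [\<Sum>p\<in>K. pm_scale (lk x p) (Poly_Mapping.single p 1)] (map (pm_scale (of_real w')) ?E)"
      using insert by auto
    from reach_span_add[OF E w this] show ?case using insert.hyps by simp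
  qed
  from this[OF finite_keys x] show ?thesis by (simp only: pm_sum_singles[symmetric])
qed

lemma reach_duality:
  assumes "0 < n" shows "reach_duality gen_actions (basis_rows n) (UNIV \<times> {..<n})"
proof
  show "basis_rows n \<noteq> []" using assms by (simp add: basis_rows_def)
  show "Poly_Mapping.keys e \<subseteq> UNIV \<times> {..<n}" if "e \<in> set (basis_rows n)" for e
    using that by (auto simp: basis_rows_def)
  show "\<exists>w. reach [x] (map (pm_scale (of_real w)) (basis_rows n))"
    if "Poly_Mapping.keys x \<subseteq> UNIV \<times> {..<n}" for x
    by (rule reach_basis[OF assms that])
qed

definition good :: "('g \<Rightarrow>\<^sub>0 complex) mat \<Rightarrow> bool" where
  "good A \<longleftrightarrow> 1 \<le> dim_row A \<and> 1 \<le> dim_col A \<and> elements_mat A \<subseteq> S \<and> N A \<le> 1"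

lemma S_scalar: "Poly_Mapping.single 0 c \<in> S"
proof -
  have "pm_scale c 1 \<in> S" using one_S unfolding gen_space_def by (rule pm.span_scale)
  then show ?thesis using pm_scale_single[of c "0 :: 'g" 1] by simp
qed

lemma S_zero: "0 \<in> S"
  using S_scalar[of 0] by simp

lemma scalar_mat_S: "elements_mat (scalar_mat \<alpha> :: ('g \<Rightarrow>\<^sub>0 complex) mat) \<subseteq> S"
  by (auto simp: elements_mat_def S_scalar)

text \<open>Each reachability step is left multiplication by a scalar contraction or by a diagonal
  matrix of signed generators, so it puts one more factor of norm at most 1 in front.\<close>

lemma reach_factor:
  assumes "reach Y Z" "Z \<noteq> []"
  shows "Y \<noteq> [] \<and> (\<exists>As. (\<forall>A\<in>set As. good A) \<and> chain (length Y) As (length Z) \<and>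
    mat_of_list n Y = foldr (*) As (mat_of_list n Z))"
  using assms
proof (induction rule: reach.induct)
  case (reach_refl Z)
  then show ?case by (auto intro!: exI[of _ "[]"])
next
  case (reach_mat Y Z m \<alpha>)
  then obtain As where Y: "Y \<noteq> []" and As: "\<forall>A\<in>set As. good A" "chain (length Y) As (length Z)"
    "mat_of_list n Y = foldr (*) As (mat_of_list n Z)" by auto
  let ?M = "mat m (length Y) (\<lambda>(i, j). \<alpha> i j)"
  have "N (scalar_mat ?M) \<le> 1"
    by (rule order_trans[OF gen_space_norm_scalar opnorm_contraction[OF reach_mat.hyps(2)]])
  then have "good (scalar_mat ?M)"
    unfolding good_def
    by (intro conjI scalar_mat_S) (use Y reach_mat.hyps(3) in \<open>simp_all add: Suc_le_eq\<close>)
  moreover have len: "length (mat_apply m \<alpha> Y) = m" by simp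
  moreover have "mat_of_list n (mat_apply m \<alpha> Y) = foldr (*) (scalar_mat ?M # As) (mat_of_list n Z)"
    by (simp only: mat_of_list_apply As(3) foldr.simps o_apply)
  moreover have "mat_apply m \<alpha> Y \<noteq> []" using len reach_mat.hyps(3) by force
  ultimately show ?case using As(1,2) by (intro conjI exI[of _ "scalar_mat ?M # As"]) simp_all
next
  case (reach_act Y Z Y')
  then obtain As where Y: "Y \<noteq> []" and As: "\<forall>A\<in>set As. good A" "chain (length Y) As (length Z)"
    "mat_of_list n Y = foldr (*) As (mat_of_list n Z)" by auto
  have len: "length Y' = length Y" using list_all2_lengthD[OF reach_act.hyps(2)] by simp
  have "\<exists>t. t \<in> {- int d..int d} \<and> Y' ! i = act (signed_gen a t) (Y ! i)" if "i < length Y" for i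
    using list_all2_nthD[OF reach_act.hyps(2) that] by (auto simp: gen_actions_def)
  then obtain t where t: "\<And>i. i < length Y \<Longrightarrow> t i \<in> {- int d..int d}"
    "\<And>i. i < length Y \<Longrightarrow> Y' ! i = act (signed_gen a (t i)) (Y ! i)" by metis
  let ?D = "diag_of (length Y) (\<lambda>i. Poly_Mapping.single (signed_gen a (t i)) (1 :: complex))"
  have "elements_mat ?D \<subseteq> S"
    using t(1) signed_gen_S[of _ d a] S_zero by (auto simp: elements_mat_def diag_of_def)
  then have "good ?D"
    using Y gen_space_norm_diag[of "length Y" t d a] t(1) by (simp add: good_def Suc_le_eq)
  moreover have "mat_of_list n Y' = ?D * mat_of_list n Y"
    by (rule mat_of_list_act[OF len t(2)])
  ultimately show ?case using As Y len
    by (intro conjI exI[of _ "?D # As"]) auto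
qed

text \<open>As congruence in F_m(S) is equality of values, a matrix product over the group algebra
  equal to A is a factorization of A in F_m(S). No intermediate product has to have entries in
  S.\<close>

lemma is_factorizationI:
  assumes A: "A \<in> mats S n k" and "As \<noteq> []" "chain n As k"
    and good: "\<And>B. B \<in> set As \<Longrightarrow> dim_row B \<ge> 1 \<and> dim_col B \<ge> 1 \<and> elements_mat B \<subseteq> S"
    and prod: "mat_list_prod As = A"
  shows "is_factorization S D m 1 A As"
proof -
  have dim: "dim_row A = n" "dim_col A = k" using mats_dim[OF A] by auto
  have Fdim: "dim_row (Fm_prod As) = n" "dim_col (Fm_prod As) = k"
    using Fm_prod_dim[OF assms(3,2)] by auto
  have eq: "Fm_prod As $$ (i, j) \<simeq> letter (A $$ (i, j))" if ij: "i < n" "j < k" for i j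
  proof -
    have "Fm_prod As $$ (i, j) \<in> free_alg S"
      by (rule Fm_prod_free[OF assms(3,2) ij]) (use good in blast)
    moreover have "letter (A $$ (i, j)) \<in> free_alg S" by (rule free_alg_letter[OF matsD[OF A ij]])
    moreover have "eval_free (Fm_prod As $$ (i, j)) = eval_free (letter (A $$ (i, j)))"
      by (simp add: Fm_prod_eval[OF assms(3,2) ij] prod)
    ultimately show ?thesis using Fm_eq_iff_eval by blast
  qed
  have "permissible S D m 1 As"
    unfolding permissible_def
  proof (intro conjI allI impI ballI)
    fix i j assume "i < dim_row (Fm_prod As)" "j < dim_col (Fm_prod As)"
    then have "i < n" "j < k" by (simp_all add: Fdim)
    then show "\<exists>s\<in>S. Fm_prod As $$ (i, j) \<simeq> letter s" using eq matsD[OF A] by blast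
  qed (use assms(2) good chain_nth[OF assms(3)] in auto)
  then show ?thesis by (simp add: is_factorization_def dim Fdim eq)
qed

lemma is_factorizationD:
  assumes f: "is_factorization S D m 1 A As"
  shows "As \<noteq> []" and "\<And>B. B \<in> set As \<Longrightarrow> B \<in> mats S (dim_row B) (dim_col B)"
    and "chain (dim_row A) As (dim_col A)" and "mat_list_prod As = A"
proof -
  have p: "permissible S D m 1 As" using f by (simp add: is_factorization_def)
  show ne: "As \<noteq> []" using p by (simp add: permissible_def)
  show "B \<in> mats S (dim_row B) (dim_col B)" if "B \<in> set As" for B
    using p that by (auto simp: permissible_def mats_def)
  have c: "chain (dim_row (hd As)) As (dim_col (last As))"
    using p by (intro chain_of_nth) (auto simp: permissible_def)
  have dim: "dim_row (hd As) = dim_row A" "dim_col (last As) = dim_col A"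
    using Fm_prod_dim[OF c ne] f by (auto simp: is_factorization_def)
  show cA: "chain (dim_row A) As (dim_col A)" using c by (simp add: dim)
  show "mat_list_prod As = A"
  proof (rule eq_matI)
    fix i j assume ij: "i < dim_row A" "j < dim_col A"
    have "Fm_prod As $$ (i, j) \<simeq> letter (A $$ (i, j))"
      using f ij by (simp add: is_factorization_def)
    from Fm_eval[OF this] show "mat_list_prod As $$ (i, j) = A $$ (i, j)"
      by (simp add: Fm_prod_eval[OF cA ne ij])
  qed (use mat_list_prod_dim[OF cA ne] in auto)
qed

lemma is_factorization_self:
  assumes "A \<in> mats S n k" "1 \<le> n" "1 \<le> k" shows "is_factorization S D m 1 A [A]"
  by (rule is_factorizationI[OF assms(1)]) (use assms in \<open>auto simp: mats_def\<close>)

lemma N_nonneg: "A \<in> mats S n k \<Longrightarrow> 0 \<le> N A"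
  using urep.op_bound_gen_space_norm(2)[OF urep.intro[OF unitary_rep_trivial]] .

lemma prod_list_nonneg_mats:
  "(\<And>B. B \<in> set As \<Longrightarrow> B \<in> mats S (dim_row B) (dim_col B)) \<Longrightarrow> 0 \<le> prod_list (map N As)"
  by (induction As) (auto intro!: mult_nonneg_nonneg N_nonneg)

lemma prod_list_good: "(\<And>B. B \<in> set As \<Longrightarrow> good B) \<Longrightarrow> prod_list (map N As) \<le> 1"
proof (induction As)
  case (Cons B As)
  have mats: "C \<in> mats S (dim_row C) (dim_col C)" if "C \<in> set (B # As)" for C
    using Cons.prems[OF that] by (simp add: good_def mats_def)
  have "N B \<le> 1" using Cons.prems[of B] by (simp add: good_def)
  moreover have "prod_list (map N As) \<le> 1" using Cons by simp
  moreover have "0 \<le> prod_list (map N As)" by (rule prod_list_nonneg_mats) (rule mats, simp)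
  moreover have "0 \<le> N B" by (rule N_nonneg) (rule mats, simp)
  ultimately show ?case by (simp add: mult_le_one)
qed simp

lemma fact_norm_le:
  assumes "is_factorization S D m 1 A As" shows "fact_norm N S D m 1 A \<le> prod_list (map N As)"
  unfolding fact_norm_def
proof (rule cInf_lower)
  show "bdd_below {prod_list (map N As) | As. is_factorization S D m 1 A As}"
  proof (rule bdd_belowI[of _ 0])
    fix r assume "r \<in> {prod_list (map N As) | As. is_factorization S D m 1 A As}"
    then obtain As where r: "r = prod_list (map N As)" and f: "is_factorization S D m 1 A As" by blast
    show "0 \<le> r" unfolding r by (rule prod_list_nonneg_mats) (rule is_factorizationD(2)[OF f])
  qed
qed (use assms in blast)

lemma fact_norm_le_reach:
  assumes A: "A \<in> mats S n k" and n: "1 \<le> n" and k: "1 \<le> k" and s: "0 \<le> s"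
    and r: "reach (map (row_vec A) [0..<n]) (map (pm_scale (of_real s)) (basis_rows k))"
  shows "fact_norm N S D m 1 A \<le> s"
proof -
  have dim: "dim_row A = n" "dim_col A = k" using mats_dim[OF A] by auto
  let ?Z = "map (pm_scale (of_real s)) (basis_rows k)"
  have lenE: "length (basis_rows k) = k" by (simp add: basis_rows_def)
  then have lenZ: "length ?Z = k" by simp
  obtain As where As: "\<forall>A\<in>set As. good A" "chain n As k"
    "mat_of_list k (map (row_vec A) [0..<n]) = foldr (*) As (mat_of_list k ?Z)"
  proof -
    have "?Z \<noteq> []" using lenZ k by force
    from reach_factor[OF r this, of k] have "\<exists>As. (\<forall>A\<in>set As. good A) \<and> chain n As k \<and>
      mat_of_list k (map (row_vec A) [0..<n]) = foldr (*) As (mat_of_list k ?Z)"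
      by (simp add: lenE)
    then show ?thesis using that by blast
  qed
  \<comment> \<open>The rightmost factor, s times the identity matrix, is the matrix of the scaled
    unit rows; it carries the whole norm.\<close>
  let ?s = "of_real s \<cdot>\<^sub>m 1\<^sub>m k :: complex mat"
  have "mat_of_list k (map (row_vec A) [0..<n]) = A"
  proof (rule eq_matI)
    fix i j assume "i < dim_row A" "j < dim_col A"
    then have "row_entry (row_vec A i) j = A $$ (i, j)"
      by (intro poly_mapping_eqI) (simp add: lookup_row_vec)
    then show "mat_of_list k (map (row_vec A) [0..<n]) $$ (i, j) = A $$ (i, j)"
      using \<open>i < dim_row A\<close> \<open>j < dim_col A\<close> by (simp add: mat_of_list_def dim)
  qed (simp_all add: dim)
  moreover have "mat_of_list k ?Z = scalar_mat ?s"
  proof (rule eq_matI)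
    fix i j assume "i < dim_row (scalar_mat ?s :: ('g \<Rightarrow>\<^sub>0 complex) mat)" "j < dim_col (scalar_mat ?s :: ('g \<Rightarrow>\<^sub>0 complex) mat)"
    then have "i < k" "j < k" by simp_all
    then show "mat_of_list k ?Z $$ (i, j) = scalar_mat ?s $$ (i, j)"
      by (simp add: mat_of_list_def basis_rows_def row_entry_single)
  qed (simp_all add: lenE)
  ultimately have prod: "mat_list_prod (As @ [scalar_mat ?s]) = A"
    using As(3) by (simp add: foldr_mult_eq_mat_list_prod)
  have f: "is_factorization S D m 1 A (As @ [scalar_mat ?s])"
  proof (rule is_factorizationI[OF A _ _ _ prod])
    show "chain n (As @ [scalar_mat ?s]) k" using As(2) by (simp add: chain_snoc)
    show "dim_row B \<ge> 1 \<and> dim_col B \<ge> 1 \<and> elements_mat B \<subseteq> S" if "B \<in> set (As @ [scalar_mat ?s])" for B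
      using that As(1) k by (auto simp: good_def S_scalar)
  qed simp
  have "N (scalar_mat ?s) \<le> s"
  proof (rule order_trans[OF gen_space_norm_scalar opnorm_le])
    fix v :: "complex vec" assume "v \<in> carrier_vec (dim_col ?s)"
    then have "?s *\<^sub>v v = of_real s \<cdot>\<^sub>v v" by (intro eq_vecI) auto
    then show "l2norm (?s *\<^sub>v v) \<le> s * l2norm v" using s by (simp add: l2norm_smult)
  qed (rule s)
  moreover have "prod_list (map N As) \<le> 1"
    by (rule prod_list_good) (use As(1) in blast)
  moreover have "0 \<le> N (scalar_mat ?s)" using is_factorizationD(2)[OF f, of "scalar_mat ?s"] N_nonneg by simp
  ultimately have "prod_list (map N As) * N (scalar_mat ?s) \<le> 1 * s"
    by (intro mult_mono) auto
  then show ?thesis using fact_norm_le[OF f] by simp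
qed

text \<open>Every representation is bounded on each factor by its quotient norm, hence on the
  product by the product of these norms.\<close>

lemma cstar_le_fact_norm:
  assumes A: "A \<in> mats S n k" and n: "1 \<le> n" "1 \<le> k"
  shows "cstar_mat_norm TYPE('i) A \<le> fact_norm N S D m 1 A"
  unfolding fact_norm_def
proof (rule cInf_greatest)
  show "{prod_list (map N As) | As. is_factorization S D m 1 A As} \<noteq> {}"
    using is_factorization_self[OF A n] by blast
  fix r assume "r \<in> {prod_list (map N As) | As. is_factorization S D m 1 A As}"
  then obtain As where r: "r = prod_list (map N As)" and f: "is_factorization S D m 1 A As" by blast
  note D = is_factorizationD[OF f]
  show "cstar_mat_norm TYPE('i) A \<le> r"
  proof (rule cstar_least)
    show "0 \<le> r" unfolding r by (rule prod_list_nonneg_mats) (rule D(2))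
    fix X :: "'i set" and \<rho> :: "'g \<Rightarrow> ('i \<Rightarrow> complex) \<Rightarrow> 'i \<Rightarrow> complex" assume u: "unitary_rep X \<rho>"
    interpret urep X \<rho> using u by unfold_locales
    have "op_bound (mat_list_prod As) (prod_list (map N As))"
      using D(1-3)
    proof (induction As arbitrary: A rule: mat_list_prod.induct)
      case (2 B)
      then show ?case using op_bound_gen_space_norm(1)[of B a d] by simp
    next
      case (3 B C As)
      have "op_bound (mat_list_prod (C # As)) (prod_list (map N (C # As)))"
      proof (rule 3(1))
        \<comment> \<open>In the induction hypothesis \<open>A\<close> enters only through its size,
          so a zero matrix of the right size stands in for the remaining product.\<close>
        show "chain (dim_row (mat (dim_col B) (dim_col A) (\<lambda>_. 0 :: 'g \<Rightarrow>\<^sub>0 complex))) (C # As)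
            (dim_col (mat (dim_col B) (dim_col A) (\<lambda>_. 0 :: 'g \<Rightarrow>\<^sub>0 complex)))"
          using 3(4) by simp
      qed (use 3(3) in auto)
      moreover have B: "B \<in> mats S (dim_row B) (dim_col B)" using 3(3)[of B] by simp
      moreover have "dim_row (mat_list_prod (C # As)) = dim_col B"
        using mat_list_prod_dim[of "dim_col B" "C # As" "dim_col A"] 3(4) by simp
      ultimately show ?case
        using op_bound_mult[OF op_bound_gen_space_norm(1)[OF B]] N_nonneg[OF B] by simp
    qed simp
    then show "op_bound A r" by (simp only: D(4) r)
  qed
qed

end

section \<open>The standard inner product of finitely supported functions\<close>

definition pm_inner :: "('b \<Rightarrow>\<^sub>0 complex) \<Rightarrow> ('b \<Rightarrow>\<^sub>0 complex) \<Rightarrow> complex" where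
  "pm_inner x y = (\<Sum>p\<in>Poly_Mapping.keys x. cnj (lk x p) * lk y p)"

lemma pm_inner_eq:
  assumes "finite F" "Poly_Mapping.keys x \<inter> Poly_Mapping.keys y \<subseteq> F"
  shows "pm_inner x y = (\<Sum>p\<in>F. cnj (lk x p) * lk y p)"
proof -
  have "pm_inner x y = (\<Sum>p\<in>Poly_Mapping.keys x \<inter> F. cnj (lk x p) * lk y p)"
    unfolding pm_inner_def using assms(2) by (intro sum.mono_neutral_right) (auto simp: in_keys_iff)
  also have "\<dots> = (\<Sum>p\<in>F. cnj (lk x p) * lk y p)"
    using assms(1) by (intro sum.mono_neutral_left) (auto simp: in_keys_iff)
  finally show ?thesis .
qed

lemma pm_inner_self: "Re (pm_inner x x) = (\<Sum>p\<in>Poly_Mapping.keys x. (cmod (lk x p))\<^sup>2)"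
proof -
  have "Re (cnj z * z) = (cmod z)\<^sup>2" for z by (simp add: cmod_def power2_eq_square)
  then show ?thesis by (simp only: pm_inner_def Re_sum)
qed

lemma pm_inner_definite: "Re (pm_inner x x) = 0 \<Longrightarrow> x = 0"
proof -
  assume "Re (pm_inner x x) = 0"
  then have "\<forall>p\<in>Poly_Mapping.keys x. (cmod (lk x p))\<^sup>2 = 0"
    unfolding pm_inner_self by (subst (asm) sum_nonneg_eq_0_iff) simp_all
  then show "x = 0" by (intro poly_mapping_eqI) (metis in_keys_iff lookup_zero norm_eq_zero power_eq_0_iff)
qed

lemma semi_inner_pm_inner: "semi_inner pm_scale (pm_inner :: ('b \<Rightarrow>\<^sub>0 complex) \<Rightarrow> _)"
proof
  fix x y z :: "'b \<Rightarrow>\<^sub>0 complex" and c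
  show "pm_inner x (y + z) = pm_inner x y + pm_inner x z"
    by (simp add: pm_inner_def lookup_add distrib_left sum.distrib)
  show "pm_inner x (pm_scale c y) = c * pm_inner x y"
    by (simp add: pm_inner_def sum_distrib_left mult.left_commute)
  have "pm_inner y x = (\<Sum>p\<in>Poly_Mapping.keys x. cnj (lk y p) * lk x p)"
    by (rule pm_inner_eq) auto
  then show "pm_inner y x = cnj (pm_inner x y)" by (simp add: pm_inner_def mult.commute)
  show "0 \<le> Re (pm_inner x x)" unfolding pm_inner_self by (rule sum_nonneg) simp
qed

text \<open>Translation only permutes the coordinates. The GNS representation of this form is a
  multiple of the left regular representation.\<close>

lemma pm_inner_act: "pm_inner (act g x) (act g y) = pm_inner x y"
  unfolding pm_inner_def
  by (rule sum.reindex_bij_witness[where i = "\<lambda>(z, j). (g + z, j)" and j = "\<lambda>(z, j). (- g + z, j)"])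
    (auto simp: in_keys_iff add.assoc[symmetric])

section \<open>Separation, equality of the norms and the matrix norm axioms\<close>

context presented
begin

text \<open>Each signed generator does not increase the form, and neither does its inverse, so it
  preserves squares. Products of generators inherit this, and polarization, with a factor
  \<open>\<i>\<close> for the imaginary part, extends it to the whole form.\<close>

lemma dual_invariant:
  assumes h: "semi_inner pm_scale h"
    and contr: "\<And>T x. T \<in> gen_actions \<Longrightarrow> Poly_Mapping.keys x \<subseteq> UNIV \<times> {..<n} \<Longrightarrow>
      Poly_Mapping.keys (T x) \<subseteq> UNIV \<times> {..<n} \<Longrightarrow> Re (h (T x) (T x)) \<le> Re (h x x)"
    and x: "x \<in> row_space n" and y: "y \<in> row_space n"
  shows "h (act g x) (act g y) = h x y"
proof -
  interpret h: semi_inner pm_scale h by (rule h)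
  have le: "Re (h (act (signed_gen a t) v) (act (signed_gen a t) v)) \<le> Re (h v v)"
    if "t \<in> {- int d..int d}" "v \<in> row_space n" for t v
    using contr[of "act (signed_gen a t)" v] that act_rows[of v n "signed_gen a t"]
    by (simp add: gen_actions_def row_space_def)
  have step: "Re (h (act (signed_gen a t) v) (act (signed_gen a t) v)) = Re (h v v)"
    if t: "t \<in> {- int d..int d}" and v: "v \<in> row_space n" for t v
  proof (rule antisym[OF le[OF that]])
    have minus: "signed_gen a (- t) = - signed_gen a t" by (simp add: signed_gen_def)
    have t': "- t \<in> {- int d..int d}" using t by simp
    have "act (signed_gen a (- t)) (act (signed_gen a t) v) = v"
      by (simp add: minus act_act)
    then show "Re (h v v) \<le> Re (h (act (signed_gen a t) v) (act (signed_gen a t) v))"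
      using le[OF t' act_rows[OF v, of "signed_gen a t"]] by simp
  qed
  have norm: "Re (h (act g v) (act g v)) = Re (h v v)" if v: "v \<in> row_space n" for g v
  proof (induction g rule: group_induct)
    case (gen t g)
    then show ?case using step[OF gen(1) act_rows[OF v, of g]] by (simp add: act_act)
  qed simp
  have polar: "2 * Re (h u v) = Re (h (u + v) (u + v)) - Re (h u u) - Re (h v v)" for u v
  proof -
    have "Re (h v u) = Re (h u v)" using h.h_sym[of u v] by simp
    then show ?thesis by (simp add: h.h_add h.h_add_left)
  qed
  have re: "Re (h (act g u) (act g v)) = Re (h u v)" if "u \<in> row_space n" "v \<in> row_space n" for u v
    using polar[of "act g u" "act g v"] polar[of u v] norm[OF that(1)] norm[OF that(2)]
      norm[OF pm.subspace_add[OF subspace_rows that]] by (simp add: act_add)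
  have im: "Im (h u v) = Re (h (pm_scale \<i> u) v)" for u v by (simp add: h.h_scale_left)
  have "pm_scale \<i> x \<in> row_space n" using pm.subspace_scale[OF subspace_rows x] .
  from re[OF this y] have "Im (h (act g x) (act g y)) = Im (h x y)" by (simp add: im act_scale)
  then show ?thesis using re[OF x y] by (simp add: complex_eq_iff)
qed

text \<open>The dual form of an unreachable A is invariant, so GNS makes it a unitary
  representation. Mass at most 1 on the unit rows bounds the norm of \<xi>, and mass at least s^2 on
  the rows of A makes the norm of the image at least s.\<close>

lemma cstar_ge:
  fixes A :: "('g \<Rightarrow>\<^sub>0 complex) mat"
  assumes dim: "1 \<le> dim_row A" "1 \<le> dim_col A" and s: "0 \<le> s"
    and not_reach: "\<not> reach (map (row_vec A) [0..<dim_row A]) (map (pm_scale (of_real s)) (basis_rows (dim_col A)))"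
  shows "s \<le> cstar_mat_norm TYPE('i::infinite) A"
proof -
  let ?n = "dim_col A" and ?A = "map (row_vec A) [0..<dim_row A]"
  have n: "0 < ?n" using dim by simp
  interpret rd: reach_duality gen_actions "basis_rows ?n" "UNIV \<times> {..<?n}" by (rule reach_duality[OF n])
  have A_ne: "?A \<noteq> []" using dim by simp
  have A_keys: "Poly_Mapping.keys x \<subseteq> UNIV \<times> {..<?n}" if "x \<in> set ?A" for x
    using that row_vec_rows[of A] by (auto simp: row_space_def)
  obtain h where h: "semi_inner pm_scale h"
    and contr: "\<And>T x. T \<in> gen_actions \<Longrightarrow> Poly_Mapping.keys x \<subseteq> UNIV \<times> {..<?n} \<Longrightarrow>
      Poly_Mapping.keys (T x) \<subseteq> UNIV \<times> {..<?n} \<Longrightarrow> Re (h (T x) (T x)) \<le> Re (h x x)"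
    and E: "(\<Sum>e\<leftarrow>basis_rows ?n. Re (h e e)) \<le> 1" and hA: "s\<^sup>2 \<le> (\<Sum>x\<leftarrow>?A. Re (h x x))"
    by (rule rd.dual_form[OF A_ne A_keys not_reach], assumption, rule that; assumption)
  have inv: "h (act g x) (act g y) = h x y" if "x \<in> row_space ?n" "y \<in> row_space ?n" for g x y
    by (rule dual_invariant[OF h _ that]) (rule contr; assumption)
  obtain X :: "'i set" and \<rho> :: "'g \<Rightarrow> _" and \<xi> where u: "unitary_rep X \<rho>" and \<xi>: "\<forall>j<?n. \<xi> j \<in> ell2 X"
    and norm_\<xi>: "(urep.fam_norm X ?n \<xi>)\<^sup>2 =
      (\<Sum>j<?n. Re (h (Poly_Mapping.single (0, j) 1) (Poly_Mapping.single (0, j) 1)))"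
    and op_\<xi>: "\<forall>A. dim_col A = ?n \<longrightarrow> (urep.fam_norm X (dim_row A) (urep.mat_op \<rho> A \<xi>))\<^sup>2 =
      (\<Sum>i<dim_row A. Re (h (row_vec A i) (row_vec A i)))"
    using gns_representation[where 'i = 'i, OF h countable_group n inv] by blast
  interpret urep X \<rho> using u by unfold_locales
  let ?c = "cstar_mat_norm TYPE('i) A"
  have list: "(\<Sum>i\<leftarrow>[0..<k]. f i) = (\<Sum>i<k. f i)" for k and f :: "nat \<Rightarrow> real"
    by (simp add: interv_sum_list_conv_sum_set_nat atLeast0LessThan)
  have "(fam_norm ?n \<xi>)\<^sup>2 \<le> 1\<^sup>2"
    using E by (simp add: norm_\<xi> basis_rows_def comp_def list)
  then have "fam_norm ?n \<xi> \<le> 1" by (rule power2_le_imp_le) simp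
  then have "?c * fam_norm ?n \<xi> \<le> ?c * 1" by (rule mult_left_mono[OF _ cstar_nonneg])
  moreover have "fam_norm (dim_row A) (mat_op A \<xi>) \<le> ?c * fam_norm ?n \<xi>"
    by (rule op_boundD[OF cstar_upper(2)[OF u]]) (use \<xi> in blast)
  moreover have "s\<^sup>2 \<le> (fam_norm (dim_row A) (mat_op A \<xi>))\<^sup>2"
    using hA op_\<xi> by (simp add: comp_def list)
  then have "s \<le> fam_norm (dim_row A) (mat_op A \<xi>)" by (rule power2_le_imp_le) simp
  ultimately show ?thesis by simp
qed

theorem fact_norm_eq_cstar:
  assumes A: "A \<in> mats S n k" and n: "1 \<le> n" "1 \<le> k"
  shows "fact_norm N S D m 1 A = cstar_mat_norm TYPE('i::infinite) A"
proof (rule antisym)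
  have dim: "dim_row A = n" "dim_col A = k" using mats_dim[OF A] by auto
  show "fact_norm N S D m 1 A \<le> cstar_mat_norm TYPE('i) A"
  \<comment> \<open>Reachability is shown only strictly above the C*-norm, so the bound is obtained
    for each larger \<open>s\<close>.\<close>
  proof (rule dense_ge)
    fix s assume s: "cstar_mat_norm TYPE('i) A < s"
    have s0: "0 \<le> s" using s cstar_nonneg[where 'i = 'i, of A] by simp
    have "reach (map (row_vec A) [0..<n]) (map (pm_scale (of_real s)) (basis_rows k))"
    proof (rule ccontr)
      assume "\<not> reach (map (row_vec A) [0..<n]) (map (pm_scale (of_real s)) (basis_rows k))"
      then have "s \<le> cstar_mat_norm TYPE('i) A"
        by (rule cstar_ge[where 'i = 'i, of A s, unfolded dim, OF n s0])
      then show False using s by simp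
    qed
    then show "fact_norm N S D m 1 A \<le> s" by (rule fact_norm_le_reach[OF A n s0])
  qed
qed (rule cstar_le_fact_norm[OF A n])

text \<open>In the GNS representation of the standard inner product the square of A applied to \<xi>
  is the sum of squares of all coefficients of A, which is 0 only for A = 0.\<close>

lemma cstar_eq_zero:
  fixes A :: "('g \<Rightarrow>\<^sub>0 complex) mat"
  assumes A: "A \<in> carrier_mat n k" and k: "1 \<le> k" and zero: "cstar_mat_norm TYPE('i::infinite) A = 0"
  shows "A = 0\<^sub>m n k"
proof -
  have dim: "dim_row A = n" "dim_col A = k" using A by auto
  have k0: "0 < k" using k by simp
  obtain X :: "'i set" and \<rho> :: "'g \<Rightarrow> _" and \<xi> where u: "unitary_rep X \<rho>" and \<xi>: "\<forall>j<k. \<xi> j \<in> ell2 X"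
    and op_\<xi>: "\<forall>A :: ('g \<Rightarrow>\<^sub>0 complex) mat. dim_col A = k \<longrightarrow> (urep.fam_norm X (dim_row A) (urep.mat_op \<rho> A \<xi>))\<^sup>2 =
      (\<Sum>i<dim_row A. Re (pm_inner (row_vec A i) (row_vec A i)))"
    using gns_representation[where 'i = 'i, OF semi_inner_pm_inner countable_group k0 pm_inner_act] by blast
  interpret urep X \<rho> using u by unfold_locales
  interpret pi: semi_inner pm_scale "pm_inner :: ('g \<times> nat \<Rightarrow>\<^sub>0 complex) \<Rightarrow> _" by (rule semi_inner_pm_inner)
  have "fam_norm (dim_row A) (mat_op A \<xi>) \<le> cstar_mat_norm TYPE('i) A * fam_norm (dim_col A) \<xi>"
    by (rule op_boundD[OF cstar_upper(2)[OF u]]) (use \<xi> dim in simp)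
  then have "fam_norm (dim_row A) (mat_op A \<xi>) = 0" using zero fam_norm_nonneg by (simp add: antisym)
  then have "(\<Sum>i<n. Re (pm_inner (row_vec A i) (row_vec A i))) = 0"
    using op_\<xi>[rule_format, OF dim(2)] by (simp add: dim)
  then have "\<forall>i\<in>{..<n}. Re (pm_inner (row_vec A i) (row_vec A i)) = 0"
    by (subst (asm) sum_nonneg_eq_0_iff) (use pi.h_nonneg in simp_all)
  then have row: "row_vec A i = 0" if "i < n" for i using that pm_inner_definite by blast
  show ?thesis
  proof (rule eq_matI)
    fix i j assume "i < dim_row (0\<^sub>m n k :: ('g \<Rightarrow>\<^sub>0 complex) mat)" "j < dim_col (0\<^sub>m n k :: ('g \<Rightarrow>\<^sub>0 complex) mat)"
    then have ij: "i < n" "j < k" by simp_all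
    have "lk (A $$ (i, j)) g = 0" for g
      using lookup_row_vec[of A i g j] row[OF ij(1)] ij(2) by (simp add: dim)
    then have "A $$ (i, j) = 0" by (intro poly_mapping_eqI) simp
    then show "A $$ (i, j) = 0\<^sub>m n k $$ (i, j)" using ij by simp
  qed (simp_all add: dim)
qed

text \<open>All axioms are transferred from the C*-norm through the equality on square matrices over
  S. What has to be added is that each operation leads to matrices over S again, where the equality
  applies.\<close>

theorem Linf_fact_norm: "Linf_matrix_norm S (fact_norm N S D m 1)"
proof -
  \<comment> \<open>The statement mentions no index type, so \<open>nat\<close> serves as an
    arbitrary infinite one.\<close>
  let ?F = "fact_norm N S D m 1" and ?C = "cstar_mat_norm TYPE(nat)"
  have eq: "?F A = ?C A" if "1 \<le> n" "A \<in> mats S n n" for n A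
    by (rule fact_norm_eq_cstar[OF that(2) that(1) that(1)])
  have carrier: "A \<in> carrier_mat n n" if "A \<in> mats S n n" for A n
    using that by (simp add: mats_iff)
  have S: "pm.subspace S" unfolding gen_space_def by (rule pm.subspace_span)
  show ?thesis
    unfolding Linf_matrix_norm_def
  proof (intro conjI allI impI ballI)
    fix n :: nat and A assume n: "1 \<le> n" and A: "A \<in> mats S n n"
    show "0 \<le> ?F A" by (simp add: eq[OF n A] cstar_nonneg)
    show "?F A = 0 \<longleftrightarrow> A = 0\<^sub>m n n"
      using cstar_eq_zero[OF carrier[OF A] n] by (auto simp: eq[OF n A] cstar_zero)
  next
    fix n :: nat and A c assume n: "1 \<le> n" and A: "A \<in> mats S n n"
    have "mat_scale c A \<in> mats S n n"
      using A pm.subspace_scale[OF S] by (auto simp: mats_iff mat_scale_def)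
    then show "?F (mat_scale c A) = cmod c * ?F A" by (simp add: eq[OF n] A cstar_scale)
  next
    fix n :: nat and A B assume n: "1 \<le> n" and A: "A \<in> mats S n n" and B: "B \<in> mats S n n"
    have "A + B \<in> mats S n n"
      using A B pm.subspace_add[OF S] by (auto simp: mats_iff)
    then show "?F (A + B) \<le> ?F A + ?F B"
      by (simp add: eq[OF n] A B cstar_add[OF carrier[OF A] carrier[OF B]])
  next
    fix n k :: nat and A and \<alpha> \<beta> :: "complex mat"
    assume n: "1 \<le> n" and k: "1 \<le> k" and A: "A \<in> mats S n n"
      and \<alpha>: "\<alpha> \<in> carrier_mat n k" and \<beta>: "\<beta> \<in> carrier_mat n k"
    let ?B = "sandwich (mat_adjoint \<alpha>) A \<beta>"
    have dim: "dim_row A = n" "dim_col A = n" using mats_dim[OF A] by auto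
    have "?B \<in> mats S k k"
    proof (rule matsI)
      show "?B \<in> carrier_mat k k" using \<alpha> \<beta> by (auto simp: sandwich_def)
      fix i j assume "i < k" "j < k"
      then have "?B $$ (i, j) = (\<Sum>p<n. \<Sum>q<n. pm_scale (mat_adjoint \<alpha> $$ (i, p) * \<beta> $$ (q, j)) (A $$ (p, q)))"
        using \<alpha> \<beta> by (simp add: sandwich_def dim)
      also have "\<dots> \<in> S"
        by (intro pm.subspace_sum[OF S] pm.subspace_scale[OF S] matsD[OF A]) simp_all
      finally show "?B $$ (i, j) \<in> S" .
    qed
    then have "?F ?B = ?C ?B" by (rule eq[OF k])
    also have "\<dots> \<le> opnorm (mat_adjoint \<alpha>) * (?C A * opnorm \<beta>)"
      by (rule cstar_sandwich) (use \<alpha> \<beta> dim in auto)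
    also have "\<dots> \<le> opnorm \<alpha> * (?C A * opnorm \<beta>)"
      by (intro mult_right_mono opnorm_adjoint_le mult_nonneg_nonneg cstar_nonneg opnorm_nonneg)
    finally show "?F ?B \<le> opnorm \<alpha> * ?F A * opnorm \<beta>" by (simp add: eq[OF n A] mult.assoc)
  next
    fix n k :: nat and A B
    assume n: "1 \<le> n" and k: "1 \<le> k" and A: "A \<in> mats S n n" and B: "B \<in> mats S k k"
    have "direct_sum_mat A B \<in> mats S (n + k) (n + k)"
    proof (rule matsI)
      show "direct_sum_mat A B \<in> carrier_mat (n + k) (n + k)"
        using carrier[OF A] carrier[OF B] by (simp add: direct_sum_mat_def)
      fix i j assume "i < n + k" "j < n + k"
      then show "direct_sum_mat A B $$ (i, j) \<in> S"
        using mats_dim[OF A] mats_dim[OF B] matsD[OF A] matsD[OF B] S_zero by (simp add: direct_sum_mat_def)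
    qed
    moreover have "1 \<le> n + k" using n by simp
    ultimately have "?F (direct_sum_mat A B) = ?C (direct_sum_mat A B)" by (intro eq)
    then show "?F (direct_sum_mat A B) = max (?F A) (?F B)"
      by (simp add: eq[OF n A] eq[OF k B] cstar_direct_sum)
  qed
qed

end

theorem theorem6p11:
  fixes a :: "nat \<Rightarrow> 'g::group_add"
    and d :: nat
    and R :: "((nat \<times> int) \<times> (nat \<times> int) \<times> (nat \<times> int)) set"
    and S :: "('g \<Rightarrow>\<^sub>0 complex) set"
    and D :: "(('g \<Rightarrow>\<^sub>0 complex) \<times> ('g \<Rightarrow>\<^sub>0 complex)) set"
    and m :: "('g \<Rightarrow>\<^sub>0 complex) \<times> ('g \<Rightarrow>\<^sub>0 complex) \<Rightarrow> ('g \<Rightarrow>\<^sub>0 complex)"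
  assumes "finite R"
    and "\<And>i x j y k z. ((i, x), (j, y), (k, z)) \<in> R \<Longrightarrow>
           {i, j, k} \<subseteq> {1..d} \<and> {x, y, z} \<subseteq> {- 1, 0, 1}"
    and "presented_by a d (relation_words R)"
    and "S = gen_space a d"
    and "D = {(s, t). s \<in> S \<and> t \<in> S \<and> s * t \<in> S}"
    and "\<And>s t. (s, t) \<in> D \<Longrightarrow> m (s, t) = s * t"
  shows "Linf_matrix_norm S (fact_norm (gen_space_norm a d) S D m 1) \<and>
         (\<forall>n\<ge>1. \<forall>A\<in>mats S n n.
            fact_norm (gen_space_norm a d) S D m 1 A = cstar_mat_norm TYPE('i::infinite) A)"
proof -
  interpret presented a d m R
  proof
    fix s t
    assume "(s, t) \<in> {(s, t). s \<in> gen_space a d \<and> t \<in> gen_space a d \<and> s * t \<in> gen_space a d}"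
    then show "m (s, t) = s * t" by (intro assms(6)) (simp only: assms(4,5))
  qed (rule assms(2), assumption, rule assms(3))
  show ?thesis
    unfolding assms(4,5) using Linf_fact_norm fact_norm_eq_cstar by blast
qed

end
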